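(* Let $R$ be a PID containing $\mathbb{Q}$ and let $B:=R[X,Y,Z]$ be the polynomial ring in three variables over $R$. Let $D\neq 0$ be a locally nilpotent $R$-derivation of $B$ and let $A:=\operatorname{Ker} D$. Suppose that $D$ is irreducible and $D^{2}X=D^{2}Y=D^{2}Z=0$. Then there exists a coordinate system $(U,V,W)$ of $B$ related to $(X,Y,Z)$ by a linear change such that the following hold: (i) $A$ contains a nonzero linear form in $X,Y,Z$ (with coefficients in $R$). (ii) $\operatorname{rank} D\leq 2$. In particular, $A=R^{[2]}$. (iii) $A=R[U,\,gV-fW]$, where $DV=f$, $DW=g$, and $f,g\in R[U]$ are such that $\gcd_{R[U]}(f,g)=1$. (iv) Either $f$ and $g$ are comaximal in $B$ or they form a regular sequence in $B$. Moreover, if they are comaximal (i.e., $D$ is fixed-point free), then $B=A^{[1]}$ and $\operatorname{rank} D=1$; and if they form a regular sequence, then $B$ is not $A$-flat and $\operatorname{rank} D=2$.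
   Context: Rings are commutative with unity. For a ring $S$ and an $S$-algebra $C$, $C=S^{[n]}$ means that $C$ is isomorphic, as an $S$-algebra, to a polynomial ring in $n$ variables over $S$. A coordinate system of $B=R^{[n]}$ is an $n$-tuple $(T_1,\dots,T_n)$ of elements of $B$ with $B=R[T_1,\dots,T_n]$. A coordinate system $(U,V,W)$ of $R[X,Y,Z]$ is related to $(X,Y,Z)$ by a linear change if $(U,V,W)^{T}=M(X,Y,Z)^{T}$ for some $M\in GL_3(R)$. An $R$-derivation $D$ of $B$ is locally nilpotent if for each $b\in B$ there is $n$ with $D^n b=0$. $D$ is reducible if there is a non-unit $b\in B$ with $DB\subseteq bB$, and irreducible otherwise. $D$ is fixed-point free if the ideal of $B$ generated by $DB$ is $B$. For a locally nilpotent $R$-derivation $D$ of $B=R^{[n]}$ with kernel $A$, $\operatorname{rank} D$ is the least integer $i$ for which there is a coordinate system $(X_1,\dots,X_n)$ of $B$ with $R[X_{i+1},\dots,X_n]\subseteq A$. Elements $f,g$ are comaximal in $B$ if $(f,g)B=B$. A regular sequence $f,g$ in $B$ is (as usual) required to satisfy $(f,g)B\neq B$. *)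

theory Defs
  imports
    "HOL-Analysis.Cartesian_Space"
    "HOL-Algebra.Algebra"
    "HOL-Computational_Algebra.Polynomial"
    "HOL-Library.Poly_Mapping"
begin

section \<open>Subrings of a type-class ring as HOL-Algebra rings\<close>

definition ring_on :: "'b::comm_ring_1 set \<Rightarrow> 'b ring" where
  "ring_on S = \<lparr>carrier = S, monoid.mult = (*), one = 1, ring.zero = 0, ring.add = (+)\<rparr>"

text \<open>\<open>adjoin S T\<close> is the \<open>S\<close>-subalgebra \<open>S[T]\<close> of the ambient ring.\<close>
definition adjoin :: "'b::comm_ring_1 set \<Rightarrow> 'b set \<Rightarrow> 'b set" where
  "adjoin S T = generate_ring (ring_on UNIV) (S \<union> T)"

text \<open>The polynomial ring \<open>S[x\<^sub>0, \<dots>, x\<^sub>n\<^sub>-\<^sub>1]\<close> over a subring \<open>S\<close>, as a set of finitely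
  supported maps from exponent vectors to coefficients.\<close>
definition mpolys :: "nat \<Rightarrow> 'b::comm_ring_1 set \<Rightarrow> ((nat \<Rightarrow>\<^sub>0 nat) \<Rightarrow>\<^sub>0 'b) set" where
  "mpolys n S = {p. (\<forall>m. Poly_Mapping.lookup p m \<in> S) \<and> (\<forall>m \<in> Poly_Mapping.keys p. Poly_Mapping.keys m \<subseteq> {..<n})}"

text \<open>\<open>C = S\<^bsup>[n]\<^esup>\<close>, for subrings \<open>S \<subseteq> C\<close>; \<open>single 0 s\<close> is the constant polynomial \<open>s\<close>.\<close>
definition is_poly_algebra :: "nat \<Rightarrow> 'b::comm_ring_1 set \<Rightarrow> 'b set \<Rightarrow> bool" where
  "is_poly_algebra n S C \<longleftrightarrow>
     (\<exists>h \<in> ring_iso (ring_on (mpolys n S)) (ring_on C). \<forall>s\<in>S. h (Poly_Mapping.single 0 s) = s)"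

text \<open>The ambient ring is understood to be a polynomial ring in \<open>n\<close> variables over \<open>S\<close>.\<close>
definition coordinate_system :: "nat \<Rightarrow> 'b::comm_ring_1 set \<Rightarrow> 'b list \<Rightarrow> bool" where
  "coordinate_system n S Ts \<longleftrightarrow> length Ts = n \<and> adjoin S (set Ts) = UNIV"

definition comaximal :: "'b::comm_ring_1 \<Rightarrow> 'b \<Rightarrow> bool" where
  "comaximal f g \<longleftrightarrow> genideal (ring_on UNIV) {f, g} = UNIV"

definition regular_sequence :: "'b::comm_ring_1 \<Rightarrow> 'b \<Rightarrow> bool" where
  "regular_sequence f g \<longleftrightarrow>
     (\<forall>b. f * b = 0 \<longrightarrow> b = 0) \<and> (\<forall>b. f dvd g * b \<longrightarrow> f dvd b) \<and>
     genideal (ring_on UNIV) {f, g} \<noteq> UNIV"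


section \<open>Derivations\<close>

definition derivation :: "'b::comm_ring_1 set \<Rightarrow> ('b \<Rightarrow> 'b) \<Rightarrow> bool" where
  "derivation S D \<longleftrightarrow>
     (\<forall>a b. D (a + b) = D a + D b) \<and> (\<forall>s\<in>S. \<forall>b. D (s * b) = s * D b) \<and>
     (\<forall>a b. D (a * b) = a * D b + D a * b)"

definition locally_nilpotent :: "('b::comm_ring_1 \<Rightarrow> 'b) \<Rightarrow> bool" where
  "locally_nilpotent D \<longleftrightarrow> (\<forall>b. \<exists>n. (D ^^ n) b = 0)"

definition reducible_der :: "('b::comm_ring_1 \<Rightarrow> 'b) \<Rightarrow> bool" where
  "reducible_der D \<longleftrightarrow> (\<exists>b. \<not> b dvd 1 \<and> (\<forall>h. b dvd D h))"

definition fixed_point_free :: "('b::comm_ring_1 \<Rightarrow> 'b) \<Rightarrow> bool" where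
  "fixed_point_free D \<longleftrightarrow> genideal (ring_on UNIV) (range D) = UNIV"

definition Ker :: "('b::comm_ring_1 \<Rightarrow> 'b) \<Rightarrow> 'b set" where
  "Ker D = {b. D b = 0}"

definition rank_der :: "nat \<Rightarrow> 'b::comm_ring_1 set \<Rightarrow> ('b \<Rightarrow> 'b) \<Rightarrow> nat" where
  "rank_der n S D =
     (LEAST i. i \<le> n \<and> (\<exists>Xs. coordinate_system n S Xs \<and> adjoin S (set (drop i Xs)) \<subseteq> Ker D))"


section \<open>Tensor products and flatness\<close>

text \<open>The tensor product \<open>M \<otimes>\<^sub>A N\<close> of modules, as the quotient of the free abelian group on
  \<open>M \<times> N\<close> by the bilinearity and balancing relations.\<close>

definition tensor_rels ::
  "('a, 'c) ring_scheme \<Rightarrow> ('a, 'm, 'd) module_scheme \<Rightarrow> ('a, 'n, 'e) module_scheme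
   \<Rightarrow> ('m \<times> 'n \<Rightarrow>\<^sub>0 int) set" where
  "tensor_rels A M N =
     {frag_of (x \<oplus>\<^bsub>M\<^esub> x', y) - frag_of (x, y) - frag_of (x', y) | x x' y.
        x \<in> carrier M \<and> x' \<in> carrier M \<and> y \<in> carrier N} \<union>
     {frag_of (x, y \<oplus>\<^bsub>N\<^esub> y') - frag_of (x, y) - frag_of (x, y') | x y y'.
        x \<in> carrier M \<and> y \<in> carrier N \<and> y' \<in> carrier N} \<union>
     {frag_of (a \<odot>\<^bsub>M\<^esub> x, y) - frag_of (x, a \<odot>\<^bsub>N\<^esub> y) | a x y.
        a \<in> carrier A \<and> x \<in> carrier M \<and> y \<in> carrier N}"

definition tensor_null ::
  "('a, 'c) ring_scheme \<Rightarrow> ('a, 'm, 'd) module_scheme \<Rightarrow> ('a, 'n, 'e) module_scheme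
   \<Rightarrow> ('m \<times> 'n \<Rightarrow>\<^sub>0 int) set" where
  "tensor_null A M N =
     generate (free_Abelian_group (carrier M \<times> carrier N)) (tensor_rels A M N)"

definition tensor ::
  "('a, 'c) ring_scheme \<Rightarrow> ('a, 'm, 'd) module_scheme \<Rightarrow> ('a, 'n, 'e) module_scheme
   \<Rightarrow> ('m \<times> 'n \<Rightarrow>\<^sub>0 int) set monoid" where
  "tensor A M N = free_Abelian_group (carrier M \<times> carrier N) Mod tensor_null A M N"

text \<open>The map \<open>\<phi> \<otimes> id : M \<otimes> N \<rightarrow> M' \<otimes> N\<close> on cosets; every representative \<open>c\<close> of a coset gives
  the same member of the union.\<close>
definition tensor_map ::
  "('a, 'c) ring_scheme \<Rightarrow> ('a, 'm', 'd) module_scheme \<Rightarrow> ('a, 'n, 'e) module_scheme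
   \<Rightarrow> ('m \<Rightarrow> 'm') \<Rightarrow> ('m \<times> 'n \<Rightarrow>\<^sub>0 int) set \<Rightarrow> ('m' \<times> 'n \<Rightarrow>\<^sub>0 int) set" where
  "tensor_map A M' N \<phi> K =
     (\<Union>c\<in>K. tensor_null A M' N #>\<^bsub>free_Abelian_group (carrier M' \<times> carrier N)\<^esub>
              frag_extend (\<lambda>(x, y). frag_of (\<phi> x, y)) c)"

definition linear_maps ::
  "('a, 'c) ring_scheme \<Rightarrow> ('a, 'm, 'd) module_scheme \<Rightarrow> ('a, 'n, 'e) module_scheme
   \<Rightarrow> ('m \<Rightarrow> 'n) set" where
  "linear_maps A M N =
     {\<phi> \<in> carrier M \<rightarrow> carrier N.
        (\<forall>x\<in>carrier M. \<forall>y\<in>carrier M. \<phi> (x \<oplus>\<^bsub>M\<^esub> y) = \<phi> x \<oplus>\<^bsub>N\<^esub> \<phi> y) \<and>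
        (\<forall>a\<in>carrier A. \<forall>x\<in>carrier M. \<phi> (a \<odot>\<^bsub>M\<^esub> x) = a \<odot>\<^bsub>N\<^esub> \<phi> x)}"

text \<open>An \<open>A\<close>-module \<open>F\<close> is flat if \<open>- \<otimes>\<^sub>A F\<close> preserves injectivity. The test modules \<open>M\<close> and \<open>M'\<close>
  have to live on one fixed type; the element type of \<open>A\<close> is large enough, as it carries
  \<open>A\<close> and all its ideals, for which injectivity of \<open>I \<otimes> F \<rightarrow> A \<otimes> F\<close> already implies flatness.
  The definition presupposes that \<open>F\<close> is an \<open>A\<close>-module rather than asserting it, so \<open>\<not> flat\<close>
  never holds merely because \<open>F\<close> fails to be a module.\<close>
definition flat :: "('a, 'c) ring_scheme \<Rightarrow> ('a, 'b, 'd) module_scheme \<Rightarrow> bool" where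
  "flat A F \<longleftrightarrow>
     (\<forall>(M :: ('a, 'a) module) (M' :: ('a, 'a) module) \<phi>.
        Module.module A M \<and> Module.module A M' \<and> \<phi> \<in> linear_maps A M M' \<and> inj_on \<phi> (carrier M) \<longrightarrow>
        inj_on (tensor_map A M' F \<phi>) (carrier (tensor A M F)))"

text \<open>The ambient ring as a module over its subrings.\<close>
definition ambient_module :: "('b::comm_ring_1, 'b) module" where
  "ambient_module = \<lparr>carrier = UNIV, monoid.mult = (*), one = 1, ring.zero = 0, ring.add = (+), module.smult = (*)\<rparr>"


section \<open>The ring \<open>R[X,Y,Z]\<close>\<close>

type_synonym 'r poly3 = "'r poly poly poly"

definition const3 :: "'r::comm_ring_1 \<Rightarrow> 'r poly3" where
  "const3 c = [:[:[:c:]:]:]"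

definition varX :: "'r::comm_ring_1 poly3" where "varX = [:[:[:0, 1:]:]:]"
definition varY :: "'r::comm_ring_1 poly3" where "varY = [:[:0, 1:]:]"
definition varZ :: "'r::comm_ring_1 poly3" where "varZ = [:0, 1:]"

definition scalars :: "'r::comm_ring_1 poly3 set" where
  "scalars = range const3"

definition linear_change :: "'r::comm_ring_1 poly3 \<Rightarrow> 'r poly3 \<Rightarrow> 'r poly3 \<Rightarrow> bool" where
  "linear_change U V W \<longleftrightarrow>
     (\<exists>M :: 'r^3^3. invertible M \<and>
        (vector [U, V, W] :: 'r poly3 ^ 3) = (\<chi> i j. const3 (M $ i $ j)) *v vector [varX, varY, varZ])"

end

theory Submission
  imports Defs "HOL-Computational_Algebra.Polynomial_Factorial"
begin

text \<open>
  Let \<open>B = R[X,Y,Z]\<close>, let \<open>K\<close> be the field of fractions of \<open>R\<close>, and let \<open>F = (DX, DY, DZ)\<close>. Since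
  \<open>D\<^sup>2\<close> kills the variables, the flow of \<open>D\<close> is \<open>v \<mapsto> v + t F(v)\<close>, and in characteristic \<open>0\<close> the
  elements of \<open>Ker D\<close> are constant along it (\<open>flow_kernel\<close>). In particular \<open>F(v + t F(v)) = F(v)\<close>
  at all points \<open>v\<close> of \<open>K\<^sup>3\<close>: the polynomial map \<open>F\<close> is a quasi-translation. Its form \<open>G\<close> of
  highest degree is one too, and \<open>G(F(v)) = 0\<close>, because \<open>F\<close> is bounded along the lines
  \<open>v + t F(v)\<close>.

  A linear form in the kernel is a linear relation between \<open>DX\<close>, \<open>DY\<close> and \<open>DZ\<close>. To find one, consider
  in the projective plane the lines that join \<open>v\<close> to \<open>G(v)\<close>. Two of them always meet, and as \<open>G\<close> is
  constant along each, they can only meet in the points \<open>G(v)\<close>; this forces \<open>G\<close> to have a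
  constant direction \<open>c\<close> (\<open>homogeneous_quasi_translation_direction\<close>). Then \<open>G\<close> is invariant under
  translation by \<open>c\<close>, so it is a binary form in two linear forms that vanish at \<open>c\<close>, and
  \<open>G(F(v)) = 0\<close> is a homogeneous relation between the values of these two forms on \<open>F\<close>. A binary
  form is a product of linear factors up to factors without zeros, so one linear factor vanishes on
  \<open>F\<close> (\<open>binary_form_dependence\<close>, \<open>quasi_translation_dependent_3\<close>).

  Over a principal ideal domain the linear form can be made primitive and completed to a linear
  change of coordinates \<open>U, V, W\<close> with \<open>D U = 0\<close>. The same reasoning in the two variables \<open>V, W\<close>
  over the field of fractions of \<open>R[U]\<close> shows that \<open>f = D V\<close> and \<open>g = D W\<close> are dependent over
  \<open>R[U]\<close>. Hence they are multiples of one element by elements of \<open>R[U]\<close>, and that element is a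
  unit because \<open>D\<close> is irreducible. So \<open>f\<close> and \<open>g\<close> lie in \<open>R[U]\<close>, are coprime there, and satisfy
  \<open>s f + t g = k\<close> with \<open>s, t\<close> in \<open>R[U]\<close> and a nonzero constant \<open>k\<close> (\<open>coefficients_univariate\<close>).

  Up to the constant \<open>k\<close> the element \<open>s V + t W\<close> is a slice, so up to powers of \<open>k\<close> the kernel is
  generated by \<open>U\<close> and \<open>p = g V - f W\<close>. The powers of \<open>k\<close> disappear since no prime of \<open>R\<close> divides
  both \<open>f\<close> and \<open>g\<close> (\<open>kernel_normal_form\<close>). The same elimination of primes shows that \<open>f, g\<close> is a
  regular sequence unless \<open>f\<close> and \<open>g\<close> are comaximal. If they are comaximal there is an honest slice,
  and \<open>B\<close> is a polynomial ring over \<open>Ker D\<close>. Otherwise \<open>p\<close> is a non-zero-divisor modulo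
  \<open>(f, g) Ker D\<close> but is zero modulo the proper ideal \<open>(f, g) B\<close>, which contradicts flatness
  (\<open>not_flat_of_relation\<close>); and the rank is not \<open>1\<close>, as a derivation of rank \<open>1\<close> is a multiple of the
  value at one coordinate, which irreducibility makes a unit.
\<close>

section \<open>Subrings, ideals and divisibility in type-class terms\<close>

lemma ring_on_simps [simp]:
  "carrier (ring_on S) = S" "monoid.mult (ring_on S) = (*)" "one (ring_on S) = 1"
  "ring.zero (ring_on S) = 0" "ring.add (ring_on S) = (+)"
  by (simp_all add: ring_on_def)

definition subring_closed :: "'b::comm_ring_1 set \<Rightarrow> bool" where
  "subring_closed S \<longleftrightarrow> 1 \<in> S \<and> (\<forall>x\<in>S. -x \<in> S) \<and> (\<forall>x\<in>S. \<forall>y\<in>S. x + y \<in> S \<and> x * y \<in> S)"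

lemma subring_closed_0: "subring_closed S \<Longrightarrow> 0 \<in> S"
  unfolding subring_closed_def by (metis add.right_inverse)

lemma cring_ring_on:
  assumes "subring_closed S" shows "cring (ring_on S)"
proof (rule cringI)
  show "abelian_group (ring_on S)"
  proof (rule abelian_groupI; simp)
    show "\<And>x y. x \<in> S \<Longrightarrow> y \<in> S \<Longrightarrow> x + y \<in> S" using assms by (auto simp: subring_closed_def)
    show "0 \<in> S" using subring_closed_0[OF assms] .
    show "\<exists>y\<in>S. y + x = 0" if "x \<in> S" for x
      using assms that by (intro bexI[of _ "-x"]) (auto simp: subring_closed_def)
  qed
  show "Group.comm_monoid (ring_on S)"
    by (rule comm_monoidI) (use assms in \<open>auto simp: subring_closed_def algebra_simps\<close>)
qed (auto simp: algebra_simps)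

lemma subring_closed_UNIV: "subring_closed UNIV"
  by (simp add: subring_closed_def)

lemma a_inv_ring_on:
  assumes "subring_closed S" "x \<in> S" shows "a_inv (ring_on S) x = - x"
proof -
  interpret cring "ring_on S" by (rule cring_ring_on[OF assms(1)])
  show ?thesis
    using minus_equality[of "-x" x] assms by (auto simp: subring_closed_def)
qed

lemma subring_adjoin: "subring_closed (adjoin S T)"
  unfolding subring_closed_def adjoin_def
  by (metis UNIV_I a_inv_ring_on generate_ring.a_inv generate_ring.eng_add generate_ring.eng_mult
      generate_ring.one ring_on_simps(2,3,5) subring_closed_UNIV)

lemma adjoin_incl: "x \<in> S \<union> T \<Longrightarrow> x \<in> adjoin S T"
  unfolding adjoin_def by (rule generate_ring.incl)

lemma adjoin_least:
  assumes C: "subring_closed C" and "S \<subseteq> C" "T \<subseteq> C"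
  shows "adjoin S T \<subseteq> C"
proof
  fix x assume "x \<in> adjoin S T"
  then have "x \<in> generate_ring (ring_on UNIV) (S \<union> T)" by (simp add: adjoin_def)
  then show "x \<in> C"
    by induction (use assms in \<open>auto simp: a_inv_ring_on[OF subring_closed_UNIV] subring_closed_def\<close>)
qed

lemma subring_closed_diff: "subring_closed S \<Longrightarrow> x \<in> S \<Longrightarrow> y \<in> S \<Longrightarrow> x - y \<in> S"
  unfolding subring_closed_def by (metis add_uminus_conv_diff)

lemma subring_closed_power: "subring_closed S \<Longrightarrow> x \<in> S \<Longrightarrow> x ^ n \<in> S"
  by (induction n) (auto simp: subring_closed_def)

subsection \<open>Ideals of the ambient ring\<close>

definition ideal_closed :: "'b::comm_ring_1 set \<Rightarrow> bool" where
  "ideal_closed I \<longleftrightarrow> 0 \<in> I \<and> (\<forall>x\<in>I. \<forall>y\<in>I. x + y \<in> I) \<and> (\<forall>x\<in>I. \<forall>r. r * x \<in> I)"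

lemma ideal_closed_minus: "ideal_closed I \<Longrightarrow> x \<in> I \<Longrightarrow> - x \<in> I"
  unfolding ideal_closed_def by (metis mult_minus1)

lemma ideal_closed_diff: "ideal_closed I \<Longrightarrow> x \<in> I \<Longrightarrow> y \<in> I \<Longrightarrow> x - y \<in> I"
  using ideal_closed_minus[of I y] unfolding ideal_closed_def by (metis add_uminus_conv_diff)

lemma ideal_iff_closed: "ideal I (ring_on UNIV) \<longleftrightarrow> ideal_closed I"
proof
  assume "ideal I (ring_on UNIV)"
  then interpret ideal I "ring_on UNIV" .
  show "ideal_closed I"
    using additive_subgroup.zero_closed[OF is_additive_subgroup]
      additive_subgroup.a_closed[OF is_additive_subgroup] I_l_closed
    by (auto simp: ideal_closed_def)
next
  assume I: "ideal_closed I"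
  interpret cring "ring_on (UNIV :: 'a set)" by (rule cring_ring_on[OF subring_closed_UNIV])
  show "ideal I (ring_on UNIV)"
  proof (rule idealI)
    show "ring (ring_on (UNIV :: 'a set))" by (rule ring_axioms)
    have inv: "\<ominus>\<^bsub>ring_on UNIV\<^esub> x = - x" for x :: 'a
      using a_inv_ring_on[OF subring_closed_UNIV, of x] by simp
    show "subgroup I (add_monoid (ring_on UNIV))"
      by (rule add.subgroupI)
        (use I inv ideal_closed_minus[OF I] in \<open>auto simp: ideal_closed_def simp flip: a_inv_def\<close>)
  qed (use I in \<open>auto simp: ideal_closed_def mult.commute\<close>)
qed

lemma genideal_eq:
  "genideal (ring_on UNIV) S = \<Inter> {I. ideal_closed I \<and> S \<subseteq> I}"
  by (simp add: genideal_def ideal_iff_closed)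

lemma ideal_closed_two: "ideal_closed {a * f + b * g | a b. True}"
proof -
  have 1: "\<exists>a b. 0 = a * f + b * g" by (intro exI[of _ 0]) auto
  have 2: "\<exists>a b. a1 * f + b1 * g + (a2 * f + b2 * g) = a * f + b * g" for a1 b1 a2 b2
    by (intro exI[of _ "a1 + a2"] exI[of _ "b1 + b2"]) (simp add: algebra_simps)
  have 3: "\<exists>a b. r * (a1 * f + b1 * g) = a * f + b * g" for r a1 b1
    by (intro exI[of _ "r * a1"] exI[of _ "r * b1"]) (simp add: algebra_simps)
  show ?thesis unfolding ideal_closed_def using 1 2 3 by auto
qed

lemma genideal_two:
  "genideal (ring_on UNIV) {f, g} = {a * f + b * g | a b. True}" (is "_ = ?J")
proof
  have "f \<in> ?J" "g \<in> ?J"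
    by (simp, intro exI[of _ 1] exI[of _ 0], simp) (simp, intro exI[of _ 0] exI[of _ 1], simp)
  then show "genideal (ring_on UNIV) {f, g} \<subseteq> ?J"
    unfolding genideal_eq using ideal_closed_two[of f g] by (intro Inter_lower) auto
  show "?J \<subseteq> genideal (ring_on UNIV) {f, g}"
    unfolding genideal_eq by (auto simp: ideal_closed_def)
qed

lemma comaximal_iff: "comaximal f g \<longleftrightarrow> (\<exists>a b. a * f + b * g = 1)"
proof
  assume "comaximal f g"
  then have "1 \<in> {a * f + b * g | a b. True}" by (simp add: comaximal_def genideal_two)
  then obtain a b where "1 = a * f + b * g" by auto
  then show "\<exists>a b. a * f + b * g = 1" by metis
next
  assume "\<exists>a b. a * f + b * g = 1"
  then obtain a b where ab: "a * f + b * g = 1" by blast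
  have "x \<in> {a * f + b * g | a b. True}" for x
  proof -
    have "x = (x * a) * f + (x * b) * g" using ab by (metis distrib_left mult.assoc mult.right_neutral)
    then show ?thesis by blast
  qed
  then show "comaximal f g" by (auto simp: comaximal_def genideal_two)
qed

subsection \<open>Principal ideal domains\<close>

definition principal_ideals :: "'r::idom itself \<Rightarrow> bool" where
  "principal_ideals _ \<longleftrightarrow> (\<forall>I :: 'r set. ideal_closed I \<longrightarrow> (\<exists>a. \<forall>x. x \<in> I \<longleftrightarrow> a dvd x))"

lemma principal_idealsI:
  assumes "principal_domain (ring_on (UNIV :: 'r::idom set))"
  shows "principal_ideals TYPE('r)"
  unfolding principal_ideals_def
proof (intro allI impI)
  interpret principal_domain "ring_on (UNIV :: 'r set)" by (rule assms)
  fix I :: "'r set" assume "ideal_closed I"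
  then have "ideal I (ring_on UNIV)" by (simp add: ideal_iff_closed)
  then obtain a where a: "I = PIdl\<^bsub>ring_on UNIV\<^esub> a" using exists_gen by auto
  have "x \<in> I \<longleftrightarrow> a dvd x" for x
    unfolding a cgenideal_def by (auto simp: dvd_def mult.commute)
  then show "\<exists>a. \<forall>x. x \<in> I \<longleftrightarrow> a dvd x" by blast
qed

lemma bezout:
  fixes a b :: "'r::idom"
  assumes "principal_ideals TYPE('r)"
  obtains d x y where "d dvd a" "d dvd b" "x * a + y * b = d"
proof -
  obtain d where d: "\<And>z. z \<in> {x * a + y * b | x y. True} \<longleftrightarrow> d dvd z"
    using assms ideal_closed_two[of a b] unfolding principal_ideals_def by metis
  have "d dvd a" unfolding d[symmetric] by (simp, intro exI[of _ 1] exI[of _ 0], simp)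
  moreover have "d dvd b" unfolding d[symmetric] by (simp, intro exI[of _ 0] exI[of _ 1], simp)
  moreover have "\<exists>x y. x * a + y * b = d" using d[of d] by simp metis
  ultimately show ?thesis using that by blast
qed

text \<open>The union of the ascending chain of ideals generated by the \<open>x n\<close> is principal, and its generator
  already lies in one of them.\<close>
lemma divisor_chain:
  fixes x :: "nat \<Rightarrow> 'r::idom"
  assumes pid: "principal_ideals TYPE('r)" and chain: "\<And>n. x (Suc n) dvd x n"
  shows "\<exists>n. x n dvd x (Suc n)"
proof -
  define I where "I = {z. \<exists>n. x n dvd z}"
  have mono: "x (n + k) dvd x n" for n k
    by (induction k) (auto intro: dvd_trans chain)
  have "ideal_closed I"
    unfolding ideal_closed_def
  proof (intro conjI ballI allI)
    show "0 \<in> I" unfolding I_def by auto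
    show "r * z \<in> I" if "z \<in> I" for r z using that dvd_mult unfolding I_def by blast
    fix y z assume "y \<in> I" "z \<in> I"
    then obtain m n where "x m dvd y" "x n dvd z" unfolding I_def by auto
    then have "x (m + n) dvd y" "x (m + n) dvd z"
      using mono[of m n] mono[of n m] by (auto simp: add.commute intro: dvd_trans)
    then show "y + z \<in> I" unfolding I_def by (auto intro: dvd_add)
  qed
  then obtain a where a: "\<And>z. z \<in> I \<longleftrightarrow> a dvd z"
    using pid unfolding principal_ideals_def by metis
  then have "a \<in> I" by simp
  then obtain n where "x n dvd a" unfolding I_def by auto
  moreover have "x (Suc n) \<in> I" unfolding I_def using dvd_refl by blast
  then have "a dvd x (Suc n)" by (simp add: a)
  ultimately show ?thesis using dvd_trans by blast
qed

lemma minimal_divisor: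
  fixes c :: "'r::idom"
  assumes pid: "principal_ideals TYPE('r)" and "Q c"
  obtains x where "Q x" "\<And>y. y dvd x \<Longrightarrow> Q y \<Longrightarrow> x dvd y"
proof (rule ccontr)
  assume "\<not> thesis"
  then have *: "\<And>x. Q x \<Longrightarrow> \<exists>y. Q y \<and> y dvd x \<and> \<not> x dvd y" using that by blast
  obtain x where "\<And>n. Q (x n)" "\<And>n. x (Suc n) dvd x n \<and> \<not> x n dvd x (Suc n)"
    using dependent_nat_choice[of "\<lambda>_. Q" "\<lambda>_ x y. y dvd x \<and> \<not> x dvd y"] * \<open>Q c\<close> by metis
  then show False using divisor_chain[OF pid, of x] by blast
qed

text \<open>A non-unit divisor of \<open>c\<close> that is minimal for divisibility is irreducible, and Bezout's identity
  makes it prime.\<close>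
lemma prime_divisor_exists:
  fixes c :: "'r::idom"
  assumes pid: "principal_ideals TYPE('r)" and "c \<noteq> 0" "\<not> c dvd 1"
  obtains p where "prime_elem p" "p dvd c"
proof -
  obtain p where p: "p dvd c" "\<not> p dvd 1"
    and min: "\<And>y. y dvd p \<Longrightarrow> y dvd c \<and> \<not> y dvd 1 \<Longrightarrow> p dvd y"
  proof (rule minimal_divisor[OF pid, of "\<lambda>x. x dvd c \<and> \<not> x dvd 1" c])
    show "c dvd c \<and> \<not> c dvd 1" using assms by simp
  qed auto
  have "prime_elem p"
  proof (rule prime_elemI)
    show "p \<noteq> 0" using p assms by auto
    show "\<not> p dvd 1" by fact
    fix a b assume ab: "p dvd a * b"
    obtain d x y where d: "d dvd p" "d dvd a" "x * p + y * a = d" using bezout[OF pid] by metis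
    show "p dvd a \<or> p dvd b"
    proof (cases "d dvd 1")
      case True
      have "p dvd x * p * b + y * (a * b)" using ab by (intro dvd_add) auto
      also have "x * p * b + y * (a * b) = d * b" using d(3) by (metis distrib_right mult.assoc)
      finally have "p dvd d * b" .
      moreover obtain k where "1 = d * k" using True by (elim dvdE)
      then have "b = d * b * k" by (metis mult.assoc mult.commute mult_1)
      ultimately show ?thesis by (metis dvd_mult2)
    next
      case False
      then have "p dvd d" using min[OF d(1)] d(1) p(1) dvd_trans by blast
      then show ?thesis using d(2) dvd_trans by blast
    qed
  qed
  then show ?thesis using that p by blast
qed

text \<open>Removing one prime after another terminates: a counterexample that is minimal for divisibility
  would stay a counterexample after division by one of its primes.\<close>
lemma prime_factor_induct:
  fixes c :: "'r::idom"
  assumes pid: "principal_ideals TYPE('r)" and "c \<noteq> 0"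
    and unit: "\<And>u. u dvd 1 \<Longrightarrow> P u"
    and step: "\<And>p x. prime_elem p \<Longrightarrow> x \<noteq> 0 \<Longrightarrow> P x \<Longrightarrow> P (p * x)"
  shows "P c"
proof (rule ccontr)
  assume "\<not> P c"
  then obtain x where x: "x \<noteq> 0 \<and> \<not> P x" and min: "\<And>y. y dvd x \<Longrightarrow> y \<noteq> 0 \<and> \<not> P y \<Longrightarrow> x dvd y"
    using minimal_divisor[OF pid, of "\<lambda>x. x \<noteq> 0 \<and> \<not> P x" c] \<open>c \<noteq> 0\<close> \<open>\<not> P c\<close> by metis
  obtain p where p: "prime_elem p" "p dvd x" using prime_divisor_exists[OF pid, of x] x unit by blast
  then obtain y where y: "x = p * y" by (elim dvdE)
  then have "\<not> P y" "y \<noteq> 0" using step[OF p(1), of y] x by auto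
  then have "x dvd y" using min[of y] y by auto
  then show False using y p(1) \<open>y \<noteq> 0\<close> by (auto simp: prime_elem_def dvd_mult_cancel_right)
qed

section \<open>Polynomial functions on affine space over an infinite field\<close>

definition polyfun :: "('k::comm_ring_1 \<Rightarrow> 'k) \<Rightarrow> bool" where
  "polyfun h \<longleftrightarrow> (\<exists>p. \<forall>s. h s = poly p s)"

lemma polyfun_const [intro, simp]: "polyfun (\<lambda>s. c)"
  unfolding polyfun_def by (rule exI[of _ "[:c:]"]) simp

lemma polyfun_id [intro, simp]: "polyfun (\<lambda>s. s)"
  unfolding polyfun_def by (rule exI[of _ "[:0, 1:]"]) simp

lemma polyfun_add [intro]: "polyfun f \<Longrightarrow> polyfun g \<Longrightarrow> polyfun (\<lambda>s. f s + g s)"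
  unfolding polyfun_def by (metis poly_add)

lemma polyfun_mult [intro]: "polyfun f \<Longrightarrow> polyfun g \<Longrightarrow> polyfun (\<lambda>s. f s * g s)"
  unfolding polyfun_def by (metis poly_mult)

lemma polyfun_diff [intro]: "polyfun f \<Longrightarrow> polyfun g \<Longrightarrow> polyfun (\<lambda>s. f s - g s)"
  unfolding polyfun_def by (metis poly_diff)

lemma polyfun_power [intro]: "polyfun f \<Longrightarrow> polyfun (\<lambda>s. f s ^ n)"
  unfolding polyfun_def by (metis poly_power)

lemma polyfun_sum [intro]: "(\<And>i. i \<in> I \<Longrightarrow> polyfun (f i)) \<Longrightarrow> polyfun (\<lambda>s. \<Sum>i\<in>I. f i s)"
  by (induction I rule: infinite_finite_induct) auto

text \<open>This extends identities from nonzero parameters to the parameter \<open>0\<close>, where a rescaled polynomial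
  map becomes its top form.\<close>
lemma polyfun_zero:
  fixes h :: "'k::idom \<Rightarrow> 'k"
  assumes inf: "infinite (UNIV :: 'k set)" and "polyfun h" and "\<And>s. s \<noteq> 0 \<Longrightarrow> h s = 0"
  shows "h s = 0"
proof -
  obtain p where p: "\<And>s. h s = poly p s" using assms unfolding polyfun_def by blast
  have "p = 0"
  proof (rule ccontr)
    assume "p \<noteq> 0"
    then have "finite {s. poly p s = 0}" by (rule poly_roots_finite)
    moreover have "UNIV - {0} \<subseteq> {s. poly p s = 0}" using assms(3) p by auto
    ultimately show False using inf by (metis finite_Diff2 finite.emptyI finite.insertI finite_subset)
  qed
  then show ?thesis by (simp add: p)
qed

lemma polyfun_product_zero:
  fixes g h :: "'k::idom \<Rightarrow> 'k"
  assumes inf: "infinite (UNIV :: 'k set)" and "polyfun g" "polyfun h" and gh: "\<And>s. g s * h s = 0"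
    and "g a \<noteq> 0"
  shows "h s = 0"
proof -
  obtain p q where pq: "\<And>s. g s = poly p s" "\<And>s. h s = poly q s"
    using assms unfolding polyfun_def by metis
  have "poly (p * q) s = 0" for s using gh[of s] by (simp add: pq)
  then have "{s. poly (p * q) s = 0} = UNIV" by auto
  then have "p * q = 0" using inf poly_roots_finite[of "p * q"] by auto
  moreover have "p \<noteq> 0" using assms(5) pq by auto
  ultimately show ?thesis using pq by simp
qed

text \<open>The inductive description transports polynomial functions along curves and splits them into
  homogeneous components without a choice of coefficients.\<close>
inductive polyfun_vec :: "('k::field ^ 'n \<Rightarrow> 'k) \<Rightarrow> bool" where
  const: "polyfun_vec (\<lambda>v. c)"
| coord: "polyfun_vec (\<lambda>v. v $ i)"
| add: "polyfun_vec f \<Longrightarrow> polyfun_vec g \<Longrightarrow> polyfun_vec (\<lambda>v. f v + g v)"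
| mult: "polyfun_vec f \<Longrightarrow> polyfun_vec g \<Longrightarrow> polyfun_vec (\<lambda>v. f v * g v)"

lemma polyfun_vec_diff: "polyfun_vec f \<Longrightarrow> polyfun_vec g \<Longrightarrow> polyfun_vec (\<lambda>v. f v - g v)"
  using polyfun_vec.add[of f "\<lambda>v. (-1) * g v"] polyfun_vec.mult[OF polyfun_vec.const[of "-1"], of g] by simp

lemma polyfun_vec_sum: "(\<And>i. i \<in> I \<Longrightarrow> polyfun_vec (f i)) \<Longrightarrow> polyfun_vec (\<lambda>v. \<Sum>i\<in>I. f i v)"
  by (induction I rule: infinite_finite_induct) (auto intro: polyfun_vec.intros)

lemma polyfun_vec_prod: "(\<And>i. i \<in> I \<Longrightarrow> polyfun_vec (f i)) \<Longrightarrow> polyfun_vec (\<lambda>v. \<Prod>i\<in>I. f i v)"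
  by (induction I rule: infinite_finite_induct) (auto intro: polyfun_vec.intros)

lemma polyfun_vec_curve:
  assumes "polyfun_vec f" and "\<And>i. polyfun (\<lambda>s. g s $ i)"
  shows "polyfun (\<lambda>s. f (g s))"
  using assms(1) by induction (auto intro: assms(2))

lemma polyfun_vec_line:
  assumes "polyfun_vec f" shows "polyfun (\<lambda>s. f (a + s *s b))"
  by (rule polyfun_vec_curve[OF assms]) (auto intro!: polyfun_add polyfun_mult)

text \<open>A vanishing product restricts to every line, where the ring of polynomial functions is
  a domain; the line joins a point at which the first factor does not vanish to a given point.\<close>
lemma polyfun_vec_product_zero:
  fixes f g :: "'k::field ^ 'n \<Rightarrow> 'k"
  assumes inf: "infinite (UNIV :: 'k set)" and "polyfun_vec f" "polyfun_vec g"
    and fg: "\<And>v. f v * g v = 0" and "f a \<noteq> 0"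
  shows "g v = 0"
proof -
  have "g (a + 1 *s (v - a)) = 0"
    by (rule polyfun_product_zero[OF inf polyfun_vec_line[OF \<open>polyfun_vec f\<close>] polyfun_vec_line[OF \<open>polyfun_vec g\<close>], where a = 0])
      (use fg \<open>f a \<noteq> 0\<close> in auto)
  then show ?thesis by simp
qed

lemma polyfun_vec_prod_zero:
  fixes f :: "'i \<Rightarrow> 'k::field ^ 'n \<Rightarrow> 'k"
  assumes inf: "infinite (UNIV :: 'k set)" and "finite I" and "\<And>i. i \<in> I \<Longrightarrow> polyfun_vec (f i)"
    and "\<And>v. (\<Prod>i\<in>I. f i v) = 0"
  shows "\<exists>i\<in>I. \<forall>v. f i v = 0"
  using assms(2-)
proof (induction I rule: finite_induct)
  case (insert i I)
  show ?case
  proof (cases "\<forall>v. f i v = 0")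
    case False
    then obtain a where "f i a \<noteq> 0" by blast
    then have "(\<Prod>i\<in>I. f i v) = 0" for v
      using polyfun_vec_product_zero[OF inf, of "f i" "\<lambda>v. \<Prod>i\<in>I. f i v" a v] insert
      by (auto intro: polyfun_vec_prod)
    then show ?thesis using insert by auto
  qed auto
qed auto

subsection \<open>Homogeneous components\<close>

definition homogeneous :: "nat \<Rightarrow> ('k::field ^ 'n \<Rightarrow> 'k) \<Rightarrow> bool" where
  "homogeneous n f \<longleftrightarrow> (\<forall>t v. f (t *s v) = t ^ n * f v)"

lemma homogeneous_decomposition:
  assumes "polyfun_vec f"
  shows "\<exists>N h. (\<forall>n. polyfun_vec (h n) \<and> homogeneous n (h n)) \<and> (\<forall>n>N. \<forall>v. h n v = 0) \<and>
    (\<forall>v. f v = (\<Sum>n\<le>N. h n v))"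
  using assms
proof induction
  case (const c)
  show ?case
    by (rule exI[of _ 0], rule exI[of _ "\<lambda>n v. if n = 0 then c else 0"])
      (auto simp: homogeneous_def intro: polyfun_vec.intros)
next
  case (coord i)
  show ?case
  proof (rule exI[of _ 1], rule exI[of _ "\<lambda>n v. if n = 1 then v $ i else 0"], intro conjI allI)
    show "polyfun_vec (\<lambda>v. if n = 1 then v $ i else 0)" for n :: nat
      by (cases "n = 1") (auto intro: polyfun_vec.intros)
  qed (auto simp: homogeneous_def)
next
  case (add f g)
  then obtain N1 h1 N2 h2 where
    1: "\<And>n. polyfun_vec (h1 n)" "\<And>n. homogeneous n (h1 n)" "\<And>n v. n > N1 \<Longrightarrow> h1 n v = 0" "\<And>v. f v = (\<Sum>n\<le>N1. h1 n v)" and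
    2: "\<And>n. polyfun_vec (h2 n)" "\<And>n. homogeneous n (h2 n)" "\<And>n v. n > N2 \<Longrightarrow> h2 n v = 0" "\<And>v. g v = (\<Sum>n\<le>N2. h2 n v)"
    by metis
  have *: "(\<Sum>n\<le>N1. h1 n v) = (\<Sum>n\<le>max N1 N2. h1 n v)" "(\<Sum>n\<le>N2. h2 n v) = (\<Sum>n\<le>max N1 N2. h2 n v)" for v
    by (rule sum.mono_neutral_left; use 1(3) 2(3) in auto)+
  show ?case
    by (rule exI[of _ "max N1 N2"], rule exI[of _ "\<lambda>n v. h1 n v + h2 n v"])
      (use 1 2 in \<open>auto simp: * sum.distrib homogeneous_def distrib_left intro: polyfun_vec.intros\<close>)
next
  case (mult f g)
  then obtain N1 h1 N2 h2 where
    1: "\<And>n. polyfun_vec (h1 n)" "\<And>n. homogeneous n (h1 n)" "\<And>n v. n > N1 \<Longrightarrow> h1 n v = 0" "\<And>v. f v = (\<Sum>n\<le>N1. h1 n v)" and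
    2: "\<And>n. polyfun_vec (h2 n)" "\<And>n. homogeneous n (h2 n)" "\<And>n v. n > N2 \<Longrightarrow> h2 n v = 0" "\<And>v. g v = (\<Sum>n\<le>N2. h2 n v)"
    by metis
  define h where "h n v = (\<Sum>k\<le>n. h1 k v * h2 (n - k) v)" for n v
  have "polyfun_vec (h n)" for n unfolding h_def by (intro polyfun_vec_sum polyfun_vec.mult 1 2)
  moreover have "homogeneous n (h n)" for n
  proof -
    have "h1 k (t *s v) * h2 (n - k) (t *s v) = t ^ n * (h1 k v * h2 (n - k) v)" if "k \<le> n" for k t v
    proof -
      have "t ^ n = t ^ k * t ^ (n - k)" using that by (simp flip: power_add)
      then show ?thesis using 1(2)[of k] 2(2)[of "n - k"] by (simp add: homogeneous_def)
    qed
    then show ?thesis unfolding homogeneous_def h_def by (auto simp: sum_distrib_left)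
  qed
  moreover have "h n v = 0" if "n > N1 + N2" for n v
    unfolding h_def
  proof (rule sum.neutral, safe)
    fix k
    show "h1 k v * h2 (n - k) v = 0" using that 1(3)[of k v] 2(3)[of "n - k" v]
      by (cases "k > N1") auto
  qed
  moreover have "f v * g v = (\<Sum>n\<le>N1 + N2. h n v)" for v
    using polynomial_product[of N1 "\<lambda>n. h1 n v" N2 "\<lambda>n. h2 n v" 1] 1 2 by (simp add: h_def)
  ultimately show ?case by blast
qed

subsection \<open>Binary forms\<close>

text \<open>Where \<open>g\<close> does not vanish, \<open>f / g\<close> is a root of the polynomial \<open>Q(y, 1)\<close>. So the product of \<open>g\<close>
  and of the finitely many functions \<open>f - r g\<close>, for its roots \<open>r\<close>, vanishes everywhere; polynomial
  functions form a domain, so one of the factors is zero.\<close>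
lemma binary_form_dependence:
  fixes f g :: "'k::field ^ 'n \<Rightarrow> 'k"
  assumes inf: "infinite (UNIV :: 'k set)" and f: "polyfun_vec f" and g: "polyfun_vec g"
    and Q1: "\<And>z. polyfun (\<lambda>y. Q y z)" and Q2: "\<And>y. polyfun (Q y)"
    and hom: "\<And>t y z. Q (t * y) (t * z) = t ^ d * Q y z"
    and nz: "Q y0 z0 \<noteq> 0" and rel: "\<And>v. Q (f v) (g v) = 0"
  shows "\<exists>a b. (a, b) \<noteq> (0, 0) \<and> (\<forall>v. a * f v + b * g v = 0)"
proof -
  obtain q where q: "\<And>y. Q y 1 = poly q y" using Q1[of 1] unfolding polyfun_def by blast
  have Qq: "Q y z = z ^ d * poly q (y / z)" if "z \<noteq> 0" for y z
    using hom[of z "y / z" 1] that by (simp add: q)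
  have "q \<noteq> 0"
  proof
    assume "q = 0"
    then have "Q y0 z = 0" if "z \<noteq> 0" for z using Qq[OF that] by simp
    then have "Q y0 z0 = 0" by (rule polyfun_zero[OF inf Q2])
    then show False using nz by simp
  qed
  then have fin: "finite {r. poly q r = 0}" by (rule poly_roots_finite)
  \<comment> \<open>\<open>Some r\<close> stands for the linear factor \<open>y - r z\<close> and \<open>None\<close> for the factor \<open>z\<close>\<close>
  define I where "I = insert None (Some ` {r. poly q r = 0})"
  define F where "F i v = (case i of None \<Rightarrow> g v | Some r \<Rightarrow> f v - r * g v)" for i v
  have "\<exists>i\<in>I. \<forall>v. F i v = 0"
  proof (rule polyfun_vec_prod_zero[OF inf])
    show "finite I" using fin by (simp add: I_def)
    show "polyfun_vec (F i)" for i
      unfolding F_def using f g by (cases i) (auto intro!: polyfun_vec_diff polyfun_vec.mult polyfun_vec.const)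
    show "(\<Prod>i\<in>I. F i v) = 0" for v
    proof (cases "g v = 0")
      case True
      then have "F None v = 0" by (simp add: F_def)
      then show ?thesis using \<open>finite I\<close> by (auto simp: I_def)
    next
      case False
      then have "poly q (f v / g v) = 0" using rel[of v] Qq[of "g v" "f v"] by simp
      then have "Some (f v / g v) \<in> I" "F (Some (f v / g v)) v = 0"
        using False by (auto simp: I_def F_def)
      then show ?thesis using \<open>finite I\<close> by (intro prod_zero) auto
    qed
  qed
  then obtain i where i: "\<And>v. F i v = 0" by blast
  show ?thesis
  proof (cases i)
    case None
    then show ?thesis using i by (intro exI[of _ 0] exI[of _ 1]) (auto simp: F_def)
  next
    case (Some r)
    then show ?thesis using i by (intro exI[of _ 1] exI[of _ "-r"]) (auto simp: F_def)
  qed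
qed

section \<open>Quasi-translations\<close>

text \<open>The family \<open>H s v = s\<^sup>d F(v / s)\<close>, where \<open>d\<close> is the degree of \<open>F\<close>, is polynomial in \<open>s\<close>; it joins \<open>F\<close>
  at \<open>s = 1\<close> to the form of highest degree at \<open>s = 0\<close>.\<close>
lemma top_form_exists:
  fixes F :: "'k::field ^ 'n \<Rightarrow> 'k ^ 'n"
  assumes F: "\<And>i. polyfun_vec (\<lambda>v. F v $ i)" and nz: "F a \<noteq> 0"
  obtains d H where "\<And>s v. H s (s *s v) = s ^ d *s F v"
    "\<forall>g i. (\<forall>j. polyfun (\<lambda>s. g s $ j)) \<longrightarrow> polyfun (\<lambda>s. H s (g s) $ i)"
    "\<And>i. polyfun_vec (\<lambda>v. H 0 v $ i)" "\<And>t v. H 0 (t *s v) = t ^ d *s H 0 v" "\<exists>v. H 0 v \<noteq> 0"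
proof -
  have "\<forall>i. \<exists>N h. (\<forall>n. polyfun_vec (h n) \<and> homogeneous n (h n)) \<and> (\<forall>n>N. \<forall>v. h n v = 0) \<and>
      (\<forall>v. F v $ i = (\<Sum>n\<le>N. h n v))"
    using homogeneous_decomposition[OF F] by blast
  then obtain N h where h: "\<And>i n. polyfun_vec (h i n)" "\<And>i n. homogeneous n (h i n)"
    "\<And>i n v. n > N i \<Longrightarrow> h i n v = 0" "\<And>i v. F v $ i = (\<Sum>n\<le>N i. h i n v)" by metis
  define P where "P n \<longleftrightarrow> (\<exists>i v. h i n v \<noteq> 0)" for n
  have bound: "n \<le> Max (range N)" if n: "P n" for n
  proof -
    obtain i v where "h i n v \<noteq> 0" using n P_def by auto
    then have "n \<le> N i" using h(3) by (meson not_le)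
    also have "N i \<le> Max (range N)" by (rule Max_ge) auto
    finally show ?thesis .
  qed
  have ex: "\<exists>n. P n"
  proof (rule ccontr)
    assume "\<not> (\<exists>n. P n)"
    then have "F a = 0" using h(4)[of a] by (auto simp: P_def vec_eq_iff)
    then show False using nz by simp
  qed
  define d where "d = (GREATEST n. P n)"
  have d: "P d" using GreatestI_ex_nat[OF ex, of "Max (range N)"] bound unfolding d_def by blast
  have beyond: "h i n v = 0" if "n > d" for i n v
    using that Greatest_le_nat[of P n "Max (range N)"] bound unfolding d_def P_def by (meson not_le)
  have Fsum: "F v $ i = (\<Sum>n\<le>d. h i n v)" for v i
  proof -
    have "F v $ i = (\<Sum>n\<le>max d (N i). h i n v)"
      unfolding h(4) by (rule sum.mono_neutral_left) (use h(3) in auto)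
    also have "\<dots> = (\<Sum>n\<le>d. h i n v)" by (rule sum.mono_neutral_right) (use beyond in auto)
    finally show ?thesis .
  qed
  define H where "H s v = (\<chi> i. \<Sum>n\<le>d. s ^ (d - n) * h i n v)" for s v
  have H0: "H 0 v $ i = h i d v" for v i
  proof -
    have "(\<Sum>n\<le>d. 0 ^ (d - n) * h i n v) = (\<Sum>n\<in>{d}. 0 ^ (d - n) * h i n v)"
      by (rule sum.mono_neutral_right) auto
    then show ?thesis by (simp add: H_def)
  qed
  show ?thesis
  proof
    show "H s (s *s v) = s ^ d *s F v" for s v
    proof -
      have "s ^ (d - n) * h i n (s *s v) = s ^ d * h i n v" if "n \<le> d" for n i
      proof -
        have "s ^ d = s ^ (d - n) * s ^ n" using that by (simp flip: power_add)
        then show ?thesis using h(2)[of n i] by (simp add: homogeneous_def)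
      qed
      then show ?thesis by (simp add: H_def vec_eq_iff Fsum sum_distrib_left)
    qed
    have "polyfun (\<lambda>s. H s (g s) $ i)" if "\<And>j. polyfun (\<lambda>s. g s $ j)" for g i
      unfolding H_def vec_lambda_beta
      by (intro polyfun_sum polyfun_mult polyfun_power polyfun_id polyfun_vec_curve[OF h(1)] that)
    then show "\<forall>g i. (\<forall>j. polyfun (\<lambda>s. g s $ j)) \<longrightarrow> polyfun (\<lambda>s. H s (g s) $ i)" by blast
    show "polyfun_vec (\<lambda>v. H 0 v $ i)" for i using h(1)[of i d] by (simp add: H0)
    show "H 0 (t *s v) = t ^ d *s H 0 v" for t v
      using h(2)[of d] by (auto simp: vec_eq_iff H0 homogeneous_def)
    show "\<exists>v. H 0 v \<noteq> 0" using d unfolding P_def by (metis H0 zero_index)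
  qed
qed

text \<open>The identity for \<open>F\<close> holds for all rescalings \<open>s\<^sup>d F(v / s)\<close> and passes to the limit \<open>s = 0\<close>. The
  form \<open>G\<close> vanishes on the values of \<open>F\<close> because \<open>G(F v)\<close> is the coefficient of \<open>t\<^sup>d\<close> in
  \<open>F(v + t F v)\<close>, which is constant in \<open>t\<close>.\<close>
lemma top_form_quasi_translation:
  fixes F :: "'k::field ^ 'n \<Rightarrow> 'k ^ 'n"
  assumes inf: "infinite (UNIV :: 'k set)"
    and F: "\<And>i. polyfun_vec (\<lambda>v. F v $ i)" and nz: "F a \<noteq> 0"
    and quasi: "\<And>t v. F (v + t *s F v) = F v"
  obtains (fixed) c where "\<And>v. F v = c"
  | (form) d G where "d > 0" "\<And>i. polyfun_vec (\<lambda>v. G v $ i)" "\<And>t v. G (t *s v) = t ^ d *s G v"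
      "\<exists>v. G v \<noteq> 0" "\<And>t v. G (v + t *s G v) = G v" "\<And>v. G (F v) = 0"
proof -
  obtain d H where H: "\<And>s v. H s (s *s v) = s ^ d *s F v"
    and Hc': "\<forall>g i. (\<forall>j. polyfun (\<lambda>s. g s $ j)) \<longrightarrow> polyfun (\<lambda>s. H s (g s) $ i)"
    and G: "\<And>i. polyfun_vec (\<lambda>v. H 0 v $ i)" "\<And>t v. H 0 (t *s v) = t ^ d *s H 0 v" "\<exists>v. H 0 v \<noteq> 0"
    by (rule top_form_exists[OF F nz], rule that)
  have Hc: "polyfun (\<lambda>s. H s (g s) $ i)" if "\<And>j. polyfun (\<lambda>s. g s $ j)" for g i
    using Hc' that by blast
  show ?thesis
  proof (cases d)
    case 0
    then have "F v = H 0 0" for v using H[of 0 v] by simp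
    then show ?thesis by (rule fixed)
  next
    case (Suc e)
    have scaled: "\<exists>u. v = s *s u \<and> H s v = s ^ d *s F u" if "s \<noteq> 0" for s v
      using that H[of s "inverse s *s v"] by (intro exI[of _ "inverse s *s v"]) simp
    have "H 0 (v + t *s H 0 v) $ i - H 0 v $ i = 0" for v t i
    proof (rule polyfun_zero[OF inf, where h = "\<lambda>s. H s (v + t *s H s v) $ i - H s v $ i"])
      show "polyfun (\<lambda>s. H s (v + t *s H s v) $ i - H s v $ i)"
        by (auto intro!: polyfun_diff Hc polyfun_add polyfun_mult)
      fix s :: 'k assume "s \<noteq> 0"
      then obtain u where u: "v = s *s u" "H s v = s ^ d *s F u" using scaled by blast
      have "v + t *s H s v = s *s (u + (t * s ^ e) *s F u)"
        by (simp add: u(1) u(2)[unfolded u(1)] Suc vec_eq_iff algebra_simps)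
      then have "H s (v + t *s H s v) = s ^ d *s F u" using H quasi by metis
      then show "H s (v + t *s H s v) $ i - H s v $ i = 0" using u by simp
    qed
    then have 1: "H 0 (v + t *s H 0 v) = H 0 v" for v t by (simp add: vec_eq_iff)
    have "H 0 (0 *s v + F v) $ i - 0 ^ d * F v $ i = 0" for v i
    proof (rule polyfun_zero[OF inf, where h = "\<lambda>s. H s (s *s v + F v) $ i - s ^ d * F v $ i"])
      show "polyfun (\<lambda>s. H s (s *s v + F v) $ i - s ^ d * F v $ i)"
        by (auto intro!: polyfun_diff Hc polyfun_add polyfun_mult polyfun_power)
      fix s :: 'k assume s: "s \<noteq> 0"
      have "s *s v + F v = s *s (v + inverse s *s F v)"
        using s by (simp add: vec_eq_iff algebra_simps)
      then have "H s (s *s v + F v) = s ^ d *s F v" using H quasi by metis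
      then show "H s (s *s v + F v) $ i - s ^ d * F v $ i = 0" by simp
    qed
    then have 2: "H 0 (F v) = 0" for v using Suc by (simp add: vec_eq_iff)
    show ?thesis by (rule form[of d "H 0"]) (use Suc G 1 2 in auto)
  qed
qed

text \<open>In two variables the top form is itself a binary form that vanishes on \<open>F\<close>.\<close>
lemma quasi_translation_dependent_2:
  fixes F :: "'k::field ^ 2 \<Rightarrow> 'k ^ 2"
  assumes inf: "infinite (UNIV :: 'k set)"
    and F: "\<And>i. polyfun_vec (\<lambda>v. F v $ i)"
    and quasi: "\<And>t v. F (v + t *s F v) = F v"
  shows "\<exists>a b. (a, b) \<noteq> (0, 0) \<and> (\<forall>v. a * F v $ 1 + b * F v $ 2 = 0)"
proof (cases "\<exists>a. F a \<noteq> 0")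
  case False
  then show ?thesis by (intro exI[of _ 1] exI[of _ 0]) auto
next
  case True
  then obtain a where "F a \<noteq> 0" by blast
  from inf F this quasi show ?thesis
  proof (rule top_form_quasi_translation)
    fix c assume c: "\<And>v. F v = c"
    show ?thesis
    proof (intro exI conjI allI)
      show "(c $ 2, - c $ 1) \<noteq> (0, 0)" using \<open>F a \<noteq> 0\<close> c by (auto simp: vec_eq_iff forall_2)
      show "c $ 2 * F v $ 1 + (- c $ 1) * F v $ 2 = 0" for v by (simp add: c)
    qed
  next
    fix d G assume G: "\<And>i. polyfun_vec (\<lambda>v. G v $ i)" "\<And>t v. G (t *s v) = t ^ d *s G v"
      "\<exists>v. G v \<noteq> 0" "\<And>v. G (F v) = 0"
    then obtain w j where w: "G w $ j \<noteq> 0" by (auto simp: vec_eq_iff)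
    have v2: "vector [v $ 1, v $ 2] = v" for v :: "'k ^ 2" by (simp add: vec_eq_iff forall_2)
    show ?thesis
    proof (rule binary_form_dependence[OF inf F F, where Q = "\<lambda>y z. G (vector [y, z]) $ j"])
      have "polyfun (\<lambda>y. vector [y, z] $ i)" for z :: 'k and i :: 2
        using exhaust_2[of i] by auto
      then show "polyfun (\<lambda>y. G (vector [y, z]) $ j)" for z by (intro polyfun_vec_curve[OF G(1)])
      have "polyfun (\<lambda>z. vector [y, z] $ i)" for y :: 'k and i :: 2
        using exhaust_2[of i] by auto
      then show "polyfun (\<lambda>z. G (vector [y, z]) $ j)" for y by (intro polyfun_vec_curve[OF G(1)])
      have "vector [t * y, t * z] = t *s (vector [y, z] :: 'k ^ 2)" for t y z
        by (simp add: vec_eq_iff forall_2)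
      then show "G (vector [t * y, t * z]) $ j = t ^ d * G (vector [y, z]) $ j" for t y z
        by (simp add: G(2))
      show "G (vector [w $ 1, w $ 2]) $ j \<noteq> 0" using w by (simp add: v2)
      show "G (vector [F v $ 1, F v $ 2]) $ j = 0" for v using G(4)[of v] by (simp add: v2)
    qed
  qed
qed

definition det3 :: "'k::comm_ring_1 ^ 3 \<Rightarrow> 'k ^ 3 \<Rightarrow> 'k ^ 3 \<Rightarrow> 'k" where
  "det3 u v w = u $ 1 * (v $ 2 * w $ 3 - v $ 3 * w $ 2) - u $ 2 * (v $ 1 * w $ 3 - v $ 3 * w $ 1)
     + u $ 3 * (v $ 1 * w $ 2 - v $ 2 * w $ 1)"

text \<open>The linear relation between four vectors in three-space given by Cramer's rule.\<close>
lemma det3_relation: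
  "det3 c v' c' *s v - det3 v v' c' *s c + det3 v c c' *s v' - det3 v c v' *s c' = 0"
  by (simp add: det3_def vec_eq_iff forall_3 algebra_simps)

text \<open>A vector orthogonal to three independent vectors is zero.\<close>
lemma det3_cramer:
  fixes n :: "'k::comm_ring_1 ^ 3"
  assumes "n $ 1 * u $ 1 + n $ 2 * u $ 2 + n $ 3 * u $ 3 = 0"
    and "n $ 1 * v $ 1 + n $ 2 * v $ 2 + n $ 3 * v $ 3 = 0"
    and "n $ 1 * w $ 1 + n $ 2 * w $ 2 + n $ 3 * w $ 3 = 0"
  shows "det3 u v w *s n = 0"
proof -
  define U V W where "U = n $ 1 * u $ 1 + n $ 2 * u $ 2 + n $ 3 * u $ 3"
    and "V = n $ 1 * v $ 1 + n $ 2 * v $ 2 + n $ 3 * v $ 3"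
    and "W = n $ 1 * w $ 1 + n $ 2 * w $ 2 + n $ 3 * w $ 3"
  have "det3 u v w * n $ 1 = (v $ 2 * w $ 3 - v $ 3 * w $ 2) * U - (u $ 2 * w $ 3 - u $ 3 * w $ 2) * V
      + (u $ 2 * v $ 3 - u $ 3 * v $ 2) * W"
    by (simp add: det3_def U_def V_def W_def algebra_simps)
  moreover have "det3 u v w * n $ 2 = (v $ 3 * w $ 1 - v $ 1 * w $ 3) * U - (u $ 3 * w $ 1 - u $ 1 * w $ 3) * V
      + (u $ 3 * v $ 1 - u $ 1 * v $ 3) * W"
    by (simp add: det3_def U_def V_def W_def algebra_simps)
  moreover have "det3 u v w * n $ 3 = (v $ 1 * w $ 2 - v $ 2 * w $ 1) * U - (u $ 1 * w $ 2 - u $ 2 * w $ 1) * V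
      + (u $ 1 * v $ 2 - u $ 2 * v $ 1) * W"
    by (simp add: det3_def U_def V_def W_def algebra_simps)
  ultimately show ?thesis using assms unfolding U_def V_def W_def by (simp add: vec_eq_iff forall_3)
qed

definition parallel :: "'k::comm_ring_1 ^ 3 \<Rightarrow> 'k ^ 3 \<Rightarrow> bool" where
  "parallel u v \<longleftrightarrow> u $ 1 * v $ 2 = u $ 2 * v $ 1 \<and> u $ 1 * v $ 3 = u $ 3 * v $ 1 \<and> u $ 2 * v $ 3 = u $ 3 * v $ 2"

lemma parallel_multiple:
  fixes c :: "'k::field ^ 3"
  assumes "parallel c v" "c \<noteq> 0"
  obtains r where "v = r *s c"
proof -
  obtain k where k: "c $ k \<noteq> 0" using assms(2) by (auto simp: vec_eq_iff)
  have "v = (v $ k / c $ k) *s c"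
    using assms(1) k exhaust_3[of k] unfolding parallel_def vec_eq_iff forall_3
    by (auto simp: field_simps)
  then show ?thesis using that by blast
qed

text \<open>Projectively, the affine lines \<open>v + t (G v)\<close> and \<open>v' + t' (G v')\<close> lie in one plane and meet.
  \<open>G\<close> is constant along each of them, so if the meeting point were an affine point of both, \<open>G v\<close>
  and \<open>G v'\<close> would be parallel. Hence the lines meet in one of the points at infinity \<open>G v\<close>, \<open>G v'\<close>,
  which is what the two determinants express.\<close>
lemma homogeneous_lines_meet:
  fixes G :: "'k::field ^ 3 \<Rightarrow> 'k ^ 3"
  assumes hom: "\<And>t v. G (t *s v) = t ^ d *s G v" and quasi: "\<And>t v. G (v + t *s G v) = G v"
  shows "det3 v (G v) (G v') * det3 v' (G v') (G v) = 0"
proof (rule ccontr)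
  assume "\<not> ?thesis"
  then have nz: "det3 v (G v) (G v') \<noteq> 0" "det3 v' (G v') (G v) \<noteq> 0" by auto
  have line: "G (p *s v + q *s G v) = p ^ d *s G v" if "p \<noteq> 0" for p q v
  proof -
    have "p *s v + q *s G v = p *s (v + (q / p) *s G v)" using that by (simp add: vec_eq_iff distrib_left)
    then show ?thesis by (simp add: hom quasi)
  qed
  define p where "p = det3 (G v) v' (G v')"
  define p' where "p' = - det3 v (G v) (G v')"
  have p: "p = det3 v' (G v') (G v)" unfolding p_def det3_def by (simp add: algebra_simps)
  have "p *s v + (- det3 v v' (G v')) *s G v = p' *s v' + det3 v (G v) v' *s G v'"
    using det3_relation[of "G v" v' "G v'" v] unfolding p_def p'_def
    by (simp add: vec_eq_iff algebra_simps)
  then have eq: "p ^ d *s G v = p' ^ d *s G v'"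
    using line[of p v "- det3 v v' (G v')"] line[of p' v' "det3 v (G v) v'"] nz p p'_def by simp
  have "p ^ d * det3 v (G v) (G v') = det3 v (p ^ d *s G v) (G v')"
    by (simp add: det3_def algebra_simps)
  also have "\<dots> = 0" unfolding eq by (simp add: det3_def algebra_simps)
  finally show False using nz p by simp
qed

text \<open>By the previous lemma, and since polynomial functions form a domain, the line that joins \<open>v\<close>
  to \<open>G v\<close> contains all the values of \<open>G\<close> in the projective plane. If two of them, \<open>c\<close> and \<open>c'\<close>, were
  distinct, it would be the line through \<open>c\<close> and \<open>c'\<close>, for every \<open>v\<close>; so for \<open>v\<close> off that line \<open>G v\<close>
  is a multiple of \<open>v\<close>. But then \<open>v + t (G v)\<close> either is constant or runs into the origin, where
  \<open>G\<close> is zero, so \<open>G v = 0\<close> for almost all \<open>v\<close>.\<close>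
lemma homogeneous_quasi_translation_direction:
  fixes G :: "'k::field ^ 3 \<Rightarrow> 'k ^ 3"
  assumes inf: "infinite (UNIV :: 'k set)" and "d > 0"
    and G: "\<And>i. polyfun_vec (\<lambda>v. G v $ i)"
    and hom: "\<And>t v. G (t *s v) = t ^ d *s G v" and quasi: "\<And>t v. G (v + t *s G v) = G v"
  shows "parallel (G v) (G v')"
proof (rule ccontr)
  assume np: "\<not> parallel (G v) (G v')"
  have det_polyfn: "polyfun_vec (\<lambda>x. det3 (f x) (g x) (h x))"
    if "\<And>i. polyfun_vec (\<lambda>x. f x $ i)" "\<And>i. polyfun_vec (\<lambda>x. g x $ i)" "\<And>i. polyfun_vec (\<lambda>x. h x $ i)"
    for f g h :: "'k ^ 3 \<Rightarrow> 'k ^ 3"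
    unfolding det3_def by (intro polyfun_vec.add polyfun_vec_diff polyfun_vec.mult that)
  have det0: "det3 a (G a) (G b) = 0" for a b
  proof (rule ccontr)
    assume ab: "det3 a (G a) (G b) \<noteq> 0"
    have step: "det3 y (G y) (G x) = 0" if x: "det3 x (G x) (G b) \<noteq> 0" for x y
    proof (rule polyfun_vec_product_zero[OF inf, where f = "\<lambda>y. det3 x (G x) (G y)" and g = "\<lambda>y. det3 y (G y) (G x)" and a = b])
      show "det3 x (G x) (G v) * det3 v (G v) (G x) = 0" for v
        using homogeneous_lines_meet[where G = G and d = d, OF hom quasi] .
    qed (rule det_polyfn G polyfun_vec.const polyfun_vec.coord x)+
    have "det3 a (G a) (G x) = 0" for x
    proof (rule polyfun_vec_product_zero[OF inf, where f = "\<lambda>x. det3 x (G x) (G b)" and g = "\<lambda>x. det3 a (G a) (G x)" and a = a])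
      show "det3 v (G v) (G b) * det3 a (G a) (G v) = 0" for v
        using step[of v a] by auto
    qed (rule det_polyfn G polyfun_vec.const polyfun_vec.coord ab)+
    then show False using ab by simp
  qed
  define c where "c = G v"
  define c' where "c' = G v'"
  have zero: "G x = 0" if x: "det3 x c c' \<noteq> 0" for x
  proof -
    have d: "det3 x (G x) c = 0" "det3 x (G x) c' = 0" using det0[of x v] det0[of x v'] by (simp_all add: c_def c'_def)
    \<comment> \<open>the cross product of \<open>x\<close> and \<open>G x\<close>, which is orthogonal to the independent vectors \<open>x\<close>, \<open>c\<close>, \<open>c'\<close>\<close>
    define n :: "'k ^ 3" where "n = vector [x $ 2 * G x $ 3 - x $ 3 * G x $ 2, x $ 3 * G x $ 1 - x $ 1 * G x $ 3, x $ 1 * G x $ 2 - x $ 2 * G x $ 1]"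
    have dot: "n $ 1 * u $ 1 + n $ 2 * u $ 2 + n $ 3 * u $ 3 = det3 x (G x) u" for u
      by (simp add: n_def det3_def algebra_simps)
    have "det3 x c c' *s n = 0"
    proof (rule det3_cramer; unfold dot)
      show "det3 x (G x) x = 0" by (simp add: det3_def algebra_simps)
    qed (fact d)+
    then have "n = 0" using x by simp
    then have "parallel x (G x)" by (auto simp: n_def parallel_def vec_eq_iff forall_3 algebra_simps)
    moreover have "x \<noteq> 0" using x by (auto simp: det3_def)
    ultimately obtain r where r: "G x = r *s x" by (rule parallel_multiple)
    show "G x = 0"
    proof (cases "r = 0")
      case False
      then have "x + (- inverse r) *s G x = 0 *s x" by (simp add: r vec_eq_iff)
      then have "G x = G (0 *s x)" using quasi[of x "- inverse r"] by simp
      also have "\<dots> = 0" unfolding hom using \<open>d > 0\<close> by (simp add: vec_eq_iff)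
      finally show ?thesis .
    qed (simp add: r)
  qed
  obtain y where y: "det3 y c c' \<noteq> 0"
  proof -
    have "det3 (axis 1 1) c c' \<noteq> 0 \<or> det3 (axis 2 1) c c' \<noteq> 0 \<or> det3 (axis 3 1) c c' \<noteq> 0"
      using np by (auto simp: det3_def axis_def parallel_def c_def c'_def)
    then show ?thesis using that by blast
  qed
  have "G x $ i = 0" for x i
  proof (rule polyfun_vec_product_zero[OF inf, where f = "\<lambda>x. det3 x c c'" and g = "\<lambda>x. G x $ i" and a = y])
    show "det3 v c c' * G v $ i = 0" for v
      using zero[of v] by (cases "det3 v c c' = 0") auto
  qed (rule det_polyfn G polyfun_vec.const polyfun_vec.coord y)+
  then have "G v = 0" by (simp add: vec_eq_iff)
  then show False using np by (simp add: parallel_def)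
qed

text \<open>The top form \<open>G\<close> has a constant direction \<open>c\<close>, so it is invariant under translation by \<open>c\<close> and is a
  form in two linear forms that vanish at \<open>c\<close>. As \<open>G\<close> vanishes on \<open>F\<close>, the values of these linear
  forms on \<open>F\<close> satisfy a binary form.\<close>
theorem quasi_translation_dependent_3:
  fixes F :: "'k::field ^ 3 \<Rightarrow> 'k ^ 3"
  assumes inf: "infinite (UNIV :: 'k set)"
    and F: "\<And>i. polyfun_vec (\<lambda>v. F v $ i)"
    and quasi: "\<And>t v. F (v + t *s F v) = F v"
  shows "\<exists>a :: 'k ^ 3. a \<noteq> 0 \<and> (\<forall>v. a $ 1 * F v $ 1 + a $ 2 * F v $ 2 + a $ 3 * F v $ 3 = 0)"
proof (cases "\<exists>a. F a \<noteq> 0")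
  case False
  then show ?thesis by (intro exI[of _ 1]) (auto simp: vec_eq_iff)
next
  case True
  then obtain a where "F a \<noteq> 0" by blast
  from inf F this quasi show ?thesis
  proof (rule top_form_quasi_translation)
    fix c assume c: "\<And>v. F v = c"
    show ?thesis
    proof (cases "c $ 1 = 0")
      case True
      then show ?thesis by (intro exI[of _ "vector [1, 0, 0]"]) (auto simp: c vec_eq_iff forall_3)
    next
      case False
      then show ?thesis by (intro exI[of _ "vector [c $ 2, - c $ 1, 0]"]) (auto simp: c vec_eq_iff forall_3)
    qed
  next
    fix d G assume d: "d > 0" and G: "\<And>i. polyfun_vec (\<lambda>v. G v $ i)" and hom: "\<And>t v. G (t *s v) = t ^ d *s G v"
      and ex: "\<exists>v. G v \<noteq> 0" and Gq: "\<And>t v. G (v + t *s G v) = G v" and GF: "\<And>v. G (F v) = 0"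
    obtain w j where w: "G w $ j \<noteq> 0" using ex by (auto simp: vec_eq_iff)
    define c where "c = G w"
    have "c \<noteq> 0" using w by (auto simp: c_def)
    then obtain k where k: "c $ k \<noteq> 0" by (auto simp: vec_eq_iff)
    have dir: "\<exists>r. G v = r *s c" for v
    proof -
      have "parallel c (G v)"
        unfolding c_def by (rule homogeneous_quasi_translation_direction[where G = G and d = d, OF inf d G hom Gq])
      then show ?thesis using \<open>c \<noteq> 0\<close> by (rule parallel_multiple) blast
    qed
    have shift': "G (v + t *s c) = G v" if "G v \<noteq> 0" for v t
    proof -
      obtain r where r: "G v = r *s c" using dir by blast
      then have "r \<noteq> 0" using that by auto
      then have "v + t *s c = v + (t / r) *s G v" by (simp add: r)
      then show ?thesis using Gq by simp
    qed
    have shift: "G (v + t *s c) = G v" for v t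
    proof (cases "G (v + t *s c) = 0")
      case False
      then show ?thesis using shift'[OF False, of "- t"] by simp
    next
      case True
      then show ?thesis using shift'[of v t] by metis
    qed
    obtain i l where il: "i \<noteq> l" "i \<noteq> k" "l \<noteq> k" and all: "\<And>m :: 3. m = i \<or> m = l \<or> m = k"
    proof -
      consider "k = 1" | "k = 2" | "k = 3" using exhaust_3[of k] by blast
      then show ?thesis
      proof cases
        case 1 show ?thesis by (rule that[of 2 3]) (use 1 exhaust_3 in auto)
      next
        case 2 show ?thesis by (rule that[of 1 3]) (use 2 exhaust_3 in auto)
      next
        case 3 show ?thesis by (rule that[of 1 2]) (use 3 exhaust_3 in auto)
      qed
    qed
    \<comment> \<open>\<open>pr i\<close> and \<open>pr l\<close> are the coordinates of the projection along \<open>c\<close> onto the plane \<open>v $ k = 0\<close>\<close>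
    define e where "e y z = (\<chi> m. if m = i then y else if m = l then z else 0)" for y z :: 'k
    define pr where "pr m v = v $ m - (c $ m / c $ k) * v $ k" for m and v :: "'k ^ 3"
    have e: "e (pr i v) (pr l v) = v + (- (v $ k / c $ k)) *s c" for v
      unfolding vec_eq_iff
    proof
      fix m show "e (pr i v) (pr l v) $ m = (v + (- (v $ k / c $ k)) *s c) $ m"
        using all[of m] il k by (auto simp: e_def pr_def)
    qed
    have Ge: "G (e (pr i v) (pr l v)) = G v" for v unfolding e by (rule shift)
    have "\<exists>p q. (p, q) \<noteq> (0, 0) \<and> (\<forall>v. p * pr i (F v) + q * pr l (F v) = 0)"
    proof (rule binary_form_dependence[OF inf, where Q = "\<lambda>y z. G (e y z) $ j"])
      have "polyfun_vec (\<lambda>v. pr m (F v))" for m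
        unfolding pr_def by (intro polyfun_vec_diff polyfun_vec.mult polyfun_vec.const F)
      then show "polyfun_vec (\<lambda>v. pr i (F v))" "polyfun_vec (\<lambda>v. pr l (F v))" by auto
      have "polyfun (\<lambda>y. e y z $ m)" "polyfun (\<lambda>y. e z y $ m)" for z m
        using all[of m] il by (auto simp: e_def)
      then show "polyfun (\<lambda>y. G (e y z) $ j)" "polyfun (\<lambda>y. G (e z y) $ j)" for z
        by (auto intro!: polyfun_vec_curve[OF G])
      have "e (t * y) (t * z) = t *s e y z" for t y z by (simp add: e_def vec_eq_iff)
      then show "G (e (t * y) (t * z)) $ j = t ^ d * G (e y z) $ j" for t y z by (simp add: hom)
      show "G (e (pr i w) (pr l w)) $ j \<noteq> 0" using w Ge by simp
      show "G (e (pr i (F v)) (pr l (F v))) $ j = 0" for v by (simp add: Ge GF)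
    qed
    then obtain p q where pq: "(p, q) \<noteq> (0, 0)" "\<And>v. p * pr i (F v) + q * pr l (F v) = 0" by blast
    \<comment> \<open>the coefficients of the linear form \<open>p (pr i) + q (pr l)\<close>\<close>
    define b where "b = (\<chi> m. if m = i then p else if m = l then q else - (p * c $ i + q * c $ l) / c $ k)"
    have "b \<noteq> 0"
    proof
      assume "b = 0"
      then have "b $ i = 0" "b $ l = 0" by simp_all
      then show False using pq(1) il by (auto simp: b_def)
    qed
    moreover have "b $ 1 * F v $ 1 + b $ 2 * F v $ 2 + b $ 3 * F v $ 3 = 0" for v
    proof -
      have "UNIV = {i, l, k}" using all by blast
      then have "(\<Sum>m\<in>UNIV. b $ m * F v $ m) = (\<Sum>m\<in>{i, l, k}. b $ m * F v $ m)" by (simp only:)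
      also have "\<dots> = b $ i * F v $ i + b $ l * F v $ l + b $ k * F v $ k" using il by simp
      also have "\<dots> = p * pr i (F v) + q * pr l (F v)"
        using il k by (simp add: b_def pr_def field_simps)
      finally show ?thesis using pq(2) by (simp add: sum_3)
    qed
    ultimately show ?thesis by blast
  qed
qed

section \<open>Substitution homomorphisms on \<open>R[X,Y,Z]\<close>\<close>

definition rhom :: "('a::comm_ring_1 \<Rightarrow> 'b::comm_ring_1) \<Rightarrow> bool" where
  "rhom h \<longleftrightarrow> h 1 = 1 \<and> (\<forall>a b. h (a + b) = h a + h b) \<and> (\<forall>a b. h (a * b) = h a * h b)"

lemma rhom_simps:
  assumes "rhom h"
  shows "h 0 = 0" "h 1 = 1" "h (a + b) = h a + h b" "h (a * b) = h a * h b" "h (- a) = - h a"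
    "h (a - b) = h a - h b" "h (a ^ n) = h a ^ n"
proof -
  have h: "h 1 = 1" "\<And>a b. h (a + b) = h a + h b" "\<And>a b. h (a * b) = h a * h b"
    using assms by (auto simp: rhom_def)
  have 0: "h 0 = 0" using h(2)[of 0 0] by simp
  have m: "h (- a) = - h a" for a using h(2)[of a "- a"] 0 by (simp add: eq_neg_iff_add_eq_0 add.commute)
  show "h 0 = 0" "h 1 = 1" "h (a + b) = h a + h b" "h (a * b) = h a * h b" "h (- a) = - h a" by fact+
  show "h (a - b) = h a - h b" using h(2)[of a "- b"] m by simp
  show "h (a ^ n) = h a ^ n" by (induction n) (use h in auto)
qed

lemma rhom_sum: "rhom h \<Longrightarrow> h (sum f I) = (\<Sum>i\<in>I. h (f i))"
  by (induction I rule: infinite_finite_induct) (auto simp: rhom_simps)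

lemma rhom_comp: "rhom f \<Longrightarrow> rhom g \<Longrightarrow> rhom (\<lambda>x. f (g x))"
  by (simp add: rhom_def)

lemma rhom_const_poly: "rhom (\<lambda>c. [:c:])"
  by (simp add: rhom_def one_pCons)

lemma rhom_to_fract: "rhom to_fract"
  by (simp add: rhom_def)

definition subst :: "('a::comm_ring_1 \<Rightarrow> 'b::comm_ring_1) \<Rightarrow> 'b \<Rightarrow> 'a poly \<Rightarrow> 'b" where
  "subst h x p = poly (map_poly h p) x"

lemma subst_pCons: "rhom h \<Longrightarrow> subst h x (pCons a p) = h a + x * subst h x p"
  by (simp add: subst_def map_poly_pCons rhom_simps)

lemma subst_0: "subst h x 0 = 0"
  by (simp add: subst_def)

lemma subst_const: "rhom h \<Longrightarrow> subst h x [:c:] = h c"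
  by (simp add: subst_pCons subst_0)

lemma rhom_subst:
  assumes "rhom h" shows "rhom (subst h x)"
proof -
  note s = subst_pCons[OF assms] subst_0 rhom_simps[OF assms]
  have add: "subst h x (p + q) = subst h x p + subst h x q" for p q
    by (induction p q rule: poly_induct2) (simp_all add: s algebra_simps)
  have smult: "subst h x (smult a q) = h a * subst h x q" for a q
    by (induction q) (simp_all add: s algebra_simps)
  have "subst h x (p * q) = subst h x p * subst h x q" for p q
    by (induction p) (simp_all add: s add smult algebra_simps)
  then show ?thesis using add by (simp add: rhom_def one_pCons s)
qed

definition eval3 :: "('r::comm_ring_1 \<Rightarrow> 'c::comm_ring_1) \<Rightarrow> 'c \<Rightarrow> 'c \<Rightarrow> 'c \<Rightarrow> 'r poly3 \<Rightarrow> 'c" where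
  "eval3 h x y z = subst (subst (subst h x) y) z"

lemma rhom_eval3: "rhom h \<Longrightarrow> rhom (eval3 h x y z)"
  unfolding eval3_def by (intro rhom_subst)

lemma eval3_gens:
  assumes "rhom h"
  shows "eval3 h x y z (const3 c) = h c" "eval3 h x y z varX = x" "eval3 h x y z varY = y"
    "eval3 h x y z varZ = z"
  unfolding eval3_def const3_def varX_def varY_def varZ_def
  using assms by (simp_all add: subst_pCons subst_0 rhom_subst rhom_simps)

lemma rhom_const3: "rhom const3"
  by (simp add: rhom_def const3_def one_pCons)

lemma poly3_induct:
  assumes const: "\<And>c. P (const3 c)" and vars: "P varX" "P varY" "P varZ"
    and add: "\<And>a b. P a \<Longrightarrow> P b \<Longrightarrow> P (a + b)" and mult: "\<And>a b. P a \<Longrightarrow> P b \<Longrightarrow> P (a * b)"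
  shows "P p"
proof -
  have split: "pCons a q = [:a:] + [:0, 1:] * q" for a :: "'a::comm_ring_1" and q by simp
  have 0: "P 0" using const[of 0] by (simp add: const3_def)
  have 1: "P [:[:q:]:]" for q
  proof (induction q)
    case (pCons a q)
    have "[:[:pCons a q:]:] = const3 a + varX * [:[:q:]:]" by (simp add: const3_def varX_def)
    then show ?case using pCons const vars add mult by metis
  qed (use 0 in simp)
  have 2: "P [:q:]" for q
  proof (induction q)
    case (pCons a q)
    have "[:pCons a q:] = [:[:a:]:] + varY * [:q:]" by (simp add: varY_def)
    then show ?case using pCons 1 vars add mult by metis
  qed (use 0 in simp)
  show ?thesis
  proof (induction p)
    case (pCons a q)
    have "pCons a q = [:a:] + varZ * q" by (simp add: varZ_def)
    then show ?case using pCons 2 vars add mult by metis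
  qed (use 0 in simp)
qed

lemma rhom_eqI:
  assumes "rhom f" "rhom g" "\<And>c. f (const3 c) = g (const3 c)" "f varX = g varX" "f varY = g varY" "f varZ = g varZ"
  shows "f p = g p"
  by (induction p rule: poly3_induct) (simp_all add: assms rhom_simps)

lemma subst_zero_coeff:
  fixes h :: "'a::comm_ring_1 \<Rightarrow> 'k::idom"
  assumes inf: "infinite (UNIV :: 'k set)" and "rhom h" and "\<And>x. subst h x p = 0"
  shows "h (coeff p n) = 0"
proof -
  have "map_poly h p = 0"
  proof (rule ccontr)
    assume "map_poly h p \<noteq> 0"
    then have "finite {x. poly (map_poly h p) x = 0}" by (rule poly_roots_finite)
    then show False using inf assms(3) by (simp add: subst_def)
  qed
  then show ?thesis using coeff_map_poly[of h p n] rhom_simps(1)[OF assms(2)] by simp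
qed

text \<open>Polynomials are determined by their values in an infinite domain that contains the coefficients.\<close>
lemma subst2_zero:
  fixes h :: "'a::comm_ring_1 \<Rightarrow> 'k::idom"
  assumes inf: "infinite (UNIV :: 'k set)" and h: "rhom h" "inj h" and zero: "\<And>y z. subst (subst h y) z p = 0"
  shows "p = 0"
proof -
  have "subst h y (coeff p n) = 0" for y n by (rule subst_zero_coeff[OF inf rhom_subst[OF h(1)] zero])
  then have "h (coeff (coeff p n) m) = 0" for n m by (rule subst_zero_coeff[OF inf h(1)])
  then have "coeff (coeff p n) m = 0" for n m using h rhom_simps(1) by (metis injD)
  then show ?thesis by (simp add: poly_eq_iff)
qed

lemma eval3_zero:
  fixes h :: "'r::comm_ring_1 \<Rightarrow> 'k::idom"
  assumes inf: "infinite (UNIV :: 'k set)" and h: "rhom h" "inj h" and zero: "\<And>x y z. eval3 h x y z p = 0"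
  shows "p = 0"
proof -
  have "subst (subst h x) y (coeff p n) = 0" for x y n
    using zero unfolding eval3_def by (rule subst_zero_coeff[OF inf rhom_subst[OF rhom_subst[OF h(1)]]])
  then have "coeff p n = 0" for n by (rule subst2_zero[OF inf h])
  then show ?thesis by (simp add: poly_eq_iff)
qed

section \<open>Kernel elements are constant along the flow\<close>

lemma of_nat_poly3_nonzero:
  assumes "\<And>n. of_nat (Suc n) \<noteq> (0 :: 'r::idom)"
  shows "of_nat (Suc n) \<noteq> (0 :: 'r poly3)"
proof -
  have eq: "of_nat (Suc n) = const3 (of_nat (Suc n) :: 'r)"
    by (simp add: const3_def of_nat_poly del: of_nat_Suc)
  show ?thesis unfolding eq using assms[of n] by (simp add: const3_def del: of_nat_Suc)
qed

lemma derivation_simps: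
  fixes D :: "'r::comm_ring_1 poly3 \<Rightarrow> 'r poly3"
  assumes "derivation scalars D"
  shows "D (a + b) = D a + D b" "D (a * b) = a * D b + D a * b" "D (const3 c) = 0" "D 0 = 0" "D 1 = 0"
    "D (- a) = - D a" "D (a - b) = D a - D b" "D (const3 c * a) = const3 c * D a"
proof -
  have d: "\<And>a b. D (a + b) = D a + D b" "\<And>a b. D (a * b) = a * D b + D a * b"
    "\<And>c b. D (const3 c * b) = const3 c * D b"
    using assms by (auto simp: derivation_def scalars_def)
  have 0: "D 0 = 0" using d(1)[of 0 0] by simp
  have 1: "D 1 = 0" using d(2)[of 1 1] by simp
  have m: "D (- a) = - D a" for a using d(1)[of a "- a"] 0 by (simp add: eq_neg_iff_add_eq_0 add.commute)
  show "D (a + b) = D a + D b" "D (a * b) = a * D b + D a * b" "D 0 = 0" "D 1 = 0" "D (- a) = - D a"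
    "D (const3 c * a) = const3 c * D a" by fact+
  show "D (const3 c) = 0" using d(3)[of c 1] 1 by simp
  show "D (a - b) = D a - D b" using d(1)[of a "- b"] m by simp
qed

text \<open>The flow \<open>p(X + t DX, Y + t DY, Z + t DZ)\<close>, as a polynomial in \<open>t\<close> over \<open>R[X,Y,Z]\<close>.\<close>
definition flow :: "('r::comm_ring_1 poly3 \<Rightarrow> 'r poly3) \<Rightarrow> 'r poly3 \<Rightarrow> 'r poly3 poly" where
  "flow D = eval3 (\<lambda>c. [:const3 c:]) [:varX, D varX:] [:varY, D varY:] [:varZ, D varZ:]"

lemma rhom_flow_base: "rhom (\<lambda>c. [:const3 c:])"
  by (rule rhom_comp[OF rhom_const_poly rhom_const3])

lemma rhom_flow: "rhom (flow D)"
  unfolding flow_def by (rule rhom_eval3[OF rhom_flow_base])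

lemma flow_gens:
  "flow D (const3 c) = [:const3 c:]" "flow D varX = [:varX, D varX:]" "flow D varY = [:varY, D varY:]"
  "flow D varZ = [:varZ, D varZ:]"
  unfolding flow_def by (simp_all add: eval3_gens[OF rhom_flow_base])

lemma coeff_map_poly_derivation:
  assumes "derivation scalars D" shows "coeff (map_poly D p) n = D (coeff p n)"
  by (rule coeff_map_poly) (rule derivation_simps(4)[OF assms])

lemma map_poly_derivation_mult:
  assumes "derivation scalars D"
  shows "map_poly D (p * q) = p * map_poly D q + map_poly D p * q"
proof -
  note d = derivation_simps[OF assms]
  have sum: "D (sum f I) = (\<Sum>i\<in>I. D (f i))" for f and I :: "nat set"
    by (induction I rule: infinite_finite_induct) (auto simp: d)
  show ?thesis
    by (simp add: poly_eq_iff coeff_map_poly_derivation[OF assms] coeff_mult sum d sum.distrib)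
qed

text \<open>Since \<open>D\<^sup>2\<close> kills the variables, the flow solves \<open>d/dt = D\<close>; in characteristic \<open>0\<close> a kernel element
  is therefore a constant of the flow.\<close>
lemma flow_kernel:
  fixes D :: "'r::idom poly3 \<Rightarrow> 'r poly3"
  assumes der: "derivation scalars D" and char0: "\<And>n. of_nat (Suc n) \<noteq> (0 :: 'r)"
    and sq: "D (D varX) = 0" "D (D varY) = 0" "D (D varZ) = 0" and p: "D p = 0"
  shows "flow D p = [:p:]"
proof -
  note d = derivation_simps[OF der]
  note r = rhom_simps[OF rhom_flow]
  have map2: "map_poly D [:a, b:] = [:D a, D b:]" for a b
    by (simp add: map_poly_pCons d)
  have ode: "pderiv (flow D q) = map_poly D (flow D q)" for q
  proof (induction q rule: poly3_induct)
    case (5 a b)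
    then show ?case by (simp add: r pderiv_add poly_eq_iff coeff_map_poly_derivation[OF der] d)
  next
    case (6 a b)
    then show ?case by (simp add: r pderiv_mult map_poly_derivation_mult[OF der] algebra_simps)
  qed (simp_all add: flow_gens map2 map_poly_pCons d sq pderiv_pCons)
  have start: "coeff (flow D q) 0 = q" for q
    by (induction q rule: poly3_induct) (simp_all add: flow_gens r coeff_mult_0)
  have "coeff (flow D p) (Suc n) = 0" for n
  proof -
    have *: "of_nat (Suc n) * coeff (flow D p) (Suc n) = D (coeff (flow D p) n)" for n
      using ode[of p] coeff_pderiv[of "flow D p" n] coeff_map_poly_derivation[OF der, of "flow D p" n] by simp
    note nz = of_nat_poly3_nonzero[OF char0]
    show ?thesis
    proof (induction n)
      case 0
      show ?case using *[of 0] p by (simp add: start)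
    next
      case (Suc n)
      then show ?case using *[of "Suc n"] nz[of "Suc n"] by (simp add: d del: of_nat_Suc)
    qed
  qed
  then have "coeff (flow D p) n = coeff [:p:] n" for n by (cases n) (simp_all add: start)
  then show ?thesis by (simp add: poly_eq_iff)
qed

text \<open>The point \<open>(x, y, z)\<close> and the time \<open>t\<close> may lie in any extension of \<open>R\<close>; the fields of fractions of
  \<open>R\<close>, \<open>R[X]\<close> and \<open>R[X,Y,Z]\<close> all occur below.\<close>
lemma kernel_translation:
  fixes D :: "'r::idom poly3 \<Rightarrow> 'r poly3"
  assumes der: "derivation scalars D" and char0: "\<And>n. of_nat (Suc n) \<noteq> (0 :: 'r)"
    and sq: "D (D varX) = 0" "D (D varY) = 0" "D (D varZ) = 0" and p: "D p = 0" and h: "rhom h"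
  shows "eval3 h (x + t * eval3 h x y z (D varX)) (y + t * eval3 h x y z (D varY))
      (z + t * eval3 h x y z (D varZ)) p = eval3 h x y z p"
proof -
  let ?E = "eval3 h x y z"
  note E = rhom_eval3[OF h, of x y z]
  have "subst ?E t (flow D q) = eval3 h (x + t * ?E (D varX)) (y + t * ?E (D varY)) (z + t * ?E (D varZ)) q" for q
    by (rule rhom_eqI[OF rhom_comp[OF rhom_subst[OF E] rhom_flow] rhom_eval3[OF h]])
      (simp_all add: flow_gens eval3_gens[OF h] subst_pCons[OF E] subst_0)
  then show ?thesis using flow_kernel[OF assms(1-6)] by (metis subst_const[OF E])
qed

lemma eval3_polyfn:
  assumes h: "rhom h" and xyz: "polyfun_vec x" "polyfun_vec y" "polyfun_vec z"
  shows "polyfun_vec (\<lambda>v. eval3 h (x v) (y v) (z v) p)"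
  by (induction p rule: poly3_induct)
    (simp_all add: eval3_gens[OF h] rhom_simps[OF rhom_eval3[OF h]] xyz polyfun_vec.intros)

section \<open>Linear dependence of \<open>DX, DY, DZ\<close>\<close>

lemma infinite_fract:
  assumes "infinite (UNIV :: 'r::idom set)" shows "infinite (UNIV :: 'r fract set)"
proof -
  have "inj (to_fract :: 'r \<Rightarrow> 'r fract)" by (auto intro: injI)
  then show ?thesis using assms by (meson finite_imageD finite_subset subset_UNIV)
qed

lemma infinite_poly:
  assumes "infinite (UNIV :: 'r::idom set)" shows "infinite (UNIV :: 'r poly set)"
proof -
  have "inj (\<lambda>c :: 'r. [:c:])" by (auto intro: injI)
  then show ?thesis using assms by (meson finite_imageD finite_subset subset_UNIV)
qed

lemma clear_denominator:
  fixes a :: "'r::idom fract"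
  obtains d n where "d \<noteq> 0" "to_fract d * a = to_fract n"
proof (cases a)
  case (Fract p q)
  then have "to_fract q * a = to_fract p" by (simp add: to_fract_def eq_fract)
  then show ?thesis using that Fract by blast
qed

text \<open>At the points of \<open>K\<^sup>3\<close>, where \<open>K\<close> is the field of fractions of \<open>R\<close>, the triple \<open>(DX, DY, DZ)\<close> is a
  quasi-translation; a relation between its entries over \<open>K\<close> becomes one over \<open>R\<close>.\<close>
theorem linear_form_in_kernel:
  fixes D :: "'r::idom poly3 \<Rightarrow> 'r poly3"
  assumes inf: "infinite (UNIV :: 'r set)" and der: "derivation scalars D"
    and char0: "\<And>n. of_nat (Suc n) \<noteq> (0 :: 'r)"
    and sq: "D (D varX) = 0" "D (D varY) = 0" "D (D varZ) = 0"
  shows "\<exists>a b c. (a, b, c) \<noteq> (0, 0, 0) \<and> const3 a * varX + const3 b * varY + const3 c * varZ \<in> Ker D"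
proof -
  note d = derivation_simps[OF der]
  define E where "E v = eval3 (to_fract :: 'r \<Rightarrow> _) (v $ 1) (v $ 2) (v $ 3)" for v :: "'r fract ^ 3"
  define F where "F v = (vector [E v (D varX), E v (D varY), E v (D varZ)] :: 'r fract ^ 3)" for v
  have E: "rhom (E v)" for v unfolding E_def by (rule rhom_eval3[OF rhom_to_fract])
  have "polyfun_vec (\<lambda>v. F v $ i)" for i
    using exhaust_3[of i] eval3_polyfn[OF rhom_to_fract polyfun_vec.coord polyfun_vec.coord polyfun_vec.coord]
    by (auto simp: F_def E_def)
  moreover have "F (v + t *s F v) = F v" for t v
  proof -
    have "E (v + t *s F v) p = E v p" if "D p = 0" for p
      using kernel_translation[OF der char0 sq that rhom_to_fract, of "v $ 1" t "v $ 2" "v $ 3"]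
      by (simp add: E_def F_def)
    then show ?thesis using sq by (subst (1 3) F_def) simp
  qed
  ultimately obtain a :: "'r fract ^ 3" where a: "a \<noteq> 0" "\<And>v. a $ 1 * F v $ 1 + a $ 2 * F v $ 2 + a $ 3 * F v $ 3 = 0"
    using quasi_translation_dependent_3[OF infinite_fract[OF inf], of F] by blast
  obtain d1 n1 where 1: "d1 \<noteq> 0" "to_fract d1 * a $ 1 = to_fract n1" by (rule clear_denominator)
  obtain d2 n2 where 2: "d2 \<noteq> 0" "to_fract d2 * a $ 2 = to_fract n2" by (rule clear_denominator)
  obtain d3 n3 where 3: "d3 \<noteq> 0" "to_fract d3 * a $ 3 = to_fract n3" by (rule clear_denominator)
  define b1 b2 b3 where "b1 = d2 * d3 * n1" and "b2 = d1 * d3 * n2" and "b3 = d1 * d2 * n3"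
  have b: "to_fract b1 = to_fract (d1 * d2 * d3) * a $ 1" "to_fract b2 = to_fract (d1 * d2 * d3) * a $ 2"
    "to_fract b3 = to_fract (d1 * d2 * d3) * a $ 3"
    unfolding b1_def b2_def b3_def by (simp_all flip: 1(2) 2(2) 3(2))
  define p where "p = const3 b1 * D varX + const3 b2 * D varY + const3 b3 * D varZ"
  have "E v p = 0" for v
  proof -
    have "E v p = to_fract (d1 * d2 * d3) * (a $ 1 * F v $ 1 + a $ 2 * F v $ 2 + a $ 3 * F v $ 3)"
      unfolding p_def rhom_simps[OF E] by (simp add: E_def F_def eval3_gens[OF rhom_to_fract] b distrib_left)
    then show ?thesis using a by simp
  qed
  then have "eval3 to_fract x y z p = 0" for x y z
    using E_def[of "vector [x, y, z]"] by (metis vector_3)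
  then have "p = 0"
    by (rule eval3_zero[OF infinite_fract[OF inf] rhom_to_fract, rotated]) (auto intro: injI)
  moreover have "(b1, b2, b3) \<noteq> (0, 0, 0)"
  proof
    assume "(b1, b2, b3) = (0, 0, 0)"
    then have "a = 0" using b 1(1) 2(1) 3(1) by (simp add: vec_eq_iff forall_3)
    then show False using a by simp
  qed
  ultimately show ?thesis
    by (intro exI[of _ b1] exI[of _ b2] exI[of _ b3]) (simp add: Ker_def d p_def)
qed

text \<open>If \<open>X\<close> is in the kernel, the same argument in the two variables \<open>Y, Z\<close> over the field of
  fractions of \<open>R[X]\<close> applies.\<close>
theorem dependence_over_univariate:
  fixes D :: "'r::idom poly3 \<Rightarrow> 'r poly3"
  assumes inf: "infinite (UNIV :: 'r set)" and der: "derivation scalars D"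
    and char0: "\<And>n. of_nat (Suc n) \<noteq> (0 :: 'r)"
    and X: "D varX = 0" and sq: "D (D varY) = 0" "D (D varZ) = 0"
  shows "\<exists>a b. (a, b) \<noteq> (0, 0) \<and> [:[:a:]:] * D varY + [:[:b:]:] * D varZ = 0"
proof -
  note d = derivation_simps[OF der]
  define h where "h = (\<lambda>c :: 'r. to_fract [:c:])"
  have h: "rhom h" unfolding h_def by (rule rhom_comp[OF rhom_to_fract rhom_const_poly])
  have base: "subst h (to_fract [:0, 1:]) q = to_fract q" for q
  proof (induction q)
    case (pCons a q)
    have "to_fract (pCons a q) = to_fract [:a:] + to_fract [:0, 1:] * to_fract q"
      by (simp flip: to_fract_add to_fract_mult)
    moreover have "h a = to_fract [:a:]" by (simp add: h_def)
    ultimately show ?case using pCons by (simp add: subst_pCons[OF h])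
  qed (simp add: subst_0)
  define E where "E v = eval3 h (to_fract [:0, 1:]) (v $ 1) (v $ 2)" for v :: "'r poly fract ^ 2"
  have E2: "E v = subst (subst to_fract (v $ 1)) (v $ 2)" for v
  proof -
    have "subst h (to_fract [:0, 1:]) = to_fract" using base by auto
    then show ?thesis unfolding E_def eval3_def by simp
  qed
  have E: "rhom (E v)" for v unfolding E_def by (rule rhom_eval3[OF h])
  define F where "F v = (vector [E v (D varY), E v (D varZ)] :: 'r poly fract ^ 2)" for v
  have "polyfun_vec (\<lambda>v. F v $ i)" for i
    using exhaust_2[of i] eval3_polyfn[OF h polyfun_vec.const polyfun_vec.coord polyfun_vec.coord]
    by (auto simp: F_def E_def)
  moreover have "F (v + t *s F v) = F v" for t v
  proof -
    have "E (v + t *s F v) p = E v p" if "D p = 0" for p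
    proof -
      have sqX: "D (D varX) = 0" by (simp add: X d)
      show ?thesis
        using kernel_translation[OF der char0 sqX sq that h, of "to_fract [:0, 1:]" t "v $ 1" "v $ 2"]
        by (simp add: E_def F_def X rhom_simps[OF rhom_eval3[OF h]])
    qed
    then show ?thesis using sq by (subst (1 3) F_def) simp
  qed
  ultimately obtain a b where ab: "(a, b) \<noteq> (0, 0)" "\<And>v. a * F v $ 1 + b * F v $ 2 = 0"
    using quasi_translation_dependent_2[OF infinite_fract[OF infinite_poly[OF inf]], of F] by blast
  obtain d1 n1 where 1: "d1 \<noteq> 0" "to_fract d1 * a = to_fract n1" by (rule clear_denominator)
  obtain d2 n2 where 2: "d2 \<noteq> 0" "to_fract d2 * b = to_fract n2" by (rule clear_denominator)
  have c: "to_fract (d2 * n1) = to_fract (d1 * d2) * a" "to_fract (d1 * n2) = to_fract (d1 * d2) * b"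
    by (simp_all flip: 1(2) 2(2))
  define p where "p = [:[:d2 * n1:]:] * D varY + [:[:d1 * n2:]:] * D varZ"
  have Ec: "E v [:[:q:]:] = to_fract q" for v q
    by (simp add: E2 subst_const rhom_subst rhom_to_fract)
  have "E v p = 0" for v
  proof -
    have "E v p = to_fract (d1 * d2) * (a * F v $ 1 + b * F v $ 2)"
      unfolding p_def rhom_simps[OF E] Ec c by (simp add: F_def distrib_left)
    then show ?thesis using ab by simp
  qed
  then have "subst (subst to_fract y) z p = 0" for y z
    using E2[of "vector [y, z]"] by (metis vector_2)
  then have "p = 0"
    by (rule subst2_zero[OF infinite_fract[OF infinite_poly[OF inf]] rhom_to_fract, rotated]) (auto intro: injI)
  moreover have "(d2 * n1, d1 * n2) \<noteq> (0, 0)"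
  proof
    assume "(d2 * n1, d1 * n2) = (0, 0)"
    then have "n1 = 0" "n2 = 0" using 1(1) 2(1) by auto
    then have "a = 0" "b = 0" using 1 2 by auto
    then show False using ab by simp
  qed
  ultimately show ?thesis unfolding p_def by blast
qed

section \<open>Elimination of constants\<close>

abbreviation emb :: "'r::comm_ring_1 poly \<Rightarrow> 'r poly3" where
  "emb q \<equiv> [:[:q:]:]"

lemma rhom_emb: "rhom emb"
  by (rule rhom_comp[OF rhom_const_poly rhom_const_poly])

lemma const3_emb: "const3 c = emb [:c:]"
  by (simp add: const3_def)

lemma const3_dvd_iff: "const3 (c :: 'r::idom) dvd emb q \<longleftrightarrow> [:c:] dvd q"
  by (simp add: const3_def const_poly_dvd_const_poly_iff)

lemma prime_elem_const3: "prime_elem (p :: 'r::idom) \<Longrightarrow> prime_elem (const3 p)"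
  unfolding const3_def by (intro lift_prime_elem_poly)

lemma unit_poly3:
  fixes e :: "'r::idom poly3"
  assumes "e dvd 1" obtains u where "e = const3 u" "u dvd 1"
  using assms by (auto simp: is_unit_poly_iff const3_def)

lemma const3_unit_iff: "const3 (c :: 'r::idom) dvd 1 \<longleftrightarrow> c dvd 1"
  by (auto simp: is_unit_poly_iff const3_def)

lemma const3_eq_0_iff [simp]: "const3 c = 0 \<longleftrightarrow> c = 0"
  by (simp add: const3_def)

text \<open>If no prime of \<open>R\<close> divides both \<open>f\<close> and \<open>g\<close>, then a constant that divides \<open>f c\<close> and \<open>g c\<close>
  divides \<open>c\<close>, one prime at a time: primes of \<open>R\<close> stay prime in \<open>R[X,Y,Z]\<close>.\<close>
lemma constant_dvd_cancel:
  fixes f g :: "'r::idom poly3"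
  assumes pid: "principal_ideals TYPE('r)"
    and coprime: "\<And>p. prime_elem p \<Longrightarrow> \<not> (const3 p dvd f \<and> const3 p dvd g)"
    and "k \<noteq> 0" "const3 k dvd f * c" "const3 k dvd g * c"
  shows "const3 k dvd c"
proof -
  have "\<forall>c. const3 k dvd f * c \<longrightarrow> const3 k dvd g * c \<longrightarrow> const3 k dvd c"
    using pid \<open>k \<noteq> 0\<close>
  proof (rule prime_factor_induct)
    fix u :: 'r assume "u dvd 1"
    then have "const3 u dvd 1" by (simp add: const3_unit_iff)
    then have "const3 u dvd c" for c by (rule dvd_trans) (rule one_dvd)
    then show "\<forall>c. const3 u dvd f * c \<longrightarrow> const3 u dvd g * c \<longrightarrow> const3 u dvd c"
      by simp
  next
    fix p x :: 'r assume p: "prime_elem p" and "x \<noteq> 0"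
      and IH: "\<forall>c. const3 x dvd f * c \<longrightarrow> const3 x dvd g * c \<longrightarrow> const3 x dvd c"
    have px: "const3 (p * x) = const3 p * const3 x" by (rule rhom_simps(4)[OF rhom_const3])
    have pp: "prime_elem (const3 p)" using p by (rule prime_elem_const3)
    show "\<forall>c. const3 (p * x) dvd f * c \<longrightarrow> const3 (p * x) dvd g * c \<longrightarrow> const3 (p * x) dvd c"
    proof (intro allI impI)
      fix c assume c: "const3 (p * x) dvd f * c" "const3 (p * x) dvd g * c"
      then have "const3 p dvd f * c" "const3 p dvd g * c" unfolding px using dvd_mult_left by blast+
      then have "const3 p dvd c" using coprime[OF p] pp by (auto simp: prime_elem_dvd_mult_iff)
      then obtain c' where c': "c = const3 p * c'" by (elim dvdE)
      have p0: "const3 p \<noteq> 0" using pp unfolding prime_elem_def by blast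
      have "const3 p * const3 x dvd const3 p * (f * c')" "const3 p * const3 x dvd const3 p * (g * c')"
        using c unfolding c' px by (simp_all only: mult.left_commute[of _ "const3 p"])
      then have "const3 x dvd f * c'" "const3 x dvd g * c'" using p0 by simp_all
      then have "const3 x dvd c'" using IH by blast
      then show "const3 (p * x) dvd c" unfolding c' px by (rule mult_dvd_mono[OF dvd_refl])
    qed
  qed
  then show ?thesis using assms by blast
qed

text \<open>Removing the primes of \<open>k\<close> one by one, either from the common factor \<open>e\<close> or from both
  cofactors, turns a common factor over the field of fractions of \<open>R\<close> into one over \<open>R\<close>.\<close>
lemma common_factor_descent:
  fixes f g :: "'r::idom poly3"
  assumes pid: "principal_ideals TYPE('r)" and "k \<noteq> 0"
    and "const3 k * f = emb a * e" "const3 k * g = emb b * e"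
  shows "\<exists>a' b' e' c. f = emb a' * e' \<and> g = emb b' * e' \<and> a = [:c:] * a' \<and> b = [:c:] * b'"
proof -
  let ?P = "\<lambda>k. \<forall>a b e. const3 k * f = emb a * e \<longrightarrow> const3 k * g = emb b * e \<longrightarrow>
    (\<exists>a' b' e' c. f = emb a' * e' \<and> g = emb b' * e' \<and> a = [:c:] * a' \<and> b = [:c:] * b')"
  have "?P k"
    using pid \<open>k \<noteq> 0\<close>
  proof (rule prime_factor_induct)
    fix u :: 'r assume "u dvd 1"
    then obtain w where w: "1 = u * w" by (elim dvdE)
    then have uw: "const3 w * const3 u = 1"
      by (simp add: rhom_simps[OF rhom_const3] mult.commute flip: rhom_simps(4)[OF rhom_const3])
    show "?P u"
    proof (intro allI impI)
      fix a b e assume ab: "const3 u * f = emb a * e" "const3 u * g = emb b * e"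
      have "const3 w * (const3 u * f) = emb a * (const3 w * e)"
        "const3 w * (const3 u * g) = emb b * (const3 w * e)"
        unfolding ab by (simp_all only: mult.left_commute)
      then have "f = emb a * (const3 w * e)" "g = emb b * (const3 w * e)"
        unfolding mult.assoc[symmetric] uw by simp_all
      then show "\<exists>a' b' e' c. f = emb a' * e' \<and> g = emb b' * e' \<and> a = [:c:] * a' \<and> b = [:c:] * b'"
        by - (rule exI[of _ a], rule exI[of _ b], rule exI[of _ "const3 w * e"], rule exI[of _ 1], simp)
    qed
  next
    fix p x :: 'r assume p: "prime_elem p" and "x \<noteq> 0" and IH: "?P x"
    have px: "const3 (p * x) = const3 p * const3 x" by (rule rhom_simps(4)[OF rhom_const3])
    have pp: "prime_elem (const3 p)" using p by (rule prime_elem_const3)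
    then have p0: "const3 p \<noteq> 0" unfolding prime_elem_def by blast
    show "?P (p * x)"
    proof (intro allI impI)
      fix a b e assume ab: "const3 (p * x) * f = emb a * e" "const3 (p * x) * g = emb b * e"
      then have "const3 p dvd emb a * e" "const3 p dvd emb b * e"
        unfolding px by (metis dvd_triv_left mult.assoc)+
      then consider "const3 p dvd e" | "const3 p dvd emb a" "const3 p dvd emb b"
        using prime_elem_dvd_multD[OF pp] by blast
      then show "\<exists>a' b' e' c. f = emb a' * e' \<and> g = emb b' * e' \<and> a = [:c:] * a' \<and> b = [:c:] * b'"
      proof cases
        case 1
        then obtain e' where e': "e = const3 p * e'" by (elim dvdE)
        have "const3 p * (const3 x * f) = const3 p * (emb a * e')"
          "const3 p * (const3 x * g) = const3 p * (emb b * e')"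
          using ab unfolding px e' by (simp_all only: mult.assoc mult.left_commute[of "const3 p"])
        then have "const3 x * f = emb a * e'" "const3 x * g = emb b * e'" unfolding mult_left_cancel[OF p0] .
        then show ?thesis using IH by blast
      next
        case 2
        then obtain a1 b1 where a1: "a = [:p:] * a1" "b = [:p:] * b1"
          unfolding const3_dvd_iff by (elim dvdE) blast
        then have e1: "emb a = const3 p * emb a1" "emb b = const3 p * emb b1"
          by (simp_all add: const3_def)
        have "const3 p * (const3 x * f) = const3 p * (emb a1 * e)"
          "const3 p * (const3 x * g) = const3 p * (emb b1 * e)"
          using ab unfolding px e1 by (simp_all only: mult.assoc)
        then have "const3 x * f = emb a1 * e" "const3 x * g = emb b1 * e" unfolding mult_left_cancel[OF p0] .
        then obtain a' b' e' c where "f = emb a' * e'" "g = emb b' * e'" "a1 = [:c:] * a'" "b1 = [:c:] * b'"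
          using IH by blast
        then show ?thesis
          by - (rule exI[of _ a'], rule exI[of _ b'], rule exI[of _ e'], rule exI[of _ "p * c"],
              simp add: a1 mult.commute[of c])
      qed
    qed
  qed
  then show ?thesis using assms by blast
qed

text \<open>Bezout's identity over the field of fractions of \<open>R\<close>, with denominators cleared: \<open>m\<close> is a
  nonzero element of least degree in the ideal generated by \<open>a\<close> and \<open>b\<close>.\<close>
lemma bezout_up_to_constant:
  fixes a b :: "'r::idom poly"
  assumes "(a, b) \<noteq> (0, 0)"
  obtains k m a1 b1 s t where "k \<noteq> 0" "m \<noteq> 0" "smult k a = m * a1" "smult k b = m * b1" "s * a1 + t * b1 = [:k:]"
proof -
  define I where "I = {s * a + t * b | s t. True}"
  have I: "ideal_closed I" unfolding I_def by (rule ideal_closed_two)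
  have "a = 1 * a + 0 * b" "b = 0 * a + 1 * b" by simp_all
  then have ab: "a \<in> I" "b \<in> I" unfolding I_def by blast+
  then have "\<exists>m. m \<in> I \<and> m \<noteq> 0" using assms by auto
  then obtain m where m: "m \<in> I" "m \<noteq> 0" and least: "\<And>x. x \<in> I \<and> x \<noteq> 0 \<Longrightarrow> degree m \<le> degree x"
    using ex_has_least_nat[of "\<lambda>m. m \<in> I \<and> m \<noteq> 0" _ degree] by blast
  have divides: "\<exists>c q. c \<noteq> 0 \<and> smult c x = m * q" if x: "x \<in> I" for x
  proof -
    obtain q r where qr: "pseudo_divmod x m = (q, r)" by (cases "pseudo_divmod x m")
    define c where "c = coeff m (degree m) ^ (Suc (degree x) - degree m)"
    have 1: "smult c x = m * q + r" "r = 0 \<or> degree r < degree m"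
      using pseudo_divmod[OF m(2) qr] by (simp_all add: c_def)
    have "[:c:] * x \<in> I" "q * m \<in> I" using I x m(1) unfolding ideal_closed_def by blast+
    then have "[:c:] * x - q * m \<in> I" by (rule ideal_closed_diff[OF I])
    then have "r \<in> I" using 1(1) by (simp add: mult.commute)
    then have "r = 0" using 1(2) least[of r] by (metis not_le)
    moreover have "c \<noteq> 0" using m(2) by (simp add: c_def)
    ultimately show ?thesis using 1(1) by auto
  qed
  obtain c1 q1 where 1: "c1 \<noteq> 0" "smult c1 a = m * q1" using divides[OF ab(1)] by blast
  obtain c2 q2 where 2: "c2 \<noteq> 0" "smult c2 b = m * q2" using divides[OF ab(2)] by blast
  obtain s t where st: "m = s * a + t * b" using m(1) unfolding I_def by blast
  define a1 b1 where "a1 = smult c2 q1" and "b1 = smult c1 q2"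
  have "smult (c1 * c2) a = smult c2 (smult c1 a)" by (simp add: mult.commute)
  then have 3: "smult (c1 * c2) a = m * a1" by (simp add: 1 a1_def)
  have "smult (c1 * c2) b = smult c1 (smult c2 b)" by simp
  then have 4: "smult (c1 * c2) b = m * b1" by (simp add: 2 b1_def)
  have "m * (s * a1 + t * b1) = s * smult (c1 * c2) a + t * smult (c1 * c2) b"
    unfolding 3 4 by (simp add: algebra_simps)
  also have "\<dots> = smult (c1 * c2) m" unfolding st by (simp add: smult_add_right)
  also have "\<dots> = m * [:c1 * c2:]" by simp
  finally have "s * a1 + t * b1 = [:c1 * c2:]" using m(2) by (metis mult_left_cancel)
  then show ?thesis using that[of "c1 * c2" m a1 b1 s t] 1(1) 2(1) m(2) 3 4 by simp
qed

section \<open>Derivations killing the first variable\<close>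

lemma derivation_range:
  assumes der: "derivation scalars D" and I: "ideal_closed I" and gens: "D varX \<in> I" "D varY \<in> I" "D varZ \<in> I"
  shows "D h \<in> I"
proof (induction h rule: poly3_induct)
  case (6 a b)
  then have "a * D b + b * D a \<in> I" using I unfolding ideal_closed_def by blast
  then show ?case by (simp add: derivation_simps[OF der] mult.commute)
qed (use I gens in \<open>auto simp: derivation_simps[OF der] ideal_closed_def\<close>)

lemma ideal_closed_dvd: "ideal_closed {x. b dvd x}"
  by (auto simp: ideal_closed_def)

text \<open>\<open>DY\<close> and \<open>DZ\<close> are dependent over \<open>R[X]\<close>, hence have a common factor with cofactors in \<open>R[X]\<close>;
  irreducibility makes that factor a unit.\<close>
lemma coefficients_univariate:
  fixes D :: "'r::idom poly3 \<Rightarrow> 'r poly3"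
  assumes pid: "principal_ideals TYPE('r)" and der: "derivation scalars D" and irr: "\<not> reducible_der D"
    and X: "D varX = 0" and ab: "(a, b) \<noteq> (0, 0)" "emb a * D varY + emb b * D varZ = 0"
  obtains f0 g0 s t k where "D varY = emb f0" "D varZ = emb g0" "s * f0 + t * g0 = [:k:]" "k \<noteq> 0"
proof -
  let ?f = "D varY" and ?g = "D varZ"
  note emb = rhom_emb
  note e = rhom_simps[OF emb]
  obtain k m a1 b1 s t where k: "k \<noteq> 0" "m \<noteq> 0" "smult k a = m * a1" "smult k b = m * b1"
    "s * a1 + t * b1 = [:k:]" using bezout_up_to_constant[OF ab(1)] .
  have "emb m * (emb a1 * ?f + emb b1 * ?g) = emb (m * a1) * ?f + emb (m * b1) * ?g"
    unfolding e by (simp only: distrib_left mult.assoc)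
  also have "\<dots> = const3 k * (emb a * ?f + emb b * ?g)"
    unfolding k(3,4)[symmetric] by (simp add: const3_def smult_add_right)
  finally have "emb a1 * ?f + emb b1 * ?g = 0" using ab(2) k(2) by simp
  then have rel: "emb a1 * ?f = - emb b1 * ?g" by (simp only: eq_neg_iff_add_eq_0 mult_minus_left)
  have k': "const3 k = emb s * emb a1 + emb t * emb b1"
    unfolding const3_emb k(5)[symmetric] e ..
  define w where "w = emb s * ?g - emb t * ?f"
  have alg1: "S * (- B * x) + T * B * y = - B * (S * x - T * y)"
    and alg2: "S * A * x - T * (- B * x) = (S * A + T * B) * x" for S T A B x y :: "'r poly3"
    by (simp_all add: algebra_simps)
  have "const3 k * ?f = emb (- b1) * w"
  proof -
    have "const3 k * ?f = emb s * (emb a1 * ?f) + emb t * emb b1 * ?f"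
      unfolding k' by (simp only: distrib_right mult.assoc)
    also have "\<dots> = emb (- b1) * w" unfolding rel e w_def by (rule alg1)
    finally show ?thesis .
  qed
  moreover have "const3 k * ?g = emb a1 * w"
  proof -
    have "emb a1 * w = emb s * emb a1 * ?g - emb t * (emb a1 * ?f)"
      unfolding w_def by (simp only: right_diff_distrib mult.assoc mult.left_commute)
    also have "\<dots> = const3 k * ?g" unfolding rel k' by (rule alg2)
    finally show ?thesis by simp
  qed
  ultimately obtain b' a' w' c where w': "?f = emb b' * w'" "?g = emb a' * w'" "- b1 = [:c:] * b'" "a1 = [:c:] * a'"
    using common_factor_descent[OF pid k(1)] by metis
  have "w' dvd D h" for h
  proof -
    have "w' dvd ?f" "w' dvd ?g" unfolding w'(1,2) by (rule dvd_triv_right)+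
    then show ?thesis using derivation_range[OF der ideal_closed_dvd[of w'], of h] by (simp add: X)
  qed
  then have "w' dvd 1" using irr unfolding reducible_der_def by blast
  then obtain u where u: "w' = const3 u" "u dvd 1" by (rule unit_poly3)
  then obtain v where v: "1 = u * v" by (elim dvdE)
  have "s * ([:c:] * a') - t * ([:c:] * b') = [:k:]" using k(5) w'(3,4) by (metis add_uminus_conv_diff minus_minus mult_minus_right)
  moreover have "(smult v s * [:c:]) * ([:u:] * a') = smult (u * v) (s * ([:c:] * a'))"
    "(- smult v t * [:c:]) * ([:u:] * b') = - smult (u * v) (t * ([:c:] * b'))"
    by (simp_all add: mult_ac)
  ultimately have "(- smult v t * [:c:]) * ([:u:] * b') + (smult v s * [:c:]) * ([:u:] * a') = [:k:]"
    unfolding v[symmetric] by (simp only: smult_1_left) (simp add: algebra_simps)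
  moreover have "?f = emb ([:u:] * b')" "?g = emb ([:u:] * a')"
    by (simp_all add: w'(1,2) u const3_def)
  ultimately show ?thesis using that k(1) by blast
qed

lemma no_common_prime:
  fixes D :: "'r::idom poly3 \<Rightarrow> 'r poly3"
  assumes der: "derivation scalars D" and irr: "\<not> reducible_der D" and X: "D varX = 0" and p: "prime_elem p"
  shows "\<not> (const3 p dvd D varY \<and> const3 p dvd D varZ)"
proof
  assume "const3 p dvd D varY \<and> const3 p dvd D varZ"
  then have "const3 p dvd D h" for h
    using derivation_range[OF der ideal_closed_dvd[of "const3 p"], of h] by (simp add: X)
  then have "const3 p dvd 1" using irr unfolding reducible_der_def by blast
  then show False using p by (simp add: const3_unit_iff prime_elem_def)
qed

lemma subring_Ker: "derivation scalars D \<Longrightarrow> subring_closed (Ker D)"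
  by (simp add: subring_closed_def Ker_def derivation_simps)

lemma subring_range: "rhom h \<Longrightarrow> subring_closed (range h)"
  unfolding subring_closed_def by (auto simp: rhom_simps(2) simp flip: rhom_simps(3,4,5)) (metis rangeI rhom_simps(2))

lemma adjoin_emb: "adjoin scalars {varX} = range emb"
proof
  have "subring_closed (range (emb :: 'a poly \<Rightarrow> _))" by (rule subring_range[OF rhom_emb])
  then show "adjoin scalars {varX :: 'a poly3} \<subseteq> range emb"
    by (rule adjoin_least) (auto simp: scalars_def const3_def varX_def)
  have "emb q \<in> adjoin scalars {varX}" for q :: "'a poly"
  proof (induction q)
    case 0
    show ?case using subring_closed_0[OF subring_adjoin] by simp
  next
    case (pCons a q)
    have "emb (pCons a q) = const3 a + varX * emb q" by (simp add: const3_def varX_def)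
    moreover have "const3 a \<in> adjoin scalars {varX}" "varX \<in> adjoin scalars {varX}"
      by (auto intro: adjoin_incl simp: scalars_def)
    ultimately show ?case using pCons subring_adjoin[of scalars "{varX}"] by (metis subring_closed_def)
  qed
  then show "range emb \<subseteq> adjoin scalars {varX :: 'a poly3}" by blast
qed

lemma coeff_subst_monomial:
  "coeff (subst (\<lambda>q. [:q:]) [:0, c:] Q) n = c ^ n * coeff Q n"
proof (induction Q arbitrary: n)
  case 0
  show ?case by (simp add: subst_0)
next
  case (pCons a Q)
  then show ?case by (cases n) (simp_all add: subst_pCons[OF rhom_const_poly] mult.assoc)
qed

text \<open>Specializing \<open>Z = 0\<close> or \<open>Y = 0\<close> turns \<open>p = gY - fZ\<close> into a monomial in the other variable.\<close>
lemma specialization: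
  fixes f g :: "'r::idom poly"
  defines "p \<equiv> emb g * varY - emb f * varZ"
  shows "\<exists>\<eta>. rhom \<eta> \<and> (\<forall>q. \<eta> (emb q) = [:q:]) \<and> \<eta> p = [:0, g:]"
    and "\<exists>\<eta>. rhom \<eta> \<and> (\<forall>q. \<eta> (emb q) = [:q:]) \<and> \<eta> p = [:0, - f:]"
proof -
  show "\<exists>\<eta>. rhom \<eta> \<and> (\<forall>q. \<eta> (emb q) = [:q:]) \<and> \<eta> p = [:0, g:]"
    by (rule exI[of _ "\<lambda>q. poly q 0"]) (simp add: rhom_def p_def varY_def varZ_def)
  have h: "rhom (\<lambda>r :: 'r poly poly. [:poly r 0:])"
    by (rule rhom_comp[OF rhom_const_poly]) (simp add: rhom_def)
  note s = rhom_simps[OF rhom_subst[OF h]] subst_pCons[OF h] subst_0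
  show "\<exists>\<eta>. rhom \<eta> \<and> (\<forall>q. \<eta> (emb q) = [:q:]) \<and> \<eta> p = [:0, - f:]"
    by (rule exI[of _ "subst (\<lambda>r. [:poly r 0:]) [:0, 1:]"])
      (simp add: rhom_subst[OF h] p_def varY_def varZ_def s del: mult_pCons_left)
qed

section \<open>The kernel\<close>

text \<open>The elements \<open>Q(p)\<close> with \<open>Q\<close> over \<open>R[X]\<close> form \<open>R[X,p]\<close>. If a prime of \<open>R\<close> divides \<open>Q(p)\<close> in
  \<open>R[X,Y,Z]\<close>, the specialization of \<open>p\<close> to a monomial whose coefficient that prime does not divide
  shows that it divides \<open>Q\<close>.\<close>
lemma prime_dvd_univariate:
  fixes f g :: "'r::idom poly"
  defines "p \<equiv> emb g * varY - emb f * varZ"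
  assumes pr: "prime_elem c" and coprime: "\<not> ([:c:] dvd f \<and> [:c:] dvd g)"
    and dvd: "const3 c * b = subst emb p Q"
  shows "\<exists>Q'. b = subst emb p Q'"
proof -
  obtain \<eta> e where eta: "rhom \<eta>" "\<And>q. \<eta> (emb q) = [:q:]" "\<eta> p = [:0, e:]" and e: "\<not> [:c:] dvd e"
  proof (cases "[:c:] dvd g")
    case False
    then show ?thesis using that specialization(1)[where f = f and g = g] unfolding p_def by blast
  next
    case True
    then have "\<not> [:c:] dvd - f" using coprime by simp
    then show ?thesis using that specialization(2)[where f = f and g = g] unfolding p_def by blast
  qed
  note emb = rhom_emb
  have sub: "\<eta> (subst emb p Q) = subst (\<lambda>q. [:q:]) [:0, e:] Q" for Q
    by (induction Q)
      (simp_all add: subst_0 subst_pCons[OF emb] subst_pCons[OF rhom_const_poly] rhom_simps[OF eta(1)] eta(2,3)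
        del: mult_pCons_left)
  have pc: "prime_elem [:c:]" using pr by (rule lift_prime_elem_poly)
  have "[:c:] dvd coeff Q n" for n
  proof -
    have "[:[:c:]:] * \<eta> b = subst (\<lambda>q. [:q:]) [:0, e:] Q"
      using dvd sub[of Q] by (metis const3_emb eta(1,2) rhom_simps(4))
    then have "[:[:c:]:] dvd subst (\<lambda>q. [:q:]) [:0, e:] Q" by (metis dvd_triv_left)
    then have "[:c:] dvd e ^ n * coeff Q n"
      unfolding const_poly_dvd_iff coeff_subst_monomial by blast
    then show ?thesis using e pc by (metis prime_elem_dvd_multD prime_elem_dvd_power)
  qed
  then have "[:[:c:]:] dvd Q" unfolding const_poly_dvd_iff by blast
  then obtain Q' where Q': "Q = [:[:c:]:] * Q'" by (elim dvdE)
  have "const3 c * b = const3 c * subst emb p Q'"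
    unfolding dvd unfolding Q' rhom_simps(4)[OF rhom_subst[OF emb]] subst_const[OF emb] const3_emb ..
  moreover have "const3 c \<noteq> 0" using pr by (auto simp: prime_elem_def)
  ultimately show ?thesis by auto
qed

lemma adjoin_two_subst: "adjoin scalars {varX, p} = range (subst emb p)"
proof
  note emb = rhom_emb
  have "subring_closed (range (subst emb p))" by (rule subring_range[OF rhom_subst[OF emb]])
  moreover have "const3 c \<in> range (subst emb p)" for c
    unfolding const3_emb using rangeI[of "subst emb p" "[:[:c:]:]"] unfolding subst_const[OF emb] .
  moreover have "varX = subst emb p [:[:0, 1:]:]" by (simp add: subst_const[OF emb] varX_def)
  moreover have "p = subst emb p [:0, 1:]"
    by (simp add: subst_pCons[OF emb] subst_0 rhom_simps[OF emb])
  ultimately show "adjoin scalars {varX, p} \<subseteq> range (subst emb p)"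
    by (intro adjoin_least) (auto simp: scalars_def)
  have sub: "subring_closed (adjoin scalars {varX, p})" by (rule subring_adjoin)
  have X: "emb q \<in> adjoin scalars {varX, p}" for q
  proof -
    have "adjoin scalars {varX} \<subseteq> adjoin scalars {varX, p}"
      by (rule adjoin_least[OF sub]) (auto intro: adjoin_incl)
    then show ?thesis using adjoin_emb by blast
  qed
  have "subst emb p Q \<in> adjoin scalars {varX, p}" for Q
  proof (induction Q)
    case 0
    show ?case using subring_closed_0[OF sub] by (simp add: subst_0)
  next
    case (pCons a Q)
    have "p \<in> adjoin scalars {varX, p}" by (rule adjoin_incl) simp
    then show ?case using pCons sub X[of a] unfolding subst_pCons[OF emb] subring_closed_def by blast
  qed
  then show "range (subst emb p) \<subseteq> adjoin scalars {varX, p}" by blast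
qed

text \<open>With \<open>s f + t g = k\<close> the element \<open>q = sY + tZ\<close> satisfies \<open>D q = k\<close>. A kernel element is constant
  along the flow, in particular up to time \<open>- q / k\<close>, which moves \<open>Y\<close> and \<open>Z\<close> to \<open>t p / k\<close> and
  \<open>- s p / k\<close>. So every kernel element lies in \<open>R[X,p]\<close> up to a power of \<open>k\<close>, and that power can be
  removed prime by prime.\<close>
theorem kernel_normal_form:
  fixes D :: "'r::idom poly3 \<Rightarrow> 'r poly3"
  assumes pid: "principal_ideals TYPE('r)" and der: "derivation scalars D"
    and char0: "\<And>n. of_nat (Suc n) \<noteq> (0 :: 'r)" and irr: "\<not> reducible_der D"
    and X: "D varX = 0" and Y: "D varY = emb f" and Z: "D varZ = emb g"
    and st: "s * f + t * g = [:k:]" and k: "k \<noteq> 0"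
  shows "Ker D = adjoin scalars {varX, emb g * varY - emb f * varZ}"
proof
  note d = derivation_simps[OF der]
  define p where "p = emb g * varY - emb f * varZ"
  note emb = rhom_emb
  have De: "D (emb q) = 0" for q
  proof -
    have "adjoin scalars {varX} \<subseteq> Ker D"
      by (rule adjoin_least[OF subring_Ker[OF der]]) (auto simp: Ker_def scalars_def d X)
    then show ?thesis unfolding adjoin_emb by (auto simp: Ker_def)
  qed
  have sq: "D (D varX) = 0" "D (D varY) = 0" "D (D varZ) = 0" unfolding X Y Z De by (simp_all add: d)
  have "D p = 0" unfolding p_def d De Y Z by (simp only: mult.commute) simp
  then show "adjoin scalars {varX, emb g * varY - emb f * varZ} \<subseteq> Ker D"
    by (intro adjoin_least[OF subring_Ker[OF der]]) (auto simp: Ker_def scalars_def d X p_def)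
  define S where "S = adjoin scalars {varX, p}"
  have S: "subring_closed S" unfolding S_def by (rule subring_adjoin)
  then have Sm: "\<And>a b. a \<in> S \<Longrightarrow> b \<in> S \<Longrightarrow> a * b \<in> S" and Sa: "\<And>a b. a \<in> S \<Longrightarrow> b \<in> S \<Longrightarrow> a + b \<in> S"
    by (auto simp: subring_closed_def)
  have Sc: "const3 c \<in> S" "varX \<in> S" "p \<in> S" for c unfolding S_def by (auto intro: adjoin_incl simp: scalars_def)
  have Se: "emb q \<in> S" for q
  proof -
    have "adjoin scalars {varX} \<subseteq> S"
      by (rule adjoin_least[OF S]) (auto simp: scalars_def Sc)
    then show ?thesis unfolding adjoin_emb by blast
  qed
  have remove: "b \<in> S" if "c \<noteq> 0" "const3 c * b \<in> S" for b c
  proof -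
    have "\<forall>b. const3 c * b \<in> S \<longrightarrow> b \<in> S"
      using pid \<open>c \<noteq> 0\<close>
    proof (rule prime_factor_induct)
      fix u :: 'r assume "u dvd 1"
      then obtain w where w: "1 = u * w" by (elim dvdE)
      then have "const3 w * const3 u = 1"
        by (simp add: rhom_simps[OF rhom_const3] mult.commute flip: rhom_simps(4)[OF rhom_const3])
      then have "b = const3 w * (const3 u * b)" for b by (simp flip: mult.assoc)
      then show "\<forall>b. const3 u * b \<in> S \<longrightarrow> b \<in> S" using Sm Sc by metis
    next
      fix c x :: 'r assume c: "prime_elem c" and IH: "\<forall>b. const3 x * b \<in> S \<longrightarrow> b \<in> S"
      have cop: "\<not> ([:c:] dvd f \<and> [:c:] dvd g)"
        using no_common_prime[OF der irr X c] unfolding Y Z const3_dvd_iff .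
      have step: "b \<in> S" if "const3 c * b \<in> S" for b
        using prime_dvd_univariate[OF c cop, of b] that unfolding S_def p_def adjoin_two_subst by auto
      have "const3 (c * x) * b = const3 c * (const3 x * b)" for b
        by (simp only: rhom_simps(4)[OF rhom_const3] mult.assoc)
      then show "\<forall>b. const3 (c * x) * b \<in> S \<longrightarrow> b \<in> S" using IH step by metis
    qed
    then show ?thesis using that by blast
  qed
  define h where "h = (\<lambda>c :: 'r. to_fract (const3 c))"
  have h: "rhom h" unfolding h_def by (rule rhom_comp[OF rhom_to_fract rhom_const3])
  have hc: "h c = to_fract (const3 c)" for c by (simp add: h_def)
  define K where "K = const3 k"
  have K: "to_fract K \<noteq> 0" using k by (simp add: K_def)
  have Kst: "emb s * emb f + emb t * emb g = K"
    unfolding K_def const3_emb st[symmetric] rhom_simps[OF emb] ..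
  define q where "q = emb s * varY + emb t * varZ"
  have base: "eval3 h (to_fract varX) (to_fract varY) (to_fract varZ) b = to_fract b" for b
    by (rule rhom_eqI[OF rhom_eval3[OF h] rhom_to_fract]) (simp_all add: eval3_gens[OF h] hc)
  define y z where "y = to_fract (emb t * p) / to_fract K" and "z = to_fract (- emb s * p) / to_fract K"
  have moved: "to_fract b = eval3 h (to_fract varX) y z b" if "D b = 0" for b
  proof -
    let ?T = "- to_fract q / to_fract K"
    have alg1: "(a * c + b * d) * y - (a * y + b * z) * c = b * (d * y - c * z)"
      and alg2: "(a * c + b * d) * z - (a * y + b * z) * d = - a * (d * y - c * z)" for a b c d y z :: "'r poly3"
      by (simp_all add: algebra_simps)
    have "K * varY - q * emb f = emb t * p" "K * varZ - q * emb g = - emb s * p"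
      unfolding Kst[symmetric] q_def p_def by (rule alg1, rule alg2)
    then have "y = to_fract (K * varY - q * emb f) / to_fract K" "z = to_fract (K * varZ - q * emb g) / to_fract K"
      by (simp_all add: y_def z_def)
    then have "y = to_fract varY + ?T * to_fract (emb f)" "z = to_fract varZ + ?T * to_fract (emb g)"
      using K by (simp_all add: field_simps del: mult_pCons_left mult_pCons_right)
    moreover have "to_fract varX = to_fract varX + ?T * to_fract 0" by simp
    ultimately show ?thesis
      using kernel_translation[OF der char0 sq that h, of "to_fract varX" ?T "to_fract varY" "to_fract varZ"]
      unfolding base X Y Z by simp
  qed
  let ?E = "eval3 h (to_fract varX) y z"
  have bounded: "\<exists>n. \<exists>a\<in>S. to_fract K ^ n * ?E b = to_fract a" for b
  proof (induction b rule: poly3_induct)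
    case (1 c)
    show ?case unfolding eval3_gens(1)[OF h] unfolding hc
      by (rule exI[of _ 0], rule bexI[of _ "const3 c"]) (simp_all add: Sc)
  next
    case 2
    show ?case by (rule exI[of _ 0], rule bexI[of _ varX]) (simp_all add: eval3_gens[OF h] Sc)
  next
    case 3
    show ?case
      by (rule exI[of _ 1], rule bexI[of _ "emb t * p"])
        (use K Sm Se Sc in \<open>auto simp: eval3_gens[OF h] y_def simp del: mult_pCons_left\<close>)
  next
    case 4
    have "- emb s \<in> S" using Se S by (simp add: subring_closed_def)
    then show ?case
      by - (rule exI[of _ 1], rule bexI[of _ "- emb s * p"],
        use K Sm Sc in \<open>auto simp: eval3_gens[OF h] z_def simp del: mult_pCons_left\<close>)
  next
    case (5 a b)
    then obtain m n a' b' where *: "a' \<in> S" "b' \<in> S" "to_fract K ^ m * ?E a = to_fract a'"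
      "to_fract K ^ n * ?E b = to_fract b'" by blast
    have "K ^ i \<in> S" for i using subring_closed_power[OF S] Sc by (simp add: K_def)
    then have "K ^ n * a' + K ^ m * b' \<in> S" using * Sm Sa by blast
    moreover have "to_fract (c ^ i) = to_fract c ^ i" for c :: "'r poly3" and i
      by (rule rhom_simps(7)[OF rhom_to_fract])
    then have "to_fract K ^ (m + n) * ?E (a + b) = to_fract (K ^ n * a' + K ^ m * b')"
      unfolding rhom_simps[OF rhom_eval3[OF h]]
      by (simp add: power_add algebra_simps flip: *(3,4))
    ultimately show ?case by blast
  next
    case (6 a b)
    then obtain m n a' b' where *: "a' \<in> S" "b' \<in> S" "to_fract K ^ m * ?E a = to_fract a'"
      "to_fract K ^ n * ?E b = to_fract b'" by blast
    have "to_fract K ^ (m + n) * ?E (a * b) = to_fract (a' * b')"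
      unfolding rhom_simps[OF rhom_eval3[OF h]]
      by (simp add: power_add algebra_simps flip: *(3,4))
    then show ?case using * Sm by blast
  qed
  show "Ker D \<subseteq> adjoin scalars {varX, emb g * varY - emb f * varZ}"
  proof
    fix b assume "b \<in> Ker D"
    then have "D b = 0" by (simp add: Ker_def)
    then obtain n a where a: "a \<in> S" "to_fract K ^ n * to_fract b = to_fract a"
      using bounded[of b] moved[of b] by auto
    have "to_fract (K ^ n * b) = to_fract a"
      unfolding to_fract_mult rhom_simps(7)[OF rhom_to_fract] by (rule a(2))
    then have "K ^ n * b = a" by (simp only: to_fract_eq_iff)
    moreover have "K ^ n = const3 (k ^ n)" unfolding K_def by (rule rhom_simps(7)[OF rhom_const3, symmetric])
    ultimately have "const3 (k ^ n) * b \<in> S" using a(1) by simp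
    then have "b \<in> S" by (rule remove[rotated]) (simp add: k)
    then show "b \<in> adjoin scalars {varX, emb g * varY - emb f * varZ}" by (simp add: S_def p_def)
  qed
qed

section \<open>Recognizing polynomial algebras\<close>

definition monomial_at :: "(nat \<Rightarrow> 'b::comm_ring_1) \<Rightarrow> (nat \<Rightarrow>\<^sub>0 nat) \<Rightarrow> 'b" where
  "monomial_at T m = (\<Prod>i\<in>Poly_Mapping.keys m. T i ^ Poly_Mapping.lookup m i)"

definition mpoly_at :: "(nat \<Rightarrow> 'b::comm_ring_1) \<Rightarrow> ((nat \<Rightarrow>\<^sub>0 nat) \<Rightarrow>\<^sub>0 'b) \<Rightarrow> 'b" where
  "mpoly_at T P = (\<Sum>m\<in>Poly_Mapping.keys P. Poly_Mapping.lookup P m * monomial_at T m)"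

lemma monomial_at_superset:
  assumes "finite I" "Poly_Mapping.keys m \<subseteq> I"
  shows "monomial_at T m = (\<Prod>i\<in>I. T i ^ Poly_Mapping.lookup m i)"
  unfolding monomial_at_def
  by (rule prod.mono_neutral_left) (use assms in \<open>auto simp: in_keys_iff\<close>)

lemma monomial_at_add: "monomial_at T (m + m') = monomial_at T m * monomial_at T m'"
proof -
  let ?I = "Poly_Mapping.keys m \<union> Poly_Mapping.keys m'"
  have "monomial_at T (m + m') = (\<Prod>i\<in>?I. T i ^ Poly_Mapping.lookup (m + m') i)"
    by (rule monomial_at_superset) (auto dest: subsetD[OF keys_add])
  also have "\<dots> = (\<Prod>i\<in>?I. T i ^ Poly_Mapping.lookup m i) * (\<Prod>i\<in>?I. T i ^ Poly_Mapping.lookup m' i)"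
    by (simp add: lookup_add power_add prod.distrib)
  also have "\<dots> = monomial_at T m * monomial_at T m'"
    by (simp add: monomial_at_superset[of ?I])
  finally show ?thesis .
qed

lemma mpoly_at_single: "mpoly_at T (Poly_Mapping.single m a) = a * monomial_at T m"
  by (simp add: mpoly_at_def)

lemma mpoly_at_0: "mpoly_at T 0 = 0"
  by (simp add: mpoly_at_def)

lemma mpoly_at_add: "mpoly_at T (P + Q) = mpoly_at T P + mpoly_at T Q"
  unfolding mpoly_at_def
  by (rule setsum_keys_plus_distrib) (simp_all add: distrib_right)

lemma poly_mapping_sum_single: "(\<Sum>m\<in>Poly_Mapping.keys P. Poly_Mapping.single m (Poly_Mapping.lookup P m)) = P"
proof (rule poly_mapping_eqI)
  fix k
  have "(\<Sum>m\<in>Poly_Mapping.keys P. Poly_Mapping.lookup (Poly_Mapping.single m (Poly_Mapping.lookup P m)) k)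
      = (\<Sum>m\<in>Poly_Mapping.keys P. if m = k then Poly_Mapping.lookup P m else 0)"
    by (rule sum.cong) (auto simp: lookup_single when_def)
  also have "\<dots> = Poly_Mapping.lookup P k"
    by (auto simp: in_keys_iff)
  finally show "Poly_Mapping.lookup (\<Sum>m\<in>Poly_Mapping.keys P. Poly_Mapping.single m (Poly_Mapping.lookup P m)) k
      = Poly_Mapping.lookup P k"
    by (simp add: lookup_sum)
qed

lemma mpolys_induct [consumes 1, case_names zero single add]:
  assumes P: "P \<in> mpolys n S" and zero: "Q 0"
    and single: "\<And>m a. a \<in> S \<Longrightarrow> Poly_Mapping.keys m \<subseteq> {..<n} \<Longrightarrow> Q (Poly_Mapping.single m a)"
    and add: "\<And>f g. Q f \<Longrightarrow> Q g \<Longrightarrow> Q (f + g)"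
  shows "Q P"
proof -
  have "Q (\<Sum>m\<in>I. Poly_Mapping.single m (Poly_Mapping.lookup P m))" if "finite I" "I \<subseteq> Poly_Mapping.keys P" for I
    using that
  proof (induction I rule: finite_induct)
    case (insert m I)
    have "Q (Poly_Mapping.single m (Poly_Mapping.lookup P m))"
      by (rule single) (use P insert in \<open>auto simp: mpolys_def\<close>)
    then show ?case using insert add by simp
  qed (use zero in simp)
  from this[of "Poly_Mapping.keys P"] show ?thesis by (simp add: poly_mapping_sum_single)
qed

text \<open>Every multivariate polynomial involves finitely many variables, so the induction principle above
  applies to it.\<close>
lemma mpolys_UNIV: "P \<in> mpolys (Suc (Max (insert 0 (\<Union>m\<in>Poly_Mapping.keys P. Poly_Mapping.keys m)))) UNIV"
  unfolding mpolys_def by (auto simp: less_Suc_eq_le intro!: Max_ge)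

lemma mpoly_at_mult: "mpoly_at T (P * Q) = mpoly_at T P * mpoly_at T Q"
proof -
  have single: "mpoly_at T (Poly_Mapping.single m a * Q) = a * monomial_at T m * mpoly_at T Q" for m a
    using mpolys_UNIV[of Q]
  proof (induction rule: mpolys_induct)
    case (single m' b)
    show ?case by (simp add: mult_single mpoly_at_single monomial_at_add mult_ac)
  qed (simp_all add: mpoly_at_0 distrib_left mpoly_at_add)
  show ?thesis
    using mpolys_UNIV[of P]
    by (induction rule: mpolys_induct)
      (simp_all add: mpoly_at_0 single mpoly_at_single distrib_right mpoly_at_add)
qed

lemma mpoly_at_uminus: "mpoly_at T (- P) = - mpoly_at T P"
  using mpoly_at_add[of T P "- P"] mpoly_at_0[of T] by (simp add: eq_neg_iff_add_eq_0 add.commute)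

lemma mpolys_single: "a \<in> S \<Longrightarrow> 0 \<in> S \<Longrightarrow> Poly_Mapping.keys m \<subseteq> {..<n} \<Longrightarrow> Poly_Mapping.single m a \<in> mpolys n S"
  by (auto simp: mpolys_def lookup_single when_def split: if_splits)

lemma mpolys_closed:
  assumes S: "subring_closed S" and "P \<in> mpolys n S" "Q \<in> mpolys n S"
  shows "P + Q \<in> mpolys n S" "- P \<in> mpolys n S" "P * Q \<in> mpolys n S"
proof -
  have add: "f + g \<in> mpolys n S" if "f \<in> mpolys n S" "g \<in> mpolys n S" for f g
    using that S unfolding mpolys_def subring_closed_def
    by (auto simp: lookup_add dest!: subsetD[OF keys_add])
  note S0 = subring_closed_0[OF S]
  have zero: "0 \<in> mpolys n S" using S0 by (simp add: mpolys_def)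
  have single: "Poly_Mapping.single m a * Q \<in> mpolys n S" if m: "a \<in> S" "Poly_Mapping.keys m \<subseteq> {..<n}" for m a
    using assms(3)
  proof (induction rule: mpolys_induct)
    case (single m' b)
    then show ?case
      using m S S0 keys_add[of m m'] unfolding mult_single
      by (intro mpolys_single) (auto simp: subring_closed_def)
  qed (auto simp: distrib_left add zero)
  show "P + Q \<in> mpolys n S" using add assms by blast
  show "- P \<in> mpolys n S" using assms unfolding mpolys_def subring_closed_def by auto
  show "P * Q \<in> mpolys n S" using assms(2)
    by (induction rule: mpolys_induct) (auto simp: single distrib_right add zero)
qed

text \<open>Evaluation at generators that satisfy no polynomial relation is the required isomorphism.\<close>
lemma is_poly_algebraI:
  fixes T :: "nat \<Rightarrow> 'b::comm_ring_1"
  assumes S: "subring_closed S" and C: "C = adjoin S (T ` {..<n})"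
    and indep: "\<And>P. P \<in> mpolys n S \<Longrightarrow> mpoly_at T P = 0 \<Longrightarrow> P = 0"
  shows "is_poly_algebra n S C"
proof -
  note S0 = subring_closed_0[OF S]
  have const: "mpoly_at T (Poly_Mapping.single 0 s) = s" for s
    by (simp add: mpoly_at_single monomial_at_def)
  have one: "1 \<in> mpolys n S" using mpolys_single[of 1 S 0 n] S S0 by (simp add: subring_closed_def)
  have C': "subring_closed C" unfolding C by (rule subring_adjoin)
  have gen: "S \<subseteq> C" "T ` {..<n} \<subseteq> C" unfolding C by (auto intro: adjoin_incl)
  have into: "mpoly_at T P \<in> C" if "P \<in> mpolys n S" for P
    using that
  proof (induction rule: mpolys_induct)
    case zero
    show ?case using subring_closed_0[OF C'] by (simp add: mpoly_at_0)
  next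
    case (single m a)
    have "(\<Prod>i\<in>I. T i ^ Poly_Mapping.lookup m i) \<in> C" if "finite I" "I \<subseteq> {..<n}" for I
      using that
    proof (induction I rule: finite_induct)
      case (insert i I)
      then have "T i ^ Poly_Mapping.lookup m i \<in> C" using gen(2) by (intro subring_closed_power[OF C']) auto
      then show ?case using insert C' by (simp add: subring_closed_def)
    qed (use C' in \<open>simp add: subring_closed_def\<close>)
    then have "monomial_at T m \<in> C" unfolding monomial_at_def using single by simp
    then show ?case using single gen C' by (auto simp: mpoly_at_single subring_closed_def)
  next
    case (add f g)
    then show ?case using C' by (simp add: mpoly_at_add subring_closed_def)
  qed
  have "subring_closed (mpoly_at T ` mpolys n S)"
  proof -
    have "1 = mpoly_at T 1" using const[of 1] by simp
    then show ?thesis unfolding subring_closed_def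
      using one mpolys_closed[OF S]
      by (auto simp flip: mpoly_at_add mpoly_at_mult mpoly_at_uminus)
  qed
  moreover have "S \<subseteq> mpoly_at T ` mpolys n S"
  proof
    fix s assume "s \<in> S"
    then have "Poly_Mapping.single 0 s \<in> mpolys n S" using S0 by (intro mpolys_single) auto
    then show "s \<in> mpoly_at T ` mpolys n S" using const by (metis imageI)
  qed
  moreover have "T ` {..<n} \<subseteq> mpoly_at T ` mpolys n S"
  proof clarify
    fix i assume i: "i < n"
    have "Poly_Mapping.single (Poly_Mapping.single i 1) 1 \<in> mpolys n S"
      using i S S0 by (intro mpolys_single) (auto simp: subring_closed_def)
    moreover have "mpoly_at T (Poly_Mapping.single (Poly_Mapping.single i 1) 1) = T i"
      by (simp add: mpoly_at_single monomial_at_def)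
    ultimately show "T i \<in> mpoly_at T ` mpolys n S" by (metis imageI)
  qed
  ultimately have onto: "C \<subseteq> mpoly_at T ` mpolys n S" unfolding C by (rule adjoin_least)
  have inj: "inj_on (mpoly_at T) (mpolys n S)"
  proof (rule inj_onI)
    fix P Q assume PQ: "P \<in> mpolys n S" "Q \<in> mpolys n S" "mpoly_at T P = mpoly_at T Q"
    have "P + - Q \<in> mpolys n S" using PQ mpolys_closed[OF S] by blast
    moreover have "mpoly_at T (P + - Q) = 0" using PQ(3) by (simp only: mpoly_at_add mpoly_at_uminus) simp
    ultimately have "P + - Q = 0" by (rule indep)
    then show "P = Q" by (simp add: eq_neg_iff_add_eq_0[symmetric])
  qed
  have "mpoly_at T \<in> ring_iso (ring_on (mpolys n S)) (ring_on C)"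
    unfolding ring_iso_def ring_hom_def bij_betw_def
    using inj into onto const[of 1] by (auto simp: mpoly_at_add mpoly_at_mult)
  then show ?thesis unfolding is_poly_algebra_def using const by blast
qed

text \<open>After the specialization \<open>\<eta>\<close> the monomials in \<open>u\<close> and \<open>p\<close> are nonzero multiples of distinct monomials.\<close>
lemma independent_two:
  fixes \<eta> :: "'r::idom poly3 \<Rightarrow> 'r poly poly"
  assumes eta: "rhom \<eta>" "\<And>c. \<eta> (const3 c) = [:[:c:]:]" "\<eta> u = [:[:0, 1:]:]" "\<eta> p = [:0, e:]" and e: "e \<noteq> 0"
    and P: "P \<in> mpolys 2 scalars" and zero: "mpoly_at (\<lambda>i. if i = 0 then u else p) P = 0"
  shows "P = 0"
proof (rule ccontr)
  let ?l = Poly_Mapping.lookup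
  let ?K = "Poly_Mapping.keys P"
  assume "P \<noteq> 0"
  then obtain m0 where m0: "m0 \<in> ?K" by (metis all_not_in_conv keys_eq_empty)
  define i j where "i = ?l m0 0" and "j = ?l m0 1"
  have "\<exists>r. ?l P m = const3 r" for m using P by (auto simp: mpolys_def scalars_def)
  then obtain r where r: "\<And>m. ?l P m = const3 (r m)" by metis
  have mon: "monomial_at (\<lambda>i. if i = 0 then u else p) m = u ^ ?l m 0 * p ^ ?l m 1" if "m \<in> ?K" for m
  proof -
    have "Poly_Mapping.keys m \<subseteq> {..<2}" using P that by (auto simp: mpolys_def)
    then show ?thesis by (simp add: monomial_at_superset[of "{..<2}"] numeral_2_eq_2 lessThan_Suc)
  qed
  have X: "[:[:0, 1:]:] ^ n = [:monom 1 n:]" for n :: nat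
    by (induction n) (simp_all add: monom_0 monom_Suc one_pCons)
  have E: "[:0, e:] ^ n = monom (e ^ n) n" for n
    by (induction n) (simp_all add: monom_0 monom_Suc smult_monom one_pCons)
  have image: "\<eta> (?l P m * monomial_at (\<lambda>i. if i = 0 then u else p) m)
      = monom (monom (r m) (?l m 0) * e ^ ?l m 1) (?l m 1)" if "m \<in> ?K" for m
    unfolding mon[OF that] rhom_simps[OF eta(1)] r eta X E
    by (simp add: smult_monom flip: mult_smult_left)
  have "0 = \<eta> (mpoly_at (\<lambda>i. if i = 0 then u else p) P)" by (simp add: zero rhom_simps[OF eta(1)])
  also have "\<dots> = (\<Sum>m\<in>?K. monom (monom (r m) (?l m 0) * e ^ ?l m 1) (?l m 1))"
    unfolding mpoly_at_def rhom_sum[OF eta(1)] by (rule sum.cong[OF refl image])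
  finally have "(\<Sum>m\<in>?K. monom (monom (r m) (?l m 0) * e ^ ?l m 1) (?l m 1)) = 0" by simp
  then have "coeff (\<Sum>m\<in>?K. monom (monom (r m) (?l m 0) * e ^ ?l m 1) (?l m 1)) j = 0" by simp
  then have "(\<Sum>m\<in>?K. if ?l m 1 = j then monom (r m) (?l m 0) * e ^ j else 0) = 0"
    unfolding coeff_sum by (simp cong: if_cong)
  moreover have "(\<Sum>m\<in>?K. if ?l m 1 = j then monom (r m) (?l m 0) * e ^ j else 0)
      = (\<Sum>m\<in>?K. if ?l m 1 = j then monom (r m) (?l m 0) else 0) * e ^ j"
    unfolding sum_distrib_right by (rule sum.cong) auto
  ultimately have "(\<Sum>m\<in>?K. if ?l m 1 = j then monom (r m) (?l m 0) else 0) = 0" using e by simp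
  then have "coeff (\<Sum>m\<in>?K. if ?l m 1 = j then monom (r m) (?l m 0) else 0) i = 0" by simp
  then have "(\<Sum>m\<in>?K. if ?l m 1 = j \<and> ?l m 0 = i then r m else 0) = 0"
    unfolding coeff_sum by (simp add: if_distrib[of "\<lambda>q. coeff q i"] if_if_eq_conj[symmetric] cong: if_cong)
  moreover have "(\<Sum>m\<in>?K. if ?l m 1 = j \<and> ?l m 0 = i then r m else 0) = (\<Sum>m\<in>?K. if m = m0 then r m else 0)"
  proof (rule sum.cong[OF refl])
    fix m assume m: "m \<in> ?K"
    have keys: "Poly_Mapping.keys m \<subseteq> {..<2}" "Poly_Mapping.keys m0 \<subseteq> {..<2}" using P m m0 by (auto simp: mpolys_def)
    have "m = m0" if "?l m 1 = j" "?l m 0 = i"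
    proof (rule poly_mapping_eqI)
      fix a
      consider "a = 0" | "a = 1" | "a \<notin> {..<2 :: nat}" by fastforce
      then show "?l m a = ?l m0 a"
      proof cases
        case 3
        then have "a \<notin> Poly_Mapping.keys m" "a \<notin> Poly_Mapping.keys m0" using keys by auto
        then show ?thesis by (simp add: in_keys_iff)
      qed (use that in \<open>auto simp: i_def j_def\<close>)
    qed
    then show "(if ?l m 1 = j \<and> ?l m 0 = i then r m else 0) = (if m = m0 then r m else 0)"
      by (auto simp: i_def j_def)
  qed
  ultimately have "r m0 = 0" using m0 by simp
  then have "?l P m0 = 0" by (simp add: r rhom_simps[OF rhom_const3])
  then show False using m0 by (simp add: in_keys_iff)
qed

lemma derivation_power:
  assumes der: "derivation scalars D" and q: "D q = 1" shows "D (q ^ Suc i) = of_nat (Suc i) * q ^ i"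
proof (induction i)
  case (Suc i)
  have "D (q ^ Suc (Suc i)) = q * D (q ^ Suc i) + D q * q ^ Suc i"
    using derivation_simps(2)[OF der, of q "q ^ Suc i"] by simp
  then show ?case unfolding Suc q by (simp add: algebra_simps)
qed (simp add: q)

text \<open>A slice is transcendental over the kernel: applying \<open>D\<close> to a relation lowers its degree.\<close>
lemma slice_transcendental:
  fixes D :: "'r::idom poly3 \<Rightarrow> 'r poly3"
  assumes der: "derivation scalars D" and char0: "\<And>n. of_nat (Suc n) \<noteq> (0 :: 'r poly3)" and q: "D q = 1"
    and a: "\<And>i. D (a i) = 0" and "(\<Sum>i\<le>n. a i * q ^ i) = 0" and "i \<le> n"
  shows "a i = 0"
  using a assms(5,6)
proof (induction n arbitrary: a i)
  case (Suc n)
  note d = derivation_simps[OF der]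
  have sum: "D (sum f I) = (\<Sum>i\<in>I. D (f i))" for f and I :: "nat set"
    by (induction I rule: infinite_finite_induct) (auto simp: d)
  have Dn: "D (of_nat m) = 0" for m by (induction m) (simp_all add: d)
  have "0 = D (\<Sum>i\<le>Suc n. a i * q ^ i)" unfolding Suc.prems(2) by (simp add: d)
  also have "\<dots> = (\<Sum>i\<le>n. D (a (Suc i) * q ^ Suc i))"
    unfolding sum.atMost_Suc_shift d(1) sum by (simp add: Suc.prems(1))
  also have "\<dots> = (\<Sum>i\<le>n. (of_nat (Suc i) * a (Suc i)) * q ^ i)"
    by (rule sum.cong[OF refl], unfold d(2) derivation_power[OF der q] Suc.prems(1)) (simp add: mult_ac)
  finally have "(\<Sum>i\<le>n. (of_nat (Suc i) * a (Suc i)) * q ^ i) = 0" by simp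
  moreover have "D (of_nat (Suc i) * a (Suc i)) = 0" for i unfolding d(2) Dn Suc.prems(1) by simp
  ultimately have prod: "of_nat (Suc i) * a (Suc i) = 0" if "i \<le> n" for i
    using Suc.IH[of "\<lambda>i. of_nat (Suc i) * a (Suc i)" i] that by blast
  have high: "a (Suc i) = 0" if "i \<le> n" for i using prod[OF that] char0[of i] mult_eq_0_iff by blast
  then have "a 0 = 0" using Suc.prems(2) unfolding sum.atMost_Suc_shift by simp
  then show ?case using high Suc.prems(3) by (cases i) auto
qed simp

lemma independent_slice:
  fixes D :: "'r::idom poly3 \<Rightarrow> 'r poly3"
  assumes der: "derivation scalars D" and char0: "\<And>n. of_nat (Suc n) \<noteq> (0 :: 'r poly3)" and q: "D q = 1"
    and P: "P \<in> mpolys 1 (Ker D)" and zero: "mpoly_at (\<lambda>_. q) P = 0"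
  shows "P = 0"
proof (rule ccontr)
  let ?l = Poly_Mapping.lookup
  let ?K = "Poly_Mapping.keys P"
  assume "P \<noteq> 0"
  then obtain m0 where m0: "m0 \<in> ?K" by (metis all_not_in_conv keys_eq_empty)
  have m: "m = Poly_Mapping.single 0 (?l m 0)" if "m \<in> ?K" for m
  proof (rule poly_mapping_eqI)
    fix a
    have "Poly_Mapping.keys m \<subseteq> {..<1}" using P that by (auto simp: mpolys_def)
    then show "?l m a = ?l (Poly_Mapping.single 0 (?l m 0)) a"
      by (cases "a = 0") (auto simp: lookup_single when_def in_keys_iff subset_iff)
  qed
  define a where "a i = ?l P (Poly_Mapping.single 0 i)" for i
  define N where "N = Max ((\<lambda>m. ?l m 0) ` ?K)"
  have N: "?l m 0 \<le> N" if "m \<in> ?K" for m unfolding N_def using that by (intro Max_ge) auto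
  have "mpoly_at (\<lambda>_. q) P = (\<Sum>m\<in>?K. a (?l m 0) * q ^ ?l m 0)"
    unfolding mpoly_at_def
  proof (rule sum.cong[OF refl])
    fix m assume mk: "m \<in> ?K"
    then have "Poly_Mapping.keys m \<subseteq> {..<1}" using P by (auto simp: mpolys_def)
    then have "monomial_at (\<lambda>_. q) m = q ^ ?l m 0" by (simp add: monomial_at_superset[of "{..<1}"])
    then show "?l P m * monomial_at (\<lambda>_. q) m = a (?l m 0) * q ^ ?l m 0"
      using m[OF mk] by (simp add: a_def)
  qed
  also have "\<dots> = (\<Sum>i\<in>(\<lambda>m. ?l m 0) ` ?K. a i * q ^ i)"
  proof -
    have "inj_on (\<lambda>m. ?l m 0) ?K" by (rule inj_onI) (metis m)
    then show ?thesis by (simp add: sum.reindex)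
  qed
  also have "\<dots> = (\<Sum>i\<le>N. a i * q ^ i)"
  proof (rule sum.mono_neutral_left)
    show "\<forall>i\<in>{..N} - (\<lambda>m. ?l m 0) ` ?K. a i * q ^ i = 0"
    proof
      fix i assume i: "i \<in> {..N} - (\<lambda>m. ?l m 0) ` ?K"
      then have "Poly_Mapping.single 0 i \<notin> ?K" by (auto simp: image_iff)
      then show "a i * q ^ i = 0" by (simp add: a_def in_keys_iff)
    qed
  qed (use N in auto)
  finally have "(\<Sum>i\<le>N. a i * q ^ i) = 0" using zero by simp
  moreover have "D (a i) = 0" for i using P by (auto simp: a_def mpolys_def Ker_def)
  ultimately have "a (?l m0 0) = 0" using slice_transcendental[OF der char0 q] N[OF m0] by blast
  then show False using m0 m[OF m0] by (simp add: a_def in_keys_iff)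
qed

section \<open>A non-flat extension\<close>

lemma ambient_module_simps [simp]:
  "carrier ambient_module = UNIV" "ring.add ambient_module = (+)" "module.smult ambient_module = (*)"
  by (simp_all add: ambient_module_def)

text \<open>If \<open>p\<close> is a non-zero-divisor on \<open>A/(f,g)A\<close> but lies in the proper ideal \<open>(f,g)B\<close>, then tensoring
  the injective multiplication by \<open>p\<close> on \<open>A/(f,g)A\<close> with \<open>B\<close> yields the zero map on the nonzero module
  \<open>B/(f,g)B\<close>. The residue classes are represented by chosen elements, since the test
  modules consist of ring elements.\<close>
theorem not_flat_of_relation:
  fixes A :: "'b::comm_ring_1 set"
  defines "J \<equiv> \<lambda>f g. {f * x + g * y | x y. x \<in> A \<and> y \<in> A}"
  assumes A: "subring_closed A" and fgp: "f \<in> A" "g \<in> A" "p \<in> A" and rel: "p = g * V - f * W"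
    and proper: "\<not> comaximal f g" and regular: "\<And>a. a \<in> A \<Longrightarrow> p * a \<in> J f g \<Longrightarrow> a \<in> J f g"
  shows "\<not> flat (ring_on A) (ambient_module :: ('b, 'b) module)"
proof
  assume flat: "flat (ring_on A) (ambient_module :: ('b, 'b) module)"
  let ?J = "J f g"
  let ?B = "ambient_module :: ('b, 'b) module"
  have A_closed: "0 \<in> A" "1 \<in> A" "\<And>x. x \<in> A \<Longrightarrow> - x \<in> A" "\<And>x y. x \<in> A \<Longrightarrow> y \<in> A \<Longrightarrow> x + y \<in> A"
    "\<And>x y. x \<in> A \<Longrightarrow> y \<in> A \<Longrightarrow> x * y \<in> A"
    using A subring_closed_0[OF A] by (auto simp: subring_closed_def)
  have J_A: "x \<in> A" if "x \<in> ?J" for x using that fgp A_closed unfolding J_def by auto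
  have J_mult: "a * x \<in> ?J" if a: "a \<in> A" and x: "x \<in> ?J" for a x
  proof -
    obtain u v where "x = f * u + g * v" "u \<in> A" "v \<in> A" using x unfolding J_def by blast
    then have "a * x = f * (a * u) + g * (a * v)" "a * u \<in> A" "a * v \<in> A"
      using a A_closed by (auto simp: algebra_simps)
    then show ?thesis unfolding J_def by blast
  qed
  have J_add: "x + y \<in> ?J" if xy: "x \<in> ?J" "y \<in> ?J" for x y
  proof -
    obtain u v u' v' where "x = f * u + g * v" "u \<in> A" "v \<in> A" "y = f * u' + g * v'" "u' \<in> A" "v' \<in> A"
      using xy unfolding J_def by blast
    then have "x + y = f * (u + u') + g * (v + v')" "u + u' \<in> A" "v + v' \<in> A"
      using A_closed by (auto simp: algebra_simps)
    then show ?thesis unfolding J_def by blast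
  qed
  have J_minus: "- x \<in> ?J" if "x \<in> ?J" for x using J_mult[of "-1" x] that A_closed by simp
  have J_diff: "x - y \<in> ?J" if "x \<in> ?J" "y \<in> ?J" for x y using J_add[of x "- y"] J_minus that by simp
  have J_f: "f * x \<in> ?J" "g * x \<in> ?J" if "x \<in> A" for x
  proof -
    have "f * x = f * x + g * 0" "g * x = f * 0 + g * x" by simp_all
    then show "f * x \<in> ?J" "g * x \<in> ?J" unfolding J_def using that A_closed(1) by blast+
  qed
  have J0: "0 \<in> ?J" using J_f(1)[OF A_closed(1)] by simp
  define r where "r a = (SOME b. b \<in> A \<and> a - b \<in> ?J)" for a
  have r: "r a \<in> A" "a - r a \<in> ?J" if "a \<in> A" for a
  proof -
    have "r a \<in> A \<and> a - r a \<in> ?J"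
      unfolding r_def by (rule someI[of _ a]) (use that J0 in auto)
    then show "r a \<in> A" "a - r a \<in> ?J" by auto
  qed
  have r_eq: "r a = r b" if "a - b \<in> ?J" for a b
  proof -
    have "a - c \<in> ?J \<longleftrightarrow> b - c \<in> ?J" for c
      using J_add[of "b - c" "a - b"] J_diff[of "a - c" "a - b"] that by auto
    then show ?thesis unfolding r_def by simp
  qed
  have r_iff: "r a = r b \<longleftrightarrow> a - b \<in> ?J" if "a \<in> A" "b \<in> A" for a b
  proof
    assume "r a = r b"
    then have "a - b = (a - r a) - (b - r b)" by simp
    then show "a - b \<in> ?J" using J_diff r that by metis
  qed (rule r_eq)
  have rr: "r (r a) = r a" if "a \<in> A" for a
    using r[OF that] J_minus[of "a - r a"] by (intro r_eq) simp
  have r_add1: "r (r a + b) = r (a + b)" if "a \<in> A" "b \<in> A" for a b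
    using r[OF that(1)] J_minus[of "a - r a"] by (intro r_eq) simp
  have r_add2: "r (b + r a) = r (b + a)" if "a \<in> A" "b \<in> A" for a b
    using r_add1[OF that] by (simp add: add.commute)
  have r_mult: "r (b * r a) = r (b * a)" if "a \<in> A" "b \<in> A" for a b
    using J_mult[OF that(2) J_minus[OF r(2)[OF that(1)]]] by (intro r_eq) (simp add: algebra_simps)
  \<comment> \<open>\<open>A/(f,g)A\<close>, with each residue class replaced by its representative\<close>
  define N where "N = (\<lparr>carrier = r ` A, monoid.mult = (*), one = 1, ring.zero = r 0,
    ring.add = (\<lambda>x y. r (x + y)), module.smult = (\<lambda>a x. r (a * x))\<rparr> :: ('b, 'b) module)"
  have N_simps [simp]: "carrier N = r ` A" "ring.zero N = r 0" "x \<oplus>\<^bsub>N\<^esub> y = r (x + y)" "a \<odot>\<^bsub>N\<^esub> x = r (a * x)" for a x y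
    by (simp_all add: N_def)
  have N_A: "x \<in> A" "r x = x" if "x \<in> r ` A" for x using that r rr by auto
  have modN: "Module.module (ring_on A) N"
  proof (rule moduleI)
    show "cring (ring_on A)" by (rule cring_ring_on[OF A])
    show "abelian_group N"
    proof (rule abelian_groupI)
      show "\<exists>y\<in>carrier N. y \<oplus>\<^bsub>N\<^esub> x = \<zero>\<^bsub>N\<^esub>" if "x \<in> carrier N" for x
      proof (rule bexI[of _ "r (- x)"])
        have x: "x \<in> A" using that N_A(1) by simp
        show "r (- x) \<oplus>\<^bsub>N\<^esub> x = \<zero>\<^bsub>N\<^esub>" using x A_closed(3) by (simp add: r_add1)
        show "r (- x) \<in> carrier N" using x A_closed(3) by simp
      qed
      show "x \<oplus>\<^bsub>N\<^esub> y \<in> carrier N" if "x \<in> carrier N" "y \<in> carrier N" for x y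
        using that N_A(1)[of x] N_A(1)[of y] A_closed(4) by simp
      show "x \<oplus>\<^bsub>N\<^esub> y \<oplus>\<^bsub>N\<^esub> z = x \<oplus>\<^bsub>N\<^esub> (y \<oplus>\<^bsub>N\<^esub> z)"
        if "x \<in> carrier N" "y \<in> carrier N" "z \<in> carrier N" for x y z
        using that N_A(1)[of x] N_A(1)[of y] N_A(1)[of z] A_closed(4) by (simp add: r(1) r_add1 r_add2 add.assoc)
      show "x \<oplus>\<^bsub>N\<^esub> y = y \<oplus>\<^bsub>N\<^esub> x" for x y by (simp add: add.commute)
      show "\<zero>\<^bsub>N\<^esub> \<oplus>\<^bsub>N\<^esub> x = x" if "x \<in> carrier N" for x
        using that N_A[of x] A_closed(1) by (simp add: r_add1)
    qed (use A_closed in simp)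
    have axy: "x \<in> A" if "x \<in> carrier N" for x using N_A(1) that by simp
    show "\<one>\<^bsub>ring_on A\<^esub> \<odot>\<^bsub>N\<^esub> x = x" if "x \<in> carrier N" for x
      using N_A(2)[of x] that by simp
    show "a \<odot>\<^bsub>N\<^esub> x \<in> carrier N" if "a \<in> carrier (ring_on A)" "x \<in> carrier N" for a x
      using that axy[of x] A_closed by simp
    show "(a \<oplus>\<^bsub>ring_on A\<^esub> b) \<odot>\<^bsub>N\<^esub> x = a \<odot>\<^bsub>N\<^esub> x \<oplus>\<^bsub>N\<^esub> b \<odot>\<^bsub>N\<^esub> x"
      if "a \<in> carrier (ring_on A)" "b \<in> carrier (ring_on A)" "x \<in> carrier N" for a b x
      using that axy[of x] A_closed by (simp add: r(1) r_add1 r_add2 distrib_right)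
    show "a \<odot>\<^bsub>N\<^esub> (x \<oplus>\<^bsub>N\<^esub> y) = a \<odot>\<^bsub>N\<^esub> x \<oplus>\<^bsub>N\<^esub> a \<odot>\<^bsub>N\<^esub> y"
      if "a \<in> carrier (ring_on A)" "x \<in> carrier N" "y \<in> carrier N" for a x y
      using that axy[of x] axy[of y] A_closed by (simp add: r(1) r_add1 r_add2 r_mult distrib_left)
    show "(a \<otimes>\<^bsub>ring_on A\<^esub> b) \<odot>\<^bsub>N\<^esub> x = a \<odot>\<^bsub>N\<^esub> (b \<odot>\<^bsub>N\<^esub> x)"
      if "a \<in> carrier (ring_on A)" "b \<in> carrier (ring_on A)" "x \<in> carrier N" for a b x
      using that axy[of x] A_closed by (simp add: r(1) r_mult mult.assoc)
  qed
  define \<phi> where "\<phi> x = r (p * x)" for x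
  have phi_lin: "\<phi> \<in> linear_maps (ring_on A) N N"
    unfolding linear_maps_def \<phi>_def
  proof (intro CollectI conjI ballI funcsetI)
    have axy: "x \<in> A" if "x \<in> carrier N" for x using N_A(1) that by simp
    show "r (p * x) \<in> carrier N" if "x \<in> carrier N" for x using axy[OF that] fgp A_closed by simp
    show "r (p * (x \<oplus>\<^bsub>N\<^esub> y)) = r (p * x) \<oplus>\<^bsub>N\<^esub> r (p * y)" if "x \<in> carrier N" "y \<in> carrier N" for x y
      using axy[OF that(1)] axy[OF that(2)] fgp A_closed by (simp add: r(1) r_add1 r_add2 r_mult distrib_left)
    show "r (p * (a \<odot>\<^bsub>N\<^esub> x)) = a \<odot>\<^bsub>N\<^esub> r (p * x)" if "a \<in> carrier (ring_on A)" "x \<in> carrier N" for a x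
      using that axy[OF that(2)] fgp A_closed by (simp add: r(1) r_mult mult.left_commute)
  qed
  have phi_inj: "inj_on \<phi> (carrier N)"
  proof (rule inj_onI)
    fix x y assume "x \<in> carrier N" "y \<in> carrier N" "\<phi> x = \<phi> y"
    then have xy: "x \<in> A" "y \<in> A" "r x = x" "r y = y" "r (p * x) = r (p * y)" using N_A[of x] N_A[of y] by (auto simp: \<phi>_def)
    then have "p * (x - y) \<in> ?J" using r_iff[of "p * x" "p * y"] fgp A_closed by (simp add: right_diff_distrib)
    moreover have "x - y \<in> A" using xy A_closed(3,4) by (metis add_uminus_conv_diff)
    ultimately have "x - y \<in> ?J" using regular by blast
    then show "x = y" using r_iff[OF xy(1,2)] xy by simp
  qed
  define G where "G = free_Abelian_group (carrier N \<times> carrier ?B)"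
  have G_keys: "x \<in> carrier G \<longleftrightarrow> Poly_Mapping.keys x \<subseteq> r ` A \<times> UNIV" for x by (simp add: G_def)
  define H where "H = tensor_null (ring_on A) N ?B"
  have rels_sub: "tensor_rels (ring_on A) N ?B \<subseteq> carrier G"
  proof
    have k2: "Poly_Mapping.keys (frag_of a - frag_of b) \<subseteq> {a, b}" for a b :: "'b \<times> 'b"
      using keys_diff[of "frag_of a" "frag_of b"] by (auto simp: keys_frag_of)
    have k3: "Poly_Mapping.keys (frag_of a - frag_of b - frag_of c) \<subseteq> {a, b, c}" for a b c :: "'b \<times> 'b"
      using keys_diff[of "frag_of a - frag_of b" "frag_of c"] k2[of a b] by (auto simp: keys_frag_of)
    have rA: "r (x + x') \<in> r ` A" "r (a * x) \<in> r ` A" if "x \<in> r ` A" "x' \<in> r ` A" "a \<in> A" for a x x'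
      using N_A(1)[OF that(1)] N_A(1)[OF that(2)] that(3) A_closed(4,5) by blast+
    fix c assume "c \<in> tensor_rels (ring_on A) N ?B"
    then consider x x' y where "c = frag_of (r (x + x'), y) - frag_of (x, y) - frag_of (x', y)" "x \<in> r ` A" "x' \<in> r ` A"
      | x y y' where "c = frag_of (x, y + y') - frag_of (x, y) - frag_of (x, y')" "x \<in> r ` A"
      | a x y where "c = frag_of (r (a * x), y) - frag_of (x, a * y)" "a \<in> A" "x \<in> r ` A"
      unfolding tensor_rels_def by auto
    then show "c \<in> carrier G"
    proof cases
      case 1
      then show ?thesis
        using k3[of "(r (x + x'), y)" "(x, y)" "(x', y)"] rA(1)[OF 1(2,3) A_closed(1)] unfolding G_def by auto
    next
      case 2
      then show ?thesis using k3[of "(x, y + y')" "(x, y)" "(x, y')"] unfolding G_def by auto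
    next
      case 3
      then show ?thesis
        using k2[of "(r (a * x), y)" "(x, a * y)"] rA(2)[OF 3(3,3,2)] unfolding G_def by auto
    qed
  qed
  have grp: "group G" by (simp add: G_def)
  have H: "subgroup H G"
    unfolding H_def tensor_null_def G_def[symmetric] by (rule group.generate_is_subgroup[OF grp rels_sub])
  have H_rel: "x \<in> H" if "x \<in> tensor_rels (ring_on A) N ?B" for x
    unfolding H_def tensor_null_def using that by (rule generate.incl)
  have H_keys: "Poly_Mapping.keys x \<subseteq> r ` A \<times> UNIV" if "x \<in> H" for x
    using subgroup.subset[OF H] that G_keys by blast
  have H_add: "x + y \<in> H" if "x \<in> H" "y \<in> H" for x y
    using subgroup.m_closed[OF H that] by (simp add: G_def)
  have H_minus: "- x \<in> H" if "x \<in> H" for x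
    using subgroup.m_inv_closed[OF H that] H_keys[OF that] by (simp add: G_def)
  have H_0: "0 \<in> H" using subgroup.one_closed[OF H] by (simp add: G_def)
  have rel_add1: "frag_of (r (x + x'), y) - frag_of (x, y) - frag_of (x', y) \<in> H" if "x \<in> r ` A" "x' \<in> r ` A" for x x' y
    by (rule H_rel) (use that in \<open>unfold tensor_rels_def, simp, blast\<close>)
  have rel_add2: "frag_of (x, y + y') - frag_of (x, y) - frag_of (x, y') \<in> H" if "x \<in> r ` A" for x y y'
    by (rule H_rel) (use that in \<open>unfold tensor_rels_def, simp, blast\<close>)
  have rel_mult: "frag_of (r (a * x), y) - frag_of (x, a * y) \<in> H" if "a \<in> A" "x \<in> r ` A" for a x y
    by (rule H_rel) (use that in \<open>unfold tensor_rels_def, simp, blast\<close>)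
  have zero_tensor: "frag_of (r 0, y) \<in> H" for y
  proof -
    have "r 0 \<in> r ` A" using A_closed by blast
    moreover have "r (r 0 + r 0) = r 0" using r_add1[OF A_closed(1) r(1)[OF A_closed(1)]] rr[OF A_closed(1)] by simp
    ultimately have "frag_of (r 0, y) - frag_of (r 0, y) - frag_of (r 0, y) \<in> H" using rel_add1[of "r 0" "r 0" y] by simp
    then show ?thesis using H_minus by fastforce
  qed
  have J_tensor: "frag_of (x, a * y) \<in> H" if x: "x \<in> r ` A" and a: "a \<in> A" "\<And>x. x \<in> A \<Longrightarrow> a * x \<in> ?J" for x a y
  proof -
    have "r (a * x) = r 0" by (rule r_eq) (use a(2) N_A(1) x in auto)
    then have "frag_of (r 0, y) - frag_of (x, a * y) \<in> H" using rel_mult[OF a(1) x, of y] by simp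
    then have "- (frag_of (r 0, y) - frag_of (x, a * y)) + frag_of (r 0, y) \<in> H"
      by (intro H_add H_minus zero_tensor)
    then show ?thesis by simp
  qed
  have phi_tensor: "frag_of (\<phi> x, y) \<in> H" if x: "x \<in> r ` A" for x y
  proof -
    have f: "frag_of (x, (- f) * (W * y)) \<in> H"
      by (rule J_tensor[OF x]) (use fgp A_closed J_f J_minus in auto)
    have g: "frag_of (x, g * (V * y)) \<in> H"
      by (rule J_tensor[OF x]) (use fgp J_f in auto)
    have "frag_of (x, g * (V * y) + (- f) * (W * y)) \<in> H"
      using H_add[OF H_add[OF rel_add2[OF x, of "g * (V * y)" "(- f) * (W * y)"] f] g] by simp
    moreover have "g * (V * y) + (- f) * (W * y) = p * y" unfolding rel by (simp add: algebra_simps)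
    ultimately have "frag_of (x, p * y) \<in> H" by simp
    from H_add[OF rel_mult[OF fgp(3) x, of y] this] show ?thesis by (simp add: \<phi>_def)
  qed
  have extend: "frag_extend (\<lambda>(x, y). frag_of (\<phi> x, y)) c \<in> H" if "Poly_Mapping.keys c \<subseteq> r ` A \<times> UNIV" for c
    using that
  proof (induction c rule: frag_induction)
    case (diff a b)
    then show ?case using H_add[OF _ H_minus] by (simp add: frag_extend_diff)
  qed (auto simp: H_0 phi_tensor)
  have collapse: "tensor_map (ring_on A) N ?B \<phi> (H #>\<^bsub>G\<^esub> c) = H" if c: "c \<in> carrier G" for c
  proof -
    have "H #>\<^bsub>G\<^esub> frag_extend (\<lambda>(x, y). frag_of (\<phi> x, y)) c' = H" if "c' \<in> H #>\<^bsub>G\<^esub> c" for c'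
    proof -
      have "c' \<in> carrier G" using monoid.r_coset_subset_G[OF group.is_monoid[OF grp] subgroup.subset[OF H] c] that by blast
      then show ?thesis using extend[of c'] group.coset_join2[OF grp _ H] H_keys[of "frag_extend (\<lambda>(x, y). frag_of (\<phi> x, y)) c'"]
        by (simp add: G_keys)
    qed
    moreover have "c \<in> H #>\<^bsub>G\<^esub> c" by (rule group.rcos_self[OF grp c H]) 
    ultimately show ?thesis unfolding tensor_map_def H_def[symmetric] G_def[symmetric] by blast
  qed
  define u where "u = (frag_of (r 1, 1) :: 'b \<times> 'b \<Rightarrow>\<^sub>0 int)"
  have u: "u \<in> carrier G" using A_closed by (simp add: u_def G_keys keys_frag_of)
  have z: "0 \<in> carrier G" by (simp add: G_keys)
  have carr: "H #>\<^bsub>G\<^esub> c \<in> carrier (tensor (ring_on A) N ?B)" if "c \<in> carrier G" for c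
    unfolding tensor_def FactGroup_def RCOSETS_def H_def[symmetric] G_def[symmetric] using that by auto
  have "inj_on (tensor_map (ring_on A) N ?B \<phi>) (carrier (tensor (ring_on A) N ?B))"
    using flat modN phi_lin phi_inj unfolding flat_def by blast
  then have "H #>\<^bsub>G\<^esub> u = H #>\<^bsub>G\<^esub> 0"
    using carr[OF u] carr[OF z] collapse[OF u] collapse[OF z] by (metis inj_onD)
  moreover have "H #>\<^bsub>G\<^esub> 0 = H" using group.coset_join2[OF grp z H] H_0 by simp
  moreover have "u \<in> H #>\<^bsub>G\<^esub> u" by (rule group.rcos_self[OF grp u H])
  ultimately have uH: "u \<in> H" by simp
  \<comment> \<open>multiplication \<open>N \<times> B \<rightarrow> B/(f,g)B\<close> kills all relations of the tensor product, but not the class of \<open>1\<close>\<close>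
  define I where "I = {a * f + b * g | a b. True}"
  have I: "ideal_closed I" unfolding I_def by (rule ideal_closed_two)
  have J_I: "x \<in> I" if "x \<in> ?J" for x using that unfolding J_def I_def by (auto simp: mult.commute) 
  define \<psi> where "\<psi> c = (\<Sum>k\<in>Poly_Mapping.keys c. of_int (Poly_Mapping.lookup c k) * (fst k * snd k))" for c :: "'b \<times> 'b \<Rightarrow>\<^sub>0 int"
  have psi_add: "\<psi> (a + b) = \<psi> a + \<psi> b" for a b
    unfolding \<psi>_def by (rule setsum_keys_plus_distrib) (simp_all add: distrib_right)
  have psi_minus: "\<psi> (- a) = - \<psi> a" for a
    unfolding \<psi>_def by (simp add: sum_negf)
  have psi_diff: "\<psi> (a - b) = \<psi> a - \<psi> b" for a b using psi_add[of a "- b"] psi_minus[of b] by simp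
  have psi_of: "\<psi> (frag_of (x, y)) = x * y" for x y by (simp add: \<psi>_def keys_frag_of)
  have r_I: "(r a - a) * y \<in> I" if "a \<in> A" for a y
  proof -
    have "r a - a \<in> I" using J_I[OF J_minus[OF r(2)[OF that]]] by simp
    then have "y * (r a - a) \<in> I" using I unfolding ideal_closed_def by blast
    then show ?thesis by (simp add: mult.commute)
  qed
  have psi_rel: "\<psi> c \<in> I" if c: "c \<in> tensor_rels (ring_on A) N ?B" for c
  proof -
    have 1: "r (x + x') * y - x * y - x' * y \<in> I" if "x \<in> r ` A" "x' \<in> r ` A" for x x' y
      using r_I[of "x + x'" y] N_A(1)[OF that(1)] N_A(1)[OF that(2)] A_closed(4) by (simp add: algebra_simps)
    have 2: "x * (y + y') - x * y - x * y' \<in> I" for x y y'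
      using I by (simp add: algebra_simps ideal_closed_def)
    have 3: "r (a * x) * y - x * (a * y) \<in> I" if "a \<in> A" "x \<in> r ` A" for a x y
      using r_I[of "a * x" y] N_A(1)[OF that(2)] A_closed(5)[OF that(1)] by (simp add: algebra_simps)
    show ?thesis using c 1 2 3 unfolding tensor_rels_def by (auto simp: psi_diff psi_of)
  qed
  have "\<psi> c \<in> I" if "c \<in> H" for c
    using that unfolding H_def tensor_null_def G_def[symmetric]
  proof (induction rule: generate.induct)
    case one
    show ?case using I by (simp add: G_def \<psi>_def ideal_closed_def)
  next
    case (incl h)
    then show ?case by (rule psi_rel)
  next
    case (inv h)
    then have "h \<in> carrier G" using rels_sub by blast
    then have "inv\<^bsub>G\<^esub> h = - h" by (simp add: G_def)
    then show ?case using ideal_closed_minus[OF I psi_rel[OF inv]] by (simp add: psi_minus)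
  next
    case (eng h1 h2)
    then show ?case using I by (simp add: G_def psi_add ideal_closed_def)
  qed
  then have "\<psi> u \<in> I" using uH by blast
  then have "r 1 \<in> I" by (simp add: u_def psi_of)
  moreover have "1 - r 1 \<in> I" by (rule J_I[OF r(2)[OF A_closed(2)]])
  ultimately have "1 - r 1 + r 1 \<in> I" using I by (simp only: ideal_closed_def)
  then obtain a b where "1 = a * f + b * g" unfolding I_def by auto
  then have "\<exists>a b. a * f + b * g = 1" by metis
  then show False using proper by (simp add: comaximal_iff)
qed

section \<open>Linear changes of coordinates\<close>

lemma mat3_eq_iff:
  fixes A B :: "'a ^ 3 ^ 3"
  shows "A = B \<longleftrightarrow> (\<forall>i j. A $ i $ j = B $ i $ j)"
  by (simp add: vec_eq_iff)

text \<open>Over a principal ideal domain a nonzero row is a multiple of the first row of an invertible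
  matrix: the greatest common divisors of the first two entries, and of the result with the third,
  give the Bezout coefficients that complete it.\<close>
lemma complete_row:
  fixes a b c :: "'r::idom"
  assumes pid: "principal_ideals TYPE('r)" and nz: "(a, b, c) \<noteq> (0, 0, 0)"
  obtains M N :: "'r ^ 3 ^ 3" and d where "M ** N = mat 1" "N ** M = mat 1" "d \<noteq> 0"
    "a = d * M $ 1 $ 1" "b = d * M $ 1 $ 2" "c = d * M $ 1 $ 3"
proof -
  note result = that
  \<comment> \<open>the rows are \<open>e\<alpha> + z\<gamma>\<close>, \<open>\<beta>\<close> and \<open>- w\<alpha> + u\<gamma>\<close> for the basis \<open>\<alpha> = (x, y, 0)\<close>, \<open>\<beta> = (-t, s, 0)\<close>, \<open>\<gamma> = (0, 0, 1)\<close>\<close>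
  have inv: thesis if h: "s * x + t * y = 1" "u * e + w * z = 1"
    and d: "d \<noteq> 0" "a = d * (e * x)" "b = d * (e * y)" "c = d * z" for s t u w x y z d e
  proof -
    define M :: "'r ^ 3 ^ 3" where
      "M = vector [vector [e * x, e * y, z], vector [- t, s, 0], vector [- w * x, - w * y, u]]"
    define N :: "'r ^ 3 ^ 3" where
      "N = vector [vector [u * s, - y, - z * s], vector [u * t, x, - z * t], vector [w, 0, e]]"
    have n: "(1::3) \<noteq> 2" "(1::3) \<noteq> 3" "(2::3) \<noteq> 3" "(2::3) \<noteq> 1" "(3::3) \<noteq> 1" "(3::3) \<noteq> 2" by simp_all
    have mn: "e * x * (u * s) + e * y * (u * t) + z * w = u * e * (s * x + t * y) + w * z"
      "e * x * (- z * s) + e * y * (- z * t) + z * e = - z * e * (s * x + t * y) + z * e"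
      "- t * - y + s * x = s * x + t * y"
      "- w * x * (u * s) + - w * y * (u * t) + u * w = - w * u * (s * x + t * y) + u * w"
      "- w * x * (- z * s) + - w * y * (- z * t) + u * e = w * z * (s * x + t * y) + u * e"
      by (simp_all add: algebra_simps)
    have nm: "u * s * (e * x) + - y * - t + - z * s * (- w * x) = s * x * (u * e + w * z) + t * y"
      "u * s * (e * y) + - y * s + - z * s * (- w * y) = s * y * (u * e + w * z) - s * y"
      "u * t * (e * x) + x * - t + - z * t * (- w * x) = t * x * (u * e + w * z) - t * x"
      "u * t * (e * y) + x * s + - z * t * (- w * y) = t * y * (u * e + w * z) + s * x"
      "w * z + e * u = u * e + w * z"
      by (simp_all add: algebra_simps)
    have "M ** N = mat 1"
      unfolding mat3_eq_iff forall_3 matrix_matrix_mult_def mat_def M_def N_def vec_lambda_beta sum_3 vector_3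
      by (intro conjI) (use mn[unfolded h] h in \<open>simp_all add: n ac_simps\<close>)
    moreover have "N ** M = mat 1"
      unfolding mat3_eq_iff forall_3 matrix_matrix_mult_def mat_def M_def N_def vec_lambda_beta sum_3 vector_3
      by (intro conjI) (use nm[unfolded h] h in \<open>simp_all add: n ac_simps\<close>)
    ultimately show thesis using d by (intro result[of M N d]) (simp_all add: M_def)
  qed
  obtain e s t where e: "e dvd a" "e dvd b" "s * a + t * b = e" using bezout[OF pid] .
  show thesis
  proof (cases "e = 0")
    case True
    then have "a = 0" "b = 0" using e by auto
    then show thesis using nz inv[where s = 1 and x = 1 and t = 0 and y = 0 and u = 0 and e = 0 and w = 1 and z = 1 and d = c] by simp
  next
    case False
    obtain d u w where d: "d dvd e" "d dvd c" "u * e + w * c = d" using bezout[OF pid] .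
    obtain x y where ab: "a = e * x" "b = e * y" using e(1,2) by (elim dvdE)
    obtain e1 z where ec: "e = d * e1" "c = d * z" using d(1,2) by (elim dvdE)
    have "d \<noteq> 0" using False ec by auto
    have "e * (s * x + t * y) = e * 1" using e(3) unfolding ab by (simp add: algebra_simps)
    then have 1: "s * x + t * y = 1" using False by (metis mult_left_cancel)
    have "d * (u * e1 + w * z) = d * 1" using d(3) unfolding ec by (simp add: algebra_simps)
    then have 2: "u * e1 + w * z = 1" using \<open>d \<noteq> 0\<close> by (metis mult_left_cancel)
    show thesis by (rule inv[OF 1 2 \<open>d \<noteq> 0\<close>]) (simp_all add: ab ec mult.assoc)
  qed
qed

definition linear_form :: "'r::comm_ring_1 poly3 \<Rightarrow> bool" where
  "linear_form l \<longleftrightarrow> (\<exists>a b c. l = const3 a * varX + const3 b * varY + const3 c * varZ)"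

lemma linear_coordinates:
  fixes a b c :: "'r::idom"
  assumes pid: "principal_ideals TYPE('r)" and nz: "(a, b, c) \<noteq> (0, 0, 0)"
  obtains U V W \<tau> d where "linear_change U V W" "d \<noteq> 0"
    "const3 a * varX + const3 b * varY + const3 c * varZ = const3 d * U"
    "linear_form U" "linear_form V" "linear_form W"
    "rhom \<tau>" "\<And>c. \<tau> (const3 c) = const3 c" "\<tau> U = varX" "\<tau> V = varY" "\<tau> W = varZ"
    "\<And>p. eval3 const3 U V W (\<tau> p) = p"
proof -
  obtain M N :: "'r ^ 3 ^ 3" and d where MN: "M ** N = mat 1" "N ** M = mat 1" and d: "d \<noteq> 0"
    "a = d * M $ 1 $ 1" "b = d * M $ 1 $ 2" "c = d * M $ 1 $ 3" using complete_row[OF pid nz] .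
  define L where "L A i = const3 (A $ i $ 1) * varX + const3 (A $ i $ 2) * varY + const3 (A $ i $ 3) * varZ"
    for A :: "'r ^ 3 ^ 3" and i
  have expand: "h (L A i) = const3 (A $ i $ 1) * h varX + const3 (A $ i $ 2) * h varY + const3 (A $ i $ 3) * h varZ"
    if "rhom h" "\<And>c. h (const3 c) = const3 c" for h A i
    by (simp add: L_def rhom_simps[OF that(1)] that(2))
  have comp: "const3 (A $ i $ 1) * L B 1 + const3 (A $ i $ 2) * L B 2 + const3 (A $ i $ 3) * L B 3 = L (A ** B) i" for A B i
    by (simp add: L_def matrix_matrix_mult_def sum_3 rhom_simps[OF rhom_const3] algebra_simps)
  have L1: "L (mat 1) 1 = varX" "L (mat 1) 2 = varY" "L (mat 1) 3 = varZ"
    by (simp_all add: L_def mat_def rhom_simps[OF rhom_const3])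
  define \<sigma> where "\<sigma> = eval3 const3 (L M 1) (L M 2) (L M 3)"
  define \<tau> where "\<tau> = eval3 const3 (L N 1) (L N 2) (L N 3)"
  have s: "rhom \<sigma>" "\<And>c. \<sigma> (const3 c) = const3 c" "\<sigma> varX = L M 1" "\<sigma> varY = L M 2" "\<sigma> varZ = L M 3"
    unfolding \<sigma>_def by (simp_all add: rhom_eval3 rhom_const3 eval3_gens)
  have t: "rhom \<tau>" "\<And>c. \<tau> (const3 c) = const3 c" "\<tau> varX = L N 1" "\<tau> varY = L N 2" "\<tau> varZ = L N 3"
    unfolding \<tau>_def by (simp_all add: rhom_eval3 rhom_const3 eval3_gens)
  have tL: "\<tau> (L M i) = L (mat 1) i" "\<sigma> (L N i) = L (mat 1) i" for i
    by (simp_all add: expand[OF t(1,2)] expand[OF s(1,2)] s t comp MN)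
  have id: "rhom (\<lambda>p :: 'r poly3. p)" by (simp add: rhom_def)
  show thesis
  proof (rule that[of "L M 1" "L M 2" "L M 3" d \<tau>])
    show "linear_change (L M 1) (L M 2) (L M 3)"
      unfolding linear_change_def
      by (rule exI[of _ M])
        (use MN in \<open>auto simp: invertible_def vec_eq_iff forall_3 matrix_vector_mult_def sum_3 L_def\<close>)
    show "const3 a * varX + const3 b * varY + const3 c * varZ = const3 d * L M 1"
      by (simp add: d L_def rhom_simps[OF rhom_const3] algebra_simps)
    show "linear_form (L M 1)" "linear_form (L M 2)" "linear_form (L M 3)"
      unfolding linear_form_def L_def by blast+
    show "eval3 const3 (L M 1) (L M 2) (L M 3) (\<tau> p) = p" for p
      unfolding \<sigma>_def[symmetric]
      by (rule rhom_eqI[OF rhom_comp[OF s(1) t(1)] id]) (simp_all add: s(2) t tL L1)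
  qed (use d t tL L1 in auto)
qed

section \<open>Derivations in adapted coordinates\<close>

text \<open>The automorphism \<open>\<tau>\<close> returns the coordinates \<open>U, V, W\<close> to \<open>X, Y, Z\<close>; conjugation by it reduces
  statements about \<open>D\<close> to the case \<open>D X = 0\<close>.\<close>
locale adapted_coordinates =
  fixes D :: "'r::idom poly3 \<Rightarrow> 'r poly3" and U V W :: "'r poly3" and \<tau> :: "'r poly3 \<Rightarrow> 'r poly3"
  assumes pid: "principal_ideals TYPE('r)" and inf: "infinite (UNIV :: 'r set)"
    and char0: "\<And>n. of_nat (Suc n) \<noteq> (0 :: 'r)"
    and der: "derivation scalars D" and irr: "\<not> reducible_der D"
    and DU: "D U = 0" and sqV: "D (D V) = 0" and sqW: "D (D W) = 0"
    and tau: "rhom \<tau>" "\<And>c. \<tau> (const3 c) = const3 c" "\<tau> U = varX" "\<tau> V = varY" "\<tau> W = varZ"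
    and sigma_tau: "\<And>p. eval3 const3 U V W (\<tau> p) = p"
begin

abbreviation \<sigma> where "\<sigma> \<equiv> eval3 const3 U V W"
abbreviation f where "f \<equiv> D V"
abbreviation g where "g \<equiv> D W"
abbreviation RU where "RU \<equiv> adjoin scalars {U}"
definition p where "p = g * V - f * W"

lemmas d = derivation_simps[OF der]

lemma sigma: "rhom \<sigma>" "\<sigma> (const3 c) = const3 c" "\<sigma> varX = U" "\<sigma> varY = V" "\<sigma> varZ = W"
  by (simp_all add: rhom_eval3 rhom_const3 eval3_gens)

lemma tau_sigma: "\<tau> (\<sigma> q) = q"
proof -
  have "rhom (\<lambda>p :: 'r poly3. p)" by (simp add: rhom_def)
  then show ?thesis
    by (rule rhom_eqI[OF rhom_comp[OF tau(1) sigma(1)]]) (simp_all add: sigma tau)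
qed

lemma generated: "adjoin scalars {U, V, W} = UNIV"
proof -
  have a: "subring_closed (adjoin scalars {U, V, W})" by (rule subring_adjoin)
  have "\<sigma> q \<in> adjoin scalars {U, V, W}" for q
  proof (induction q rule: poly3_induct)
    case (5 a b)
    then show ?case using a by (simp add: rhom_simps[OF sigma(1)] subring_closed_def)
  next
    case (6 a b)
    then show ?case using a by (simp add: rhom_simps[OF sigma(1)] subring_closed_def)
  qed (auto simp: sigma scalars_def intro: adjoin_incl)
  then show ?thesis using sigma_tau by (metis UNIV_eq_I)
qed

lemma subring_UNIV: "subring_closed C \<Longrightarrow> scalars \<subseteq> C \<Longrightarrow> U \<in> C \<Longrightarrow> V \<in> C \<Longrightarrow> W \<in> C \<Longrightarrow> q \<in> C"
  using adjoin_least[of C scalars "{U, V, W}"] generated by auto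

lemma subring_ideal_preimage: "ideal_closed I \<Longrightarrow> subring_closed {h. D h \<in> I}"
  unfolding subring_closed_def
proof (intro conjI ballI)
  assume I: "ideal_closed I"
  show "1 \<in> {h. D h \<in> I}" using I by (simp add: d ideal_closed_def)
  show "- x \<in> {h. D h \<in> I}" if "x \<in> {h. D h \<in> I}" for x
    using ideal_closed_minus[OF I] that by (simp add: d)
  fix x y assume xy: "x \<in> {h. D h \<in> I}" "y \<in> {h. D h \<in> I}"
  then show "x + y \<in> {h. D h \<in> I}" using I by (simp add: d ideal_closed_def)
  have "x * D y + y * D x \<in> I" using xy I unfolding ideal_closed_def by blast
  then show "x * y \<in> {h. D h \<in> I}" by (simp add: d mult.commute)
qed

lemma D_in_ideal: "ideal_closed I \<Longrightarrow> f \<in> I \<Longrightarrow> g \<in> I \<Longrightarrow> D h \<in> I"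
proof -
  assume I: "ideal_closed I" and fg: "f \<in> I" "g \<in> I"
  have "0 \<in> I" using I by (simp add: ideal_closed_def)
  have "h \<in> {h. D h \<in> I}"
  proof (rule subring_UNIV[OF subring_ideal_preimage[OF I]])
    show "scalars \<subseteq> {h. D h \<in> I}" using \<open>0 \<in> I\<close> by (auto simp: scalars_def d(3))
  qed (simp_all add: DU \<open>0 \<in> I\<close> fg)
  then show ?thesis by simp
qed

text \<open>A common divisor of \<open>f\<close> and \<open>g\<close> divides all values of \<open>D\<close>, and \<open>D\<close> is irreducible.\<close>
lemma common_divisor_unit: "y dvd f \<Longrightarrow> y dvd g \<Longrightarrow> y dvd 1"
  using D_in_ideal[OF ideal_closed_dvd[of y]] irr unfolding reducible_der_def by blast

lemma univariate_image: "RU = range (\<lambda>q. \<sigma> (emb q))"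
proof
  note emb = rhom_emb
  have "const3 c \<in> range (\<lambda>q. \<sigma> (emb q))" for c
    using rangeI[of "\<lambda>q. \<sigma> (emb q)" "[:c:]"] unfolding const3_emb[symmetric] sigma .
  moreover have "U \<in> range (\<lambda>q. \<sigma> (emb q))"
    using rangeI[of "\<lambda>q. \<sigma> (emb q)" "[:0, 1:]"] unfolding varX_def[symmetric] sigma .
  ultimately show "RU \<subseteq> range (\<lambda>q. \<sigma> (emb q))"
    by (intro adjoin_least subring_range rhom_comp[OF sigma(1) emb]) (auto simp: scalars_def)
  have "emb q \<in> {q. \<sigma> q \<in> RU}" for q :: "'r poly"
  proof -
    have "subring_closed {q. \<sigma> q \<in> RU}"
      using subring_adjoin[of scalars "{U}"] by (simp add: subring_closed_def rhom_simps[OF sigma(1)])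
    moreover have "scalars \<subseteq> {q. \<sigma> q \<in> RU}" "{varX} \<subseteq> {q. \<sigma> q \<in> RU}"
      by (auto simp: scalars_def sigma intro: adjoin_incl)
    ultimately have "adjoin scalars {varX} \<subseteq> {q. \<sigma> q \<in> RU}" by (rule adjoin_least)
    then show ?thesis unfolding adjoin_emb by blast
  qed
  then show "range (\<lambda>q. \<sigma> (emb q)) \<subseteq> RU" by blast
qed

lemma normal_form:
  obtains f0 g0 s t k where "f = \<sigma> (emb f0)" "g = \<sigma> (emb g0)" "s * f0 + t * g0 = [:k:]" "k \<noteq> 0"
    "Ker D = adjoin scalars {U, p}"
proof -
  define E where "E h = \<tau> (D (\<sigma> h))" for h
  note s = rhom_simps[OF sigma(1)] and t = rhom_simps[OF tau(1)]
  have E: "derivation scalars E"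
    unfolding derivation_def E_def scalars_def by (auto simp: s t d sigma tau tau_sigma)
  have irrE: "\<not> reducible_der E"
  proof
    assume "reducible_der E"
    then obtain b where b: "\<not> b dvd 1" "\<And>h. b dvd E h" unfolding reducible_der_def by blast
    have "\<sigma> b dvd D h" for h
    proof -
      obtain c where "E (\<tau> h) = b * c" using b(2) by (meson dvdE)
      then have "\<sigma> (E (\<tau> h)) = \<sigma> b * \<sigma> c" by (simp add: s)
      then show ?thesis by (simp add: E_def sigma_tau)
    qed
    then have "\<sigma> b dvd 1" using irr unfolding reducible_der_def by blast
    then obtain c where "1 = \<sigma> b * c" by (elim dvdE)
    then have "1 = b * \<tau> c" using t(2,4) tau_sigma by metis
    then show False using b(1) by (metis dvd_triv_left)
  qed
  have EX: "E varX = 0" by (simp add: E_def sigma DU t)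
  have EY: "E varY = \<tau> f" "E varZ = \<tau> g" by (simp_all add: E_def sigma)
  have sq: "E (E varY) = 0" "E (E varZ) = 0" unfolding EY by (simp_all add: E_def sigma_tau sqV sqW t)
  obtain a b where ab: "(a, b) \<noteq> (0, 0)" "emb a * E varY + emb b * E varZ = 0"
    using dependence_over_univariate[OF inf E char0 EX sq] by blast
  obtain f0 g0 s t k where c: "E varY = emb f0" "E varZ = emb g0" "s * f0 + t * g0 = [:k:]" "k \<noteq> 0"
    using coefficients_univariate[OF pid E irrE EX ab] .
  have f: "f = \<sigma> (emb f0)" "g = \<sigma> (emb g0)" using c(1,2) unfolding EY by (metis sigma_tau)+
  define p0 where "p0 = emb g0 * varY - emb f0 * varZ"
  have p0: "\<sigma> p0 = p" unfolding p0_def p_def f by (simp only: s sigma)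
  have kerE: "Ker E = adjoin scalars {varX, p0}"
    unfolding p0_def by (rule kernel_normal_form[OF pid E char0 irrE EX c])
  have "Ker D \<subseteq> adjoin scalars {U, p}"
  proof
    fix b assume "b \<in> Ker D"
    then have "\<tau> b \<in> Ker E" by (simp add: Ker_def E_def sigma_tau t)
    moreover have "adjoin scalars {varX, p0} \<subseteq> {q. \<sigma> q \<in> adjoin scalars {U, p}}"
    proof (rule adjoin_least)
      show "subring_closed {q. \<sigma> q \<in> adjoin scalars {U, p}}"
        using subring_adjoin[of scalars "{U, p}"] by (simp add: subring_closed_def s)
    qed (auto simp: scalars_def sigma p0 intro: adjoin_incl)
    ultimately have "\<sigma> (\<tau> b) \<in> adjoin scalars {U, p}" using kerE by auto
    then show "b \<in> adjoin scalars {U, p}" by (simp add: sigma_tau)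
  qed
  moreover have "adjoin scalars {U, p} \<subseteq> Ker D"
    by (rule adjoin_least[OF subring_Ker[OF der]]) (auto simp: scalars_def Ker_def d DU sqV sqW p_def)
  ultimately show thesis using that[of f0 g0 s t k] f c(3,4) by blast
qed

lemma kernel: "Ker D = adjoin scalars {U, p}"
proof -
  obtain f0 g0 s t k where "f = \<sigma> (emb f0)" "g = \<sigma> (emb g0)" "s * f0 + t * g0 = [:k:]" "k \<noteq> 0"
    "Ker D = adjoin scalars {U, p}" by (rule normal_form) (rule that)
  then show ?thesis by simp
qed

lemma univariate: "f \<in> RU" "g \<in> RU"
proof -
  obtain f0 g0 s t k where c: "f = \<sigma> (emb f0)" "g = \<sigma> (emb g0)" "s * f0 + t * g0 = [:k:]" "k \<noteq> 0"
    "Ker D = adjoin scalars {U, p}" by (rule normal_form) (rule that)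
  show "f \<in> RU" unfolding univariate_image c(1) by (rule rangeI)
  show "g \<in> RU" unfolding univariate_image c(2) by (rule rangeI)
qed

lemma U_subset_Ker: "RU \<subseteq> Ker D"
  by (rule adjoin_least[OF subring_Ker[OF der]]) (auto simp: scalars_def Ker_def d DU)

lemma bezout_constant:
  obtains S T k where "S * f + T * g = const3 k" "k \<noteq> 0"
proof -
  obtain f0 g0 s t k where "f = \<sigma> (emb f0)" "g = \<sigma> (emb g0)" "s * f0 + t * g0 = [:k:]" "k \<noteq> 0"
    "Ker D = adjoin scalars {U, p}" by (rule normal_form) (rule that)
  moreover have r: "rhom (\<lambda>q :: 'r poly. \<sigma> (emb q))" by (rule rhom_comp[OF sigma(1) rhom_emb])
  ultimately have "\<sigma> (emb s) * f + \<sigma> (emb t) * g = const3 k"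
    using rhom_simps(3)[OF r, of "s * f0" "t * g0"] rhom_simps(4)[OF r] by (simp only: const3_emb[symmetric] sigma)
  then show thesis using that \<open>k \<noteq> 0\<close> by blast
qed

text \<open>The retraction of \<open>B\<close> onto \<open>R[U]\<close> that sends \<open>V\<close> and \<open>W\<close> to \<open>0\<close>.\<close>
definition ret where "ret h = \<sigma> (eval3 const3 varX 0 0 (\<tau> h))"

lemma rhom_ret: "rhom ret"
  unfolding ret_def by (intro rhom_comp[OF sigma(1) rhom_comp[OF rhom_eval3[OF rhom_const3] tau(1)]])

lemma ret_gens: "ret (const3 c) = const3 c" "ret U = U" "ret V = 0" "ret W = 0"
  unfolding ret_def by (simp_all add: tau eval3_gens[OF rhom_const3] sigma rhom_simps[OF sigma(1)])

lemma ret_fixes: "q \<in> RU \<Longrightarrow> ret q = q"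
proof -
  have "RU \<subseteq> {q. ret q = q}"
    by (rule adjoin_least) (auto simp: subring_closed_def rhom_simps[OF rhom_ret] scalars_def ret_gens)
  then show "q \<in> RU \<Longrightarrow> ret q = q" by blast
qed

lemma ret_into: "ret q \<in> RU"
proof (rule CollectD[OF subring_UNIV[of "{q. ret q \<in> RU}"]])
  show "subring_closed {q. ret q \<in> RU}"
    using subring_adjoin[of scalars "{U}"] by (simp add: subring_closed_def rhom_simps[OF rhom_ret])
qed (auto simp: scalars_def ret_gens subring_closed_0[OF subring_adjoin] intro: adjoin_incl)

lemma p_specialization:
  obtains \<eta> e where "rhom \<eta>" "\<And>c. \<eta> (const3 c) = [:[:c:]:]" "\<eta> U = [:[:0, 1:]:]" "\<eta> p = [:0, e:]" "e \<noteq> 0"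
proof -
  obtain f0 g0 s t k where c: "f = \<sigma> (emb f0)" "g = \<sigma> (emb g0)" "s * f0 + t * g0 = [:k:]" "k \<noteq> 0"
    "Ker D = adjoin scalars {U, p}" by (rule normal_form) (rule that)
  define p0 where "p0 = emb g0 * varY - emb f0 * varZ"
  have "\<sigma> p0 = p" unfolding p0_def p_def c by (simp only: rhom_simps[OF sigma(1)] sigma)
  then have p0: "\<tau> p = p0" using tau_sigma by metis
  obtain \<eta> e where eta: "rhom \<eta>" "\<And>q. \<eta> (emb q) = [:q:]" "\<eta> p0 = [:0, e:]" "e \<noteq> 0"
  proof (cases "g0 = 0")
    case False
    then show ?thesis using that specialization(1)[where f = f0 and g = g0] unfolding p0_def by blast
  next
    case True
    then have "- f0 \<noteq> 0" using c by auto
    then show ?thesis using that specialization(2)[where f = f0 and g = g0] unfolding p0_def by blast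
  qed
  show thesis
  proof (rule that[of "\<lambda>h. \<eta> (\<tau> h)" e])
    show "rhom (\<lambda>h. \<eta> (\<tau> h))" by (rule rhom_comp[OF eta(1) tau(1)])
    show "\<eta> (\<tau> (const3 c)) = [:[:c:]:]" for c unfolding tau unfolding const3_emb by (rule eta)
    show "\<eta> (\<tau> U) = [:[:0, 1:]:]" unfolding tau varX_def by (rule eta)
  qed (use eta p0 in auto)
qed

lemma p_nonzero: "p \<noteq> 0"
proof -
  obtain \<eta> e where "rhom \<eta>" "\<And>c. \<eta> (const3 c) = [:[:c:]:]" "\<eta> U = [:[:0, 1:]:]" "\<eta> p = [:0, e:]" "e \<noteq> 0"
    by (rule p_specialization) (rule that)
  then show ?thesis using rhom_simps(1) by force
qed

lemma kernel_poly_algebra: "is_poly_algebra 2 scalars (Ker D)"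
proof (rule is_poly_algebraI)
  show "subring_closed (scalars :: 'r poly3 set)" unfolding scalars_def by (rule subring_range[OF rhom_const3])
  have "(\<lambda>i. if i = 0 then U else p) ` {..<2::nat} = {U, p}" by (auto simp: numeral_2_eq_2 lessThan_Suc)
  then show "Ker D = adjoin scalars ((\<lambda>i. if i = 0 then U else p) ` {..<2::nat})" using kernel by simp
  fix P assume P: "P \<in> mpolys 2 scalars" "mpoly_at (\<lambda>i. if i = 0 then U else p) P = 0"
  obtain \<eta> e where "rhom \<eta>" "\<And>c. \<eta> (const3 c) = [:[:c:]:]" "\<eta> U = [:[:0, 1:]:]" "\<eta> p = [:0, e:]" "e \<noteq> 0"
    by (rule p_specialization) (rule that)
  from independent_two[OF this P] show "P = 0" .
qed

lemma gcd_one: "isgcd (ring_on RU) 1 f g"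
  unfolding isgcd_def factor_def ring_on_simps
proof (intro conjI ballI impI)
  have a: "subring_closed (RU)" by (rule subring_adjoin)
  show "\<exists>c\<in>RU. f = 1 * c"
    "\<exists>c\<in>RU. g = 1 * c"
    using univariate by auto
  fix y assume "(\<exists>c\<in>RU. f = y * c) \<and>
    (\<exists>c\<in>RU. g = y * c)"
  then have "y dvd f" "y dvd g" by auto
  then have "y dvd 1" by (rule common_divisor_unit)
  then obtain u where u: "y = const3 u" "u dvd 1" by (rule unit_poly3)
  then obtain v where "1 = u * v" by (elim dvdE)
  then have "1 = y * const3 v" using u rhom_simps(2,4)[OF rhom_const3] by metis
  moreover have "const3 v \<in> RU" by (rule adjoin_incl) (simp add: scalars_def)
  ultimately show "\<exists>c\<in>RU. 1 = y * c" by auto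
qed

text \<open>If \<open>f\<close> divides \<open>g b\<close> then it divides \<open>k b\<close> for the constant \<open>k = S f + T g\<close>, and \<open>k\<close> can be cancelled
  because no prime of \<open>R\<close> divides both \<open>f\<close> and \<open>g\<close>.\<close>
lemma regular_if_not_comaximal:
  assumes "\<not> comaximal f g" shows "regular_sequence f g"
proof -
  have f0: "f \<noteq> 0"
  proof
    assume "f = 0"
    then have "g dvd 1" by (intro common_divisor_unit) simp_all
    then obtain c where "1 = g * c" by (elim dvdE)
    then have "0 * f + c * g = 1" by (simp add: mult.commute)
    then show False using assms comaximal_iff by blast
  qed
  obtain S T k where k: "S * f + T * g = const3 k" "k \<noteq> 0" by (rule bezout_constant)
  have dvd: "f dvd b" if "f dvd g * b" for b
  proof -
    obtain c' where c': "g * b = f * c'" using \<open>f dvd g * b\<close> by (elim dvdE)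
    define c where "c = S * b + T * c'"
    have "f * c = S * f * b + T * (f * c')" by (simp add: c_def algebra_simps)
    also have "\<dots> = (S * f + T * g) * b" unfolding c'[symmetric] by (simp add: algebra_simps)
    finally have fc: "f * c = const3 k * b" by (simp only: k)
    have "f * (g * c) = const3 k * (g * b)" using fc by (metis mult.left_commute)
    then have "f * (g * c) = f * (const3 k * c')" unfolding c' by (simp add: mult.left_commute)
    then have gc: "g * c = const3 k * c'" using f0 by simp
    have "const3 k dvd c"
    proof (rule constant_dvd_cancel[OF pid _ k(2)])
      show "\<not> (const3 q dvd f \<and> const3 q dvd g)" if "prime_elem q" for q
        using common_divisor_unit[of "const3 q"] that by (auto simp: const3_unit_iff prime_elem_def)
    qed (simp_all add: fc gc)
    then obtain c1 where "c = const3 k * c1" by (elim dvdE)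
    then have "const3 k * (f * c1) = const3 k * b" using fc by (simp add: mult.left_commute)
    then have "f * c1 = b" using k(2) by simp
    then show ?thesis by (metis dvd_triv_left)
  qed
  show ?thesis
    unfolding regular_sequence_def
  proof (intro conjI allI impI)
    show "b = 0" if "f * b = 0" for b using that f0 by simp
    show "f dvd b" if "f dvd g * b" for b using that by (rule dvd)
    show "genideal (ring_on UNIV) {f, g} \<noteq> UNIV" using assms by (simp add: comaximal_def)
  qed
qed

text \<open>Both ideals are generated by the values of \<open>D\<close> at the coordinates.\<close>
lemma comaximal_iff_fixed_point_free: "comaximal f g \<longleftrightarrow> fixed_point_free D"
proof -
  have "{f, g} \<subseteq> I \<longleftrightarrow> range D \<subseteq> I" if "ideal_closed I" for I
    using D_in_ideal[OF that] by auto
  then have "{I. ideal_closed I \<and> {f, g} \<subseteq> I} = {I. ideal_closed I \<and> range D \<subseteq> I}" by blast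
  then show ?thesis unfolding comaximal_def fixed_point_free_def genideal_eq by simp
qed

lemma rank_le: "i \<le> 3 \<Longrightarrow> coordinate_system 3 scalars Xs \<Longrightarrow> adjoin scalars (set (drop i Xs)) \<subseteq> Ker D \<Longrightarrow>
    rank_der 3 scalars D \<le> i"
  unfolding rank_der_def by (intro Least_le) blast

lemma rank_le_2: "rank_der 3 scalars D \<le> 2"
proof (rule rank_le)
  have "{V, W, U} = {U, V, W}" by blast
  then show "coordinate_system 3 scalars [V, W, U]" by (simp add: coordinate_system_def generated)
  show "adjoin scalars (set (drop 2 [V, W, U])) \<subseteq> Ker D" using U_subset_Ker by simp
qed simp

lemma rank_witness:
  obtains Xs where "coordinate_system 3 scalars Xs"
    "adjoin scalars (set (drop (rank_der 3 scalars D) Xs)) \<subseteq> Ker D"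
proof -
  let ?P = "\<lambda>i. i \<le> 3 \<and> (\<exists>Xs. coordinate_system 3 scalars Xs \<and> adjoin scalars (set (drop i Xs)) \<subseteq> Ker D)"
  have "coordinate_system 3 scalars [U, V, W]" by (simp add: coordinate_system_def generated)
  moreover have "adjoin scalars (set (drop 3 [U, V, W])) \<subseteq> Ker D"
    by (rule adjoin_least[OF subring_Ker[OF der]]) (auto simp: scalars_def Ker_def d)
  ultimately have "?P 3" by blast
  then have "?P (rank_der 3 scalars D)" unfolding rank_der_def by (rule LeastI)
  then show thesis using that by blast
qed

lemma rank_positive:
  assumes "D \<noteq> (\<lambda>b. 0)" shows "rank_der 3 scalars D \<noteq> 0"
proof
  assume "rank_der 3 scalars D = 0"
  then obtain Xs where "adjoin scalars (set Xs) = UNIV" "adjoin scalars (set Xs) \<subseteq> Ker D"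
    using rank_witness by (metis coordinate_system_def drop_0)
  then have "\<And>b. D b = 0" by (auto simp: Ker_def)
  then show False using assms by blast
qed

text \<open>If two of three coordinates are in the kernel, the value of \<open>D\<close> at the remaining one divides all
  values of \<open>D\<close>.\<close>
lemma fixed_point_free_if_rank_1:
  assumes "rank_der 3 scalars D = 1" shows "fixed_point_free D"
proof -
  obtain Xs where Xs: "coordinate_system 3 scalars Xs" "adjoin scalars (set (drop 1 Xs)) \<subseteq> Ker D"
    using rank_witness assms by metis
  then obtain x y z where xyz: "Xs = [x, y, z]"
    by (auto simp: coordinate_system_def numeral_3_eq_3 length_Suc_conv)
  have "y \<in> Ker D" "z \<in> Ker D" using Xs(2) adjoin_incl[of _ scalars "{y, z}"] by (auto simp: xyz)
  then have "adjoin scalars {x, y, z} \<subseteq> {h. D h \<in> {w. D x dvd w}}"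
    by (intro adjoin_least subring_ideal_preimage ideal_closed_dvd) (auto simp: scalars_def d Ker_def)
  then have "D x dvd D h" for h using Xs(1) by (auto simp: coordinate_system_def xyz)
  then have "D x dvd 1" using irr unfolding reducible_der_def by blast
  then obtain c where c: "1 = D x * c" by (elim dvdE)
  have "b \<in> I" if "ideal_closed I" "range D \<subseteq> I" for I b
  proof -
    have "D x \<in> I" using that by blast
    then have "(b * c) * D x \<in> I" using that(1) unfolding ideal_closed_def by blast
    moreover have "(b * c) * D x = b" using c by (metis mult.assoc mult.commute mult.right_neutral)
    ultimately show ?thesis by simp
  qed
  then show ?thesis unfolding fixed_point_free_def genideal_eq by blast
qed

text \<open>The Bezout coefficients of \<open>f\<close> and \<open>g\<close> can be moved into \<open>R[U]\<close>, where they are constants of \<open>D\<close>;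
  they then define a slice.\<close>
lemma comaximal_slice:
  assumes "comaximal f g"
  obtains q where "D q = 1" "adjoin (Ker D) {q} = UNIV" "adjoin scalars {q, U, p} = UNIV"
proof -
  obtain a b where ab: "a * f + b * g = 1" using assms comaximal_iff by blast
  define a0 b0 where "a0 = ret a" and "b0 = ret b"
  have "ret (a * f + b * g) = 1" unfolding ab by (rule rhom_simps(2)[OF rhom_ret])
  then have ab0: "a0 * f + b0 * g = 1"
    unfolding a0_def b0_def rhom_simps[OF rhom_ret] ret_fixes[OF univariate(1)] ret_fixes[OF univariate(2)] .
  have in_U: "a0 \<in> RU" "b0 \<in> RU" unfolding a0_def b0_def by (rule ret_into)+
  then have "D a0 = 0" "D b0 = 0" using U_subset_Ker by (auto simp: Ker_def)
  define q where "q = a0 * V + b0 * W"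
  have "D q = 1" unfolding q_def d \<open>D a0 = 0\<close> \<open>D b0 = 0\<close> using ab0 by simp
  have "f * q + b0 * p = (a0 * f + b0 * g) * V" "g * q - a0 * p = (a0 * f + b0 * g) * W"
    unfolding q_def p_def by (simp_all add: algebra_simps)
  then have VW: "V = f * q + b0 * p" "W = g * q - a0 * p" unfolding ab0 by simp_all
  let ?C = "adjoin scalars {q, U, p}"
  have C: "subring_closed ?C" by (rule subring_adjoin)
  have gens: "scalars \<subseteq> ?C" "q \<in> ?C" "U \<in> ?C" "p \<in> ?C" by (auto intro: adjoin_incl)
  have UC: "RU \<subseteq> ?C" using C gens by (intro adjoin_least) auto
  have fgC: "f \<in> ?C" "g \<in> ?C" "a0 \<in> ?C" "b0 \<in> ?C" using UC univariate in_U by blast+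
  have "f * q + b0 * p \<in> ?C" using C fgC gens unfolding subring_closed_def by blast
  then have "V \<in> ?C" using VW(1) by simp
  have "g * q \<in> ?C" "a0 * p \<in> ?C" using C fgC gens unfolding subring_closed_def by blast+
  then have "W \<in> ?C" using VW(2) subring_closed_diff[OF C] by metis
  have all: "?C = UNIV" using subring_UNIV[OF C gens(1,3) \<open>V \<in> ?C\<close> \<open>W \<in> ?C\<close>] by blast
  have "?C \<subseteq> adjoin (Ker D) {q}"
    by (rule adjoin_least[OF subring_adjoin])
      (auto intro!: adjoin_incl simp: scalars_def Ker_def d DU p_def sqV sqW)
  then show thesis using that \<open>D q = 1\<close> all by blast
qed

lemma comaximal_case:
  assumes "comaximal f g" and nz: "D \<noteq> (\<lambda>b. 0)"
  shows "is_poly_algebra 1 (Ker D) UNIV" "rank_der 3 scalars D = 1"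
proof -
  obtain q where q: "D q = 1" "adjoin (Ker D) {q} = UNIV" "adjoin scalars {q, U, p} = UNIV"
    using comaximal_slice[OF assms(1)] .
  note char = of_nat_poly3_nonzero[OF char0]
  show "is_poly_algebra 1 (Ker D) UNIV"
  proof (rule is_poly_algebraI[where T = "\<lambda>_. q"])
    have "(\<lambda>_. q) ` {..<1::nat} = {q}" by auto
    then show "UNIV = adjoin (Ker D) ((\<lambda>_. q) ` {..<1::nat})" using q(2) by simp
  qed (use subring_Ker[OF der] independent_slice[OF der char q(1)] in auto)
  have "rank_der 3 scalars D \<le> 1"
  proof (rule rank_le)
    show "coordinate_system 3 scalars [q, U, p]" using q(3) by (simp add: coordinate_system_def)
    show "adjoin scalars (set (drop 1 [q, U, p])) \<subseteq> Ker D" using kernel by simp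
  qed simp
  then show "rank_der 3 scalars D = 1" using rank_positive[OF nz] by linarith
qed

text \<open>Writing kernel elements as \<open>x\<^sub>0 + p x'\<close> with \<open>x\<^sub>0\<close> in \<open>R[U]\<close> shows that \<open>p\<close> is regular on
  \<open>Ker D / (f, g)\<close>, while \<open>p = g V - f W\<close> vanishes modulo \<open>(f, g) B\<close>.\<close>
lemma not_flat:
  assumes "\<not> comaximal f g"
  shows "\<not> flat (ring_on (Ker D)) (ambient_module :: ('r poly3, 'r poly3) module)"
proof (rule not_flat_of_relation[where f = f and g = g and p = p and V = V and W = W])
  have A: "subring_closed (Ker D)" by (rule subring_Ker[OF der])
  then show "subring_closed (Ker D)" .
  show fgp: "f \<in> Ker D" "g \<in> Ker D" "p \<in> Ker D" by (simp_all add: Ker_def sqV sqW d p_def)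
  show "p = g * V - f * W" by (rule p_def)
  show "\<not> comaximal f g" by (rule assms)
  have U: "subring_closed (RU)" by (rule subring_adjoin)
  let ?C = "{x0 + p * x' | x0 x'. x0 \<in> RU \<and> x' \<in> Ker D}"
  have split: "\<exists>x0 x'. x = x0 + p * x' \<and> x0 \<in> RU \<and> x' \<in> Ker D" if "x \<in> Ker D" for x
  proof -
    have base: "x0 \<in> ?C" if "x0 \<in> RU" for x0
    proof -
      have "x0 = x0 + p * 0" by simp
      then show ?thesis using that subring_closed_0[OF A] by blast
    qed
    have "subring_closed ?C"
      unfolding subring_closed_def
    proof (intro conjI ballI)
      show "1 \<in> ?C" using U by (intro base) (simp add: subring_closed_def)
      fix x assume "x \<in> ?C"
      then obtain x0 x' where x: "x = x0 + p * x'" "x0 \<in> RU" "x' \<in> Ker D" by blast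
      have "- x = - x0 + p * (- x')" by (simp add: x)
      moreover have "- x0 \<in> RU" "- x' \<in> Ker D" using x U A by (auto simp: subring_closed_def)
      ultimately show "- x \<in> ?C" by blast
      fix y assume "y \<in> ?C"
      then obtain y0 y' where y: "y = y0 + p * y'" "y0 \<in> RU" "y' \<in> Ker D" by blast
      have "x + y = (x0 + y0) + p * (x' + y')" by (simp add: x y algebra_simps)
      moreover have "x0 + y0 \<in> RU" "x' + y' \<in> Ker D" using x y U A by (auto simp: subring_closed_def)
      ultimately show "x + y \<in> ?C" by blast
      have "x * y = x0 * y0 + p * (x0 * y' + x' * y0 + p * x' * y')" by (simp add: x y algebra_simps)
      moreover have "x0 \<in> Ker D" "y0 \<in> Ker D" using x y U_subset_Ker by blast+
      then have "x0 * y' + x' * y0 + p * x' * y' \<in> Ker D" using x y A fgp(3) by (auto simp: subring_closed_def)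
      moreover have "x0 * y0 \<in> RU" using x y U by (auto simp: subring_closed_def)
      ultimately show "x * y \<in> ?C" by blast
    qed
    moreover have "p \<in> ?C"
    proof -
      have "p = 0 + p * 1" by simp
      then show ?thesis using subring_closed_0[OF U] A unfolding subring_closed_def by blast
    qed
    ultimately have "adjoin scalars {U, p} \<subseteq> ?C"
      by (intro adjoin_least) (auto intro!: base[simplified] adjoin_incl)
    then show ?thesis using that kernel by blast
  qed
  fix a assume a: "a \<in> Ker D" and "p * a \<in> {f * x + g * y | x y. x \<in> Ker D \<and> y \<in> Ker D}"
  then obtain x y where xy: "p * a = f * x + g * y" "x \<in> Ker D" "y \<in> Ker D" by blast
  obtain x0 x' where x: "x = x0 + p * x'" "x0 \<in> RU" "x' \<in> Ker D" using split[OF xy(2)] by blast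
  obtain y0 y' where y: "y = y0 + p * y'" "y0 \<in> RU" "y' \<in> Ker D" using split[OF xy(3)] by blast
  have eq: "p * (a - (f * x' + g * y')) = f * x0 + g * y0"
    using xy(1) unfolding x y by (simp add: algebra_simps)
  have "ret p = 0" unfolding p_def by (simp add: rhom_simps[OF rhom_ret] ret_gens)
  then have "ret (p * (a - (f * x' + g * y'))) = 0" by (simp add: rhom_simps[OF rhom_ret])
  then have "f * x0 + g * y0 = 0"
    unfolding eq rhom_simps[OF rhom_ret] ret_fixes[OF univariate(1)] ret_fixes[OF univariate(2)]
      ret_fixes[OF x(2)] ret_fixes[OF y(2)] .
  then have "a = f * x' + g * y'" using eq p_nonzero by simp
  then show "a \<in> {f * x + g * y | x y. x \<in> Ker D \<and> y \<in> Ker D}" using x y by blast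
qed

lemma regular_case:
  assumes reg: "regular_sequence f g" and nz: "D \<noteq> (\<lambda>b. 0)"
  shows "\<not> flat (ring_on (Ker D)) (ambient_module :: ('r poly3, 'r poly3) module)" "rank_der 3 scalars D = 2"
proof -
  have nc: "\<not> comaximal f g" using reg by (simp add: regular_sequence_def comaximal_def)
  then show "\<not> flat (ring_on (Ker D)) (ambient_module :: ('r poly3, 'r poly3) module)" by (rule not_flat)
  have "rank_der 3 scalars D \<noteq> 1"
    using fixed_point_free_if_rank_1 comaximal_iff_fixed_point_free nc by blast
  then show "rank_der 3 scalars D = 2" using rank_positive[OF nz] rank_le_2 by linarith
qed

end

section \<open>Irreducible derivations whose square kills the variables\<close>

lemma contains_rat_char_0:
  fixes h :: "rat \<Rightarrow> 'r::idom"
  assumes "h \<in> ring_hom (ring_on UNIV) (ring_on UNIV)" "inj h"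
  shows "infinite (UNIV :: 'r set)" "of_nat (Suc n) \<noteq> (0 :: 'r)"
proof -
  have h: "rhom h" using assms(1) by (auto simp: rhom_def ring_hom_def)
  have "infinite (range h)" using assms(2) infinite_UNIV_char_0 finite_imageD by blast
  then show "infinite (UNIV :: 'r set)" by (rule infinite_super[OF subset_UNIV])
  have "h (of_nat n) = of_nat n" for n by (induction n) (simp_all add: rhom_simps[OF h])
  then show "of_nat (Suc n) \<noteq> (0 :: 'r)"
    using injD[OF assms(2), of "of_nat (Suc n)" 0] rhom_simps(1)[OF h] by (metis of_nat_eq_0_iff Suc_not_Zero)
qed

theorem theorem3p6:
  fixes D :: "'r::idom poly3 \<Rightarrow> 'r poly3"
  assumes pid: "principal_domain (ring_on (UNIV :: 'r set))"
    and contains_rat: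
      "\<exists>h \<in> ring_hom (ring_on (UNIV :: rat set)) (ring_on (UNIV :: 'r set)). inj h"
    and der: "derivation scalars D"
    and nilpotent: "locally_nilpotent D"
    and nonzero: "D \<noteq> (\<lambda>b. 0)"
    and irreducible: "\<not> reducible_der D"
    and sq_X: "D (D varX) = 0"
    and sq_Y: "D (D varY) = 0"
    and sq_Z: "D (D varZ) = 0"
  shows "\<exists>U V W. coordinate_system 3 scalars [U, V, W] \<and> linear_change U V W \<and>
    (\<comment> \<open>(i)\<close>
      (\<exists>a b c. (a, b, c) \<noteq> (0, 0, 0) \<and>
         const3 a * varX + const3 b * varY + const3 c * varZ \<in> Ker D)) \<and>
    (\<comment> \<open>(ii)\<close>
      rank_der 3 scalars D \<le> 2 \<and> is_poly_algebra 2 scalars (Ker D)) \<and>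
    (\<comment> \<open>(iii), (iv)\<close>
      \<exists>f g. D V = f \<and> D W = g \<and>
        f \<in> adjoin scalars {U} \<and> g \<in> adjoin scalars {U} \<and>
        isgcd (ring_on (adjoin scalars {U})) 1 f g \<and>
        Ker D = adjoin scalars {U, g * V - f * W} \<and>
        (comaximal f g \<or> regular_sequence f g) \<and>
        (comaximal f g \<longleftrightarrow> fixed_point_free D) \<and>
        (comaximal f g \<longrightarrow>
           is_poly_algebra 1 (Ker D) UNIV \<and> rank_der 3 scalars D = 1) \<and>
        (regular_sequence f g \<longrightarrow>
           \<not> flat (ring_on (Ker D)) ambient_module \<and> rank_der 3 scalars D = 2))"
proof -
  have pi: "principal_ideals TYPE('r)" using pid by (rule principal_idealsI)
  obtain h :: "rat \<Rightarrow> 'r" where "h \<in> ring_hom (ring_on UNIV) (ring_on UNIV)" "inj h" using contains_rat by blast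
  note char = contains_rat_char_0[OF this]
  note d = derivation_simps[OF der]
  obtain a b c where abc: "(a, b, c) \<noteq> (0, 0, 0)" "const3 a * varX + const3 b * varY + const3 c * varZ \<in> Ker D"
    using linear_form_in_kernel[OF char(1) der char(2) sq_X sq_Y sq_Z] by blast
  obtain U V W \<tau> r where U: "linear_change U V W" "r \<noteq> 0"
    "const3 a * varX + const3 b * varY + const3 c * varZ = const3 r * U"
    and lin: "linear_form U" "linear_form V" "linear_form W"
    and tau: "rhom \<tau>" "\<And>c. \<tau> (const3 c) = const3 c" "\<tau> U = varX" "\<tau> V = varY" "\<tau> W = varZ"
    "\<And>p. eval3 const3 U V W (\<tau> p) = p"
    by (rule linear_coordinates[OF pi abc(1)]) (rule that)
  have "const3 r * D U = 0" using abc(2) unfolding U(3) by (simp add: Ker_def d)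
  then have DU: "D U = 0" using U(2) by simp
  have "D (D l) = 0" if "linear_form l" for l
    using that sq_X sq_Y sq_Z by (auto simp: linear_form_def d)
  then have sq: "D (D V) = 0" "D (D W) = 0" using lin by auto
  interpret adapted_coordinates D U V W \<tau>
    by unfold_locales (use pi char der irreducible DU sq tau in auto)
  have coords: "coordinate_system 3 scalars [U, V, W]" by (simp add: coordinate_system_def generated)
  have kernel_gens: "Ker D = adjoin scalars {U, D W * V - D V * W}" using kernel unfolding p_def .
  have alternative: "comaximal (D V) (D W) \<or> regular_sequence (D V) (D W)"
    using regular_if_not_comaximal by blast
  have comax: "comaximal (D V) (D W) \<longrightarrow> is_poly_algebra 1 (Ker D) UNIV \<and> rank_der 3 scalars D = 1"
    using comaximal_case[OF _ nonzero] by simp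
  have reg: "regular_sequence (D V) (D W) \<longrightarrow>
      \<not> flat (ring_on (Ker D)) (ambient_module :: ('r poly3, 'r poly3) module) \<and> rank_der 3 scalars D = 2"
    using regular_case[OF _ nonzero] by simp
  have form: "\<exists>a b c. (a, b, c) \<noteq> (0, 0, 0) \<and>
      const3 a * varX + const3 b * varY + const3 c * varZ \<in> Ker D"
    by (rule exI[of _ a], rule exI[of _ b], rule exI[of _ c], rule conjI[OF abc])
  show ?thesis
    by (rule exI[of _ U], rule exI[of _ V], rule exI[of _ W], intro conjI;
        (fact coords U(1) form rank_le_2 kernel_poly_algebra)?;
        rule exI[of _ "D V"], rule exI[of _ "D W"], intro conjI;
        fact refl univariate gcd_one kernel_gens alternative comaximal_iff_fixed_point_free comax reg)
qed

end
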